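(* Let $M$ be a Riemannian manifold with metric $\langle\cdot,\cdot\rangle_R$ and Levi-Civita connection $\nabla$, and let $\mathcal{H}\oplus\mathcal{V}\subset TM$ be two orthogonal subbundles, with orthogonal projection operators $\mathrm{H}$ and $\mathrm{V}$ from $TM$ to $\mathcal{H}$ and $\mathcal{V}$. For vector fields $c_1,c_2$, the expression $\mathrm{V}\nabla_{c_1}(\mathrm{H}c_2)$ is a $(1,2)$-tensor. For tangent vectors $\xi,\eta$ at $x\in M$ and vector fields with $c_1(x)=\xi,c_2(x)=\eta$, the map $A_\xi:\eta\mapsto(\mathrm{V}\nabla_{c_1}(\mathrm{H}c_2))_x$ maps $T_xM$ to $T_xM$, and induces an operator on vector fields denoted $A_{c_1}$. Its adjoint $A^\dagger_{c_1}$ in the Riemannian inner product is $-\mathrm{H}\nabla_{c_1}\mathrm{V}$, that is, $$\langle\mathrm{H}\nabla_{c_1}(\mathrm{V}c_3),c_2\rangle_R=-\langle c_3,\mathrm{V}\nabla_{c_1}(\mathrm{H}c_2)\rangle_R$$ for all vector fields $c_1,c_2,c_3$. Further, if $(M,g,\mathcal{E})$ is an embedded ambient structure inducing $\langle\cdot,\cdot\rangle_R$ and $\Gamma$ is a Christoffel function, with $\mathring{\Gamma}(c_1,c_2)=\Gamma(c_1,c_2)+(D_{c_1}\Pi)c_2$, then $$A_{c_1}c_2=-(D_{c_1}\mathrm{V})\mathrm{H}c_2+\mathrm{V}\mathring{\Gamma}(c_1,\mathrm{H}c_2),\qquad A^\dagger_{c_1}c_3=(D_{c_1}\mathrm{H})\mathrm{V}c_3-\mathrm{H}\mathring{\Gamma}(c_1,\mathrm{V}c_3).$$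 For a subbundle $\mathcal{F}$ of $TM$ with projection $\Pi_{\mathcal{F}}$, set $\Gamma_{\mathcal{F}}(\xi,\omega)=-(D_\xi\Pi_{\mathcal{F}})\omega+\Pi_{\mathcal{F}}\mathring{\Gamma}(\xi,\omega)$. Then for tangent vectors $\xi,\eta$ at $x$, $A_\xi\eta=\Gamma_{\mathcal{V}}(\xi,\mathrm{H}\eta)$ and $A^\dagger_\xi\eta=-\Gamma_{\mathcal{H}}(\xi,\mathrm{V}\eta)$ (and likewise for vector fields). If $\mathcal{H}=\mathcal{H}M$ is the horizontal bundle (and $\mathcal{V}$ the vertical bundle) of a Riemannian submersion $q:M\to B$, and $c_1,c_2$ are horizontal vector fields with $c_1(x)=\xi,c_2(x)=\eta$, then $$2A_\xi\eta=(\mathrm{V}[c_1,c_2])_x=(D_\xi\mathrm{H})_x\eta-(D_\eta\mathrm{H})_x\xi.$$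
   Context: $\mathcal{E}$ is a finite-dimensional real inner product space. An embedded ambient structure $(M,g,\mathcal{E})$ is a Riemannian manifold $M$ differentiably embedded in $\mathcal{E}$ (so $T_xM\subset\mathcal{E}$, vector fields are $\mathcal{E}$-valued functions) with a metric operator $g$: a smooth map $M\to L(\mathcal{E},\mathcal{E})$, each $g_x$ (self-adjoint) positive-definite, with $\langle\xi,g_x\eta\rangle_{\mathcal{E}}=\langle\xi,\eta\rangle_R$ on $T_xM$. When an ambient structure is given, $\Pi_x$, $\mathrm{H}_x$, $\mathrm{V}_x$, $\Pi_{\mathcal{F},x}$ denote the projections of all of $\mathcal{E}$ onto $T_xM,\mathcal{H}_x,\mathcal{V}_x,\mathcal{F}_x$ orthogonal for $\langle\cdot,g_x\cdot\rangle_{\mathcal{E}}$ (extending the projections on $T_xM$); they are smooth $L(\mathcal{E},\mathcal{E})$-valued functions on $M$, and $D_\xi$ is their directional derivative. A Christoffel function is a smooth $\Gamma:M\to L(\mathcal{E}\otimes\mathcal{E},\mathcal{E})$ with $\nabla_XY=D_XY+\Gamma(X,Y)$ for all vector fields $X,Y$. $\mathring{\Gamma}(\xi,\omega)=(D_\xi\Pi)\omega+\Gamma(\xi,\omega)$ for $\xi\in T_xM,\omega\in\mathcal{E}$. For a Riemannian submersion $q$, the vertical bundle is $\ker dq$ and the horizontal bundle its orthogonal complement in $TM$. *)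

theory Defs
  imports "HOL-Analysis.Analysis"
begin

section \<open>Smooth maps between open sets of normed spaces\<close>

text \<open>Both notions below are meant for an open set \<open>S\<close>.\<close>

fun Ck_on :: "nat \<Rightarrow> 'a::real_normed_vector set \<Rightarrow> ('a \<Rightarrow> 'b::real_normed_vector) \<Rightarrow> bool" where
  "Ck_on 0 S f \<longleftrightarrow> continuous_on S f"
| "Ck_on (Suc k) S f \<longleftrightarrow> (\<forall>x\<in>S. f differentiable (at x)) \<and>
     (\<forall>v. Ck_on k S (\<lambda>x. frechet_derivative f (at x) v))"

definition smooth_on :: "'a::real_normed_vector set \<Rightarrow> ('a \<Rightarrow> 'b::real_normed_vector) \<Rightarrow> bool" where
  "smooth_on S f \<longleftrightarrow> (\<forall>k. Ck_on k S f)"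


section \<open>Smooth manifolds\<close>

text \<open>A chart is a pair \<open>(U, \<phi>)\<close>; only the values of \<open>\<phi>\<close> on \<open>U\<close> matter. The atlas need not be
  maximal.\<close>

type_synonym ('m, 'n) chart = "'m set \<times> ('m \<Rightarrow> 'n)"

record ('m, 'n) manifold =
  mtop :: "'m topology"
  atlas :: "('m, 'n) chart set"

definition pts :: "('m, 'n) manifold \<Rightarrow> 'm set" where
  "pts M = topspace (mtop M)"

definition chart_inv :: "('m, 'n) chart \<Rightarrow> 'n \<Rightarrow> 'm" where
  "chart_inv c = inv_into (fst c) (snd c)"

definition smooth_manifold :: "('m, 'n::euclidean_space) manifold \<Rightarrow> bool" where
  "smooth_manifold M \<longleftrightarrow>
     Hausdorff_space (mtop M) \<and> second_countable (mtop M) \<and>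
     pts M = (\<Union>c\<in>atlas M. fst c) \<and>
     (\<forall>(U, \<phi>)\<in>atlas M. openin (mtop M) U \<and> open (\<phi> ` U) \<and>
        homeomorphic_map (subtopology (mtop M) U) (top_of_set (\<phi> ` U)) \<phi>) \<and>
     (\<forall>(U, \<phi>)\<in>atlas M. \<forall>(W, \<psi>)\<in>atlas M.
        smooth_on (\<phi> ` (U \<inter> W)) (\<psi> \<circ> chart_inv (U, \<phi>)))"

definition smooth_fun :: "('m, 'n::euclidean_space) manifold \<Rightarrow> ('m \<Rightarrow> 'a::real_normed_vector) \<Rightarrow> bool" where
  "smooth_fun M f \<longleftrightarrow> (\<forall>(U, \<phi>)\<in>atlas M. smooth_on (\<phi> ` U) (f \<circ> chart_inv (U, \<phi>)))"

text \<open>Tangent vectors at \<open>x\<close> are represented by their coordinate vectors in a fixed, arbitrarily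
  chosen chart around \<open>x\<close>. Thus every \<open>T\<^sub>xM\<close> is (a copy of) the model space \<open>'n\<close>, and a vector
  field is a function \<open>'m \<Rightarrow> 'n\<close>. The preferred chart may jump with \<open>x\<close>, so smoothness of a vector
  field is not smoothness of this function; it is defined through genuine local coordinates.\<close>

definition chart_at :: "('m, 'n) manifold \<Rightarrow> 'm \<Rightarrow> ('m, 'n) chart" where
  "chart_at M x = (SOME c. c \<in> atlas M \<and> x \<in> fst c)"

text \<open>The directional derivative \<open>(D\<^sub>\<xi> f)\<^sub>x\<close> of a function with values in a normed space.\<close>

definition dird :: "('m, 'n::euclidean_space) manifold \<Rightarrow> ('m \<Rightarrow> 'a::real_normed_vector) \<Rightarrow> 'm \<Rightarrow> 'n \<Rightarrow> 'a" where
  "dird M f x \<xi> =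
     frechet_derivative (f \<circ> chart_inv (chart_at M x)) (at (snd (chart_at M x) x)) \<xi>"

text \<open>The coordinate expression of the vector field \<open>X\<close> in the chart \<open>c = (U, \<phi>)\<close>: at \<open>\<phi> y\<close> it is
  \<open>D\<^bsub>X(y)\<^esub>\<phi>\<close>.\<close>

definition vf_rep :: "('m, 'n::euclidean_space) manifold \<Rightarrow> ('m, 'n) chart \<Rightarrow> ('m \<Rightarrow> 'n) \<Rightarrow> 'n \<Rightarrow> 'n" where
  "vf_rep M c X p = (let y = chart_inv c p in dird M (snd c) y (X y))"

text \<open>Conversely, the tangent vector at \<open>y\<close> whose coordinate vector in the chart \<open>c\<close> is \<open>a\<close>.\<close>

definition coord_vec :: "('m, 'n::euclidean_space) manifold \<Rightarrow> ('m, 'n) chart \<Rightarrow> 'n \<Rightarrow> 'm \<Rightarrow> 'n" where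
  "coord_vec M c a y = frechet_derivative (snd (chart_at M y) \<circ> chart_inv c) (at (snd c y)) a"

definition smooth_vf_on :: "('m, 'n::euclidean_space) manifold \<Rightarrow> 'm set \<Rightarrow> ('m \<Rightarrow> 'n) \<Rightarrow> bool" where
  "smooth_vf_on M W X \<longleftrightarrow> (\<forall>(U, \<phi>)\<in>atlas M. smooth_on (\<phi> ` (U \<inter> W)) (vf_rep M (U, \<phi>) X))"

abbreviation smooth_vf :: "('m, 'n::euclidean_space) manifold \<Rightarrow> ('m \<Rightarrow> 'n) \<Rightarrow> bool" where
  "smooth_vf M \<equiv> smooth_vf_on M (pts M)"

text \<open>In local coordinates, \<open>[X, Y] = DY(X) - DX(Y)\<close>.\<close>

definition lie_bracket :: "('m, 'n::euclidean_space) manifold \<Rightarrow> ('m \<Rightarrow> 'n) \<Rightarrow> ('m \<Rightarrow> 'n) \<Rightarrow> 'm \<Rightarrow> 'n" where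
  "lie_bracket M X Y x = (let c = chart_at M x; p = snd c x in
     frechet_derivative (vf_rep M c Y) (at p) (X x) -
     frechet_derivative (vf_rep M c X) (at p) (Y x))"

definition smooth_map :: "('m, 'n::euclidean_space) manifold \<Rightarrow> ('b, 'k::euclidean_space) manifold \<Rightarrow> ('m \<Rightarrow> 'b) \<Rightarrow> bool" where
  "smooth_map M B q \<longleftrightarrow> continuous_map (mtop M) (mtop B) q \<and>
     (\<forall>(U, \<phi>)\<in>atlas M. \<forall>(W, \<psi>)\<in>atlas B.
        smooth_on (\<phi> ` {x \<in> U. q x \<in> W}) (\<psi> \<circ> q \<circ> chart_inv (U, \<phi>)))"

definition differential :: "('m, 'n::euclidean_space) manifold \<Rightarrow> ('b, 'k::euclidean_space) manifold \<Rightarrow> ('m \<Rightarrow> 'b) \<Rightarrow> 'm \<Rightarrow> 'n \<Rightarrow> 'k" where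
  "differential M B q x = dird M (snd (chart_at B (q x)) \<circ> q) x"


section \<open>Riemannian metrics, connections, subbundles\<close>

definition riemannian_manifold ::
  "('m, 'n::euclidean_space) manifold \<Rightarrow> ('m \<Rightarrow> 'n \<Rightarrow> 'n \<Rightarrow> real) \<Rightarrow> bool" where
  "riemannian_manifold M R \<longleftrightarrow> smooth_manifold M \<and>
     (\<forall>x\<in>pts M. bilinear (R x) \<and> (\<forall>\<xi> \<eta>. R x \<xi> \<eta> = R x \<eta> \<xi>) \<and> (\<forall>\<xi>. \<xi> \<noteq> 0 \<longrightarrow> R x \<xi> \<xi> > 0)) \<and>
     (\<forall>(U, \<phi>)\<in>atlas M. \<forall>a b. smooth_on (\<phi> ` U)
        ((\<lambda>y. R y (coord_vec M (U, \<phi>) a y) (coord_vec M (U, \<phi>) b y)) \<circ> chart_inv (U, \<phi>)))"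

definition affine_connection ::
  "('m, 'n::euclidean_space) manifold \<Rightarrow> (('m \<Rightarrow> 'n) \<Rightarrow> ('m \<Rightarrow> 'n) \<Rightarrow> 'm \<Rightarrow> 'n) \<Rightarrow> bool" where
  "affine_connection M conn \<longleftrightarrow>
     (\<forall>X Y. smooth_vf M X \<and> smooth_vf M Y \<longrightarrow> smooth_vf M (conn X Y)) \<and>
     (\<forall>X Y Z. smooth_vf M X \<and> smooth_vf M Y \<and> smooth_vf M Z \<longrightarrow> (\<forall>x\<in>pts M.
        conn (\<lambda>y. X y + Y y) Z x = conn X Z x + conn Y Z x \<and>
        conn X (\<lambda>y. Y y + Z y) x = conn X Y x + conn X Z x)) \<and>
     (\<forall>f X Y. smooth_fun M (f :: 'm \<Rightarrow> real) \<and> smooth_vf M X \<and> smooth_vf M Y \<longrightarrow> (\<forall>x\<in>pts M.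
        conn (\<lambda>y. f y *\<^sub>R X y) Y x = f x *\<^sub>R conn X Y x \<and>
        conn X (\<lambda>y. f y *\<^sub>R Y y) x = f x *\<^sub>R conn X Y x + dird M f x (X x) *\<^sub>R Y x))"

definition levi_civita ::
  "('m, 'n::euclidean_space) manifold \<Rightarrow> ('m \<Rightarrow> 'n \<Rightarrow> 'n \<Rightarrow> real) \<Rightarrow>
   (('m \<Rightarrow> 'n) \<Rightarrow> ('m \<Rightarrow> 'n) \<Rightarrow> 'm \<Rightarrow> 'n) \<Rightarrow> bool" where
  "levi_civita M R conn \<longleftrightarrow> affine_connection M conn \<and>
     (\<forall>X Y. smooth_vf M X \<and> smooth_vf M Y \<longrightarrow>
        (\<forall>x\<in>pts M. conn X Y x - conn Y X x = lie_bracket M X Y x)) \<and>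
     (\<forall>X Y Z. smooth_vf M X \<and> smooth_vf M Y \<and> smooth_vf M Z \<longrightarrow>
        (\<forall>x\<in>pts M. dird M (\<lambda>y. R y (Y y) (Z y)) x (X x) =
           R x (conn X Y x) (Z x) + R x (Y x) (conn X Z x)))"

text \<open>A subbundle of \<open>TM\<close> assigns to each point the span of a local frame of smooth vector fields.
  The rank is locally constant.\<close>

definition subbundle :: "('m, 'n::euclidean_space) manifold \<Rightarrow> ('m \<Rightarrow> 'n set) \<Rightarrow> bool" where
  "subbundle M F \<longleftrightarrow> (\<forall>x\<in>pts M. \<exists>W (k::nat) (e :: nat \<Rightarrow> 'm \<Rightarrow> 'n).
     openin (mtop M) W \<and> x \<in> W \<and> (\<forall>i<k. smooth_vf_on M W (e i)) \<and>
     (\<forall>y\<in>W. inj_on (\<lambda>i. e i y) {..<k} \<and> independent ((\<lambda>i. e i y) ` {..<k}) \<and>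
        F y = span ((\<lambda>i. e i y) ` {..<k})))"

definition orthogonal_bundles ::
  "('m, 'n) manifold \<Rightarrow> ('m \<Rightarrow> 'n \<Rightarrow> 'n \<Rightarrow> real) \<Rightarrow> ('m \<Rightarrow> 'n set) \<Rightarrow> ('m \<Rightarrow> 'n set) \<Rightarrow> bool" where
  "orthogonal_bundles M R F G \<longleftrightarrow> (\<forall>x\<in>pts M. \<forall>a\<in>F x. \<forall>b\<in>G x. R x a b = 0)"

text \<open>Orthogonal projection onto the subspace \<open>S\<close>, and adjoint of a linear operator, with respect
  to the inner product \<open>b\<close>.\<close>

definition orth_proj :: "('v::real_vector \<Rightarrow> 'v \<Rightarrow> real) \<Rightarrow> 'v set \<Rightarrow> 'v \<Rightarrow> 'v" where
  "orth_proj b S v = (THE w. w \<in> S \<and> (\<forall>s\<in>S. b (v - w) s = 0))"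

definition adjoint_wrt :: "('v \<Rightarrow> 'v \<Rightarrow> real) \<Rightarrow> ('v \<Rightarrow> 'v) \<Rightarrow> 'v \<Rightarrow> 'v" where
  "adjoint_wrt b T = (THE S. \<forall>v w. b (S v) w = b v (T w))"

definition vf_proj ::
  "('m \<Rightarrow> 'n::real_vector \<Rightarrow> 'n \<Rightarrow> real) \<Rightarrow> ('m \<Rightarrow> 'n set) \<Rightarrow> ('m \<Rightarrow> 'n) \<Rightarrow> 'm \<Rightarrow> 'n" where
  "vf_proj R F c = (\<lambda>x. orth_proj (R x) (F x) (c x))"

definition tensor_1_2 ::
  "('m, 'n::euclidean_space) manifold \<Rightarrow> (('m \<Rightarrow> 'n) \<Rightarrow> ('m \<Rightarrow> 'n) \<Rightarrow> 'm \<Rightarrow> 'n) \<Rightarrow> bool" where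
  "tensor_1_2 M T \<longleftrightarrow>
     (\<forall>X Y. smooth_vf M X \<and> smooth_vf M Y \<longrightarrow> smooth_vf M (T X Y)) \<and>
     (\<forall>X Y Z. smooth_vf M X \<and> smooth_vf M Y \<and> smooth_vf M Z \<longrightarrow> (\<forall>x\<in>pts M.
        T (\<lambda>y. X y + Y y) Z x = T X Z x + T Y Z x \<and>
        T X (\<lambda>y. Y y + Z y) x = T X Y x + T X Z x)) \<and>
     (\<forall>f X Y. smooth_fun M (f :: 'm \<Rightarrow> real) \<and> smooth_vf M X \<and> smooth_vf M Y \<longrightarrow> (\<forall>x\<in>pts M.
        T (\<lambda>y. f y *\<^sub>R X y) Y x = f x *\<^sub>R T X Y x \<and>
        T X (\<lambda>y. f y *\<^sub>R Y y) x = f x *\<^sub>R T X Y x))"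

text \<open>\<open>A\<^sub>\<xi> \<eta> = (V \<nabla>\<^bsub>c\<^sub>1\<^esub>(H c\<^sub>2))\<^sub>x\<close> for any vector fields with \<open>c\<^sub>1(x) = \<xi>\<close>, \<open>c\<^sub>2(x) = \<eta>\<close>; that extensions
  exist and that their choice does not matter has to be proved.\<close>

definition A_tensor ::
  "('m, 'n::euclidean_space) manifold \<Rightarrow> ('m \<Rightarrow> 'n \<Rightarrow> 'n \<Rightarrow> real) \<Rightarrow>
   (('m \<Rightarrow> 'n) \<Rightarrow> ('m \<Rightarrow> 'n) \<Rightarrow> 'm \<Rightarrow> 'n) \<Rightarrow> ('m \<Rightarrow> 'n set) \<Rightarrow> ('m \<Rightarrow> 'n set) \<Rightarrow>
   'm \<Rightarrow> 'n \<Rightarrow> 'n \<Rightarrow> 'n" where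
  "A_tensor M R conn HH VV x \<xi> \<eta> = (THE w. \<exists>c1 c2. smooth_vf M c1 \<and> smooth_vf M c2 \<and>
     c1 x = \<xi> \<and> c2 x = \<eta> \<and> w = vf_proj R VV (conn c1 (vf_proj R HH c2)) x)"

definition A_adj ::
  "('m, 'n::euclidean_space) manifold \<Rightarrow> ('m \<Rightarrow> 'n \<Rightarrow> 'n \<Rightarrow> real) \<Rightarrow>
   (('m \<Rightarrow> 'n) \<Rightarrow> ('m \<Rightarrow> 'n) \<Rightarrow> 'm \<Rightarrow> 'n) \<Rightarrow> ('m \<Rightarrow> 'n set) \<Rightarrow> ('m \<Rightarrow> 'n set) \<Rightarrow>
   'm \<Rightarrow> 'n \<Rightarrow> 'n \<Rightarrow> 'n" where
  "A_adj M R conn HH VV x \<xi> = adjoint_wrt (R x) (A_tensor M R conn HH VV x \<xi>)"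


section \<open>Embedded ambient structures\<close>

text \<open>The inclusion of \<open>M\<close> into \<open>\<E>\<close> is written as an embedding \<open>\<iota>\<close>; its differential
  \<open>dird M \<iota> x\<close> identifies \<open>T\<^sub>xM\<close> with a subspace of \<open>\<E>\<close>.\<close>

definition smooth_embedding :: "('m, 'n::euclidean_space) manifold \<Rightarrow> ('m \<Rightarrow> 'e::euclidean_space) \<Rightarrow> bool" where
  "smooth_embedding M \<iota> \<longleftrightarrow> smooth_fun M \<iota> \<and> (\<forall>x\<in>pts M. inj (dird M \<iota> x)) \<and>
     embedding_map (mtop M) euclidean \<iota>"

definition ambient_structure ::
  "('m, 'n::euclidean_space) manifold \<Rightarrow> ('m \<Rightarrow> 'n \<Rightarrow> 'n \<Rightarrow> real) \<Rightarrow> ('m \<Rightarrow> 'e::euclidean_space) \<Rightarrow>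
   ('m \<Rightarrow> ('e, 'e) blinfun) \<Rightarrow> bool" where
  "ambient_structure M R \<iota> g \<longleftrightarrow> smooth_embedding M \<iota> \<and> smooth_fun M g \<and>
     (\<forall>x\<in>pts M.
        (\<forall>v w. inner (blinfun_apply (g x) v) w = inner v (blinfun_apply (g x) w)) \<and>
        (\<forall>v. v \<noteq> 0 \<longrightarrow> inner v (blinfun_apply (g x) v) > 0) \<and>
        (\<forall>\<xi> \<eta>. inner (dird M \<iota> x \<xi>) (blinfun_apply (g x) (dird M \<iota> x \<eta>)) = R x \<xi> \<eta>))"

text \<open>The projection of all of \<open>\<E>\<close> onto \<open>\<F>\<^sub>x\<close>, orthogonal for \<open>\<langle>\<cdot>, g\<^sub>x \<cdot>\<rangle>\<close>.\<close>

definition amb_proj ::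
  "('m, 'n::euclidean_space) manifold \<Rightarrow> ('m \<Rightarrow> 'e::euclidean_space) \<Rightarrow> ('m \<Rightarrow> ('e, 'e) blinfun) \<Rightarrow>
   ('m \<Rightarrow> 'n set) \<Rightarrow> 'm \<Rightarrow> ('e, 'e) blinfun" where
  "amb_proj M \<iota> g F x =
     Blinfun (orth_proj (\<lambda>v w. inner v (blinfun_apply (g x) w)) (dird M \<iota> x ` F x))"

text \<open>A Christoffel function takes values in \<open>L(\<E> \<otimes> \<E>, \<E>)\<close>, written in curried form.\<close>

definition christoffel ::
  "('m, 'n::euclidean_space) manifold \<Rightarrow> (('m \<Rightarrow> 'n) \<Rightarrow> ('m \<Rightarrow> 'n) \<Rightarrow> 'm \<Rightarrow> 'n) \<Rightarrow>
   ('m \<Rightarrow> 'e::euclidean_space) \<Rightarrow> ('m \<Rightarrow> ('e, ('e, 'e) blinfun) blinfun) \<Rightarrow> bool" where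
  "christoffel M conn \<iota> \<Gamma> \<longleftrightarrow> smooth_fun M \<Gamma> \<and>
     (\<forall>X Y. smooth_vf M X \<and> smooth_vf M Y \<longrightarrow> (\<forall>x\<in>pts M.
        dird M \<iota> x (conn X Y x) = dird M (\<lambda>y. dird M \<iota> y (Y y)) x (X x) +
          blinfun_apply (blinfun_apply (\<Gamma> x) (dird M \<iota> x (X x))) (dird M \<iota> x (Y x))))"

definition Gamma_ring ::
  "('m, 'n::euclidean_space) manifold \<Rightarrow> ('m \<Rightarrow> 'e::euclidean_space) \<Rightarrow> ('m \<Rightarrow> ('e, 'e) blinfun) \<Rightarrow>
   ('m \<Rightarrow> ('e, ('e, 'e) blinfun) blinfun) \<Rightarrow> 'm \<Rightarrow> 'n \<Rightarrow> 'e \<Rightarrow> 'e" where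
  "Gamma_ring M \<iota> g \<Gamma> x \<xi> \<omega> =
     blinfun_apply (dird M (amb_proj M \<iota> g (\<lambda>_. UNIV)) x \<xi>) \<omega> +
     blinfun_apply (blinfun_apply (\<Gamma> x) (dird M \<iota> x \<xi>)) \<omega>"

definition Gamma_sub ::
  "('m, 'n::euclidean_space) manifold \<Rightarrow> ('m \<Rightarrow> 'e::euclidean_space) \<Rightarrow> ('m \<Rightarrow> ('e, 'e) blinfun) \<Rightarrow>
   ('m \<Rightarrow> ('e, ('e, 'e) blinfun) blinfun) \<Rightarrow> ('m \<Rightarrow> 'n set) \<Rightarrow> 'm \<Rightarrow> 'n \<Rightarrow> 'e \<Rightarrow> 'e" where
  "Gamma_sub M \<iota> g \<Gamma> F x \<xi> \<omega> =
     - blinfun_apply (dird M (amb_proj M \<iota> g F) x \<xi>) \<omega> +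
     blinfun_apply (amb_proj M \<iota> g F x) (Gamma_ring M \<iota> g \<Gamma> x \<xi> \<omega>)"


section \<open>Riemannian submersions\<close>

definition vertical ::
  "('m, 'n::euclidean_space) manifold \<Rightarrow> ('b, 'k::euclidean_space) manifold \<Rightarrow> ('m \<Rightarrow> 'b) \<Rightarrow> 'm \<Rightarrow> 'n set" where
  "vertical M B q x = {\<xi>. differential M B q x \<xi> = 0}"

definition horizontal ::
  "('m, 'n::euclidean_space) manifold \<Rightarrow> ('m \<Rightarrow> 'n \<Rightarrow> 'n \<Rightarrow> real) \<Rightarrow>
   ('b, 'k::euclidean_space) manifold \<Rightarrow> ('m \<Rightarrow> 'b) \<Rightarrow> 'm \<Rightarrow> 'n set" where
  "horizontal M R B q x = {\<xi>. \<forall>v\<in>vertical M B q x. R x \<xi> v = 0}"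

definition riemannian_submersion ::
  "('m, 'n::euclidean_space) manifold \<Rightarrow> ('m \<Rightarrow> 'n \<Rightarrow> 'n \<Rightarrow> real) \<Rightarrow>
   ('b, 'k::euclidean_space) manifold \<Rightarrow> ('b \<Rightarrow> 'k \<Rightarrow> 'k \<Rightarrow> real) \<Rightarrow> ('m \<Rightarrow> 'b) \<Rightarrow> bool" where
  "riemannian_submersion M R B RB q \<longleftrightarrow>
     riemannian_manifold M R \<and> riemannian_manifold B RB \<and> smooth_map M B q \<and>
     (\<forall>x\<in>pts M. surj (differential M B q x) \<and>
        (\<forall>\<xi>\<in>horizontal M R B q x. \<forall>\<eta>\<in>horizontal M R B q x.
           RB (q x) (differential M B q x \<xi>) (differential M B q x \<eta>) = R x \<xi> \<eta>))"

end

theory Submission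
  imports Defs
begin

text \<open>
Let \<open>X\<close>, \<open>Y\<close>, \<open>Z\<close> be vector fields. The expression \<open>V \<nabla>\<^sub>X (H Y)\<close> is linear over functions in \<open>X\<close>, and also
in \<open>Y\<close> because the Leibniz term \<open>(X f) H Y\<close> is killed by \<open>V\<close> (\<open>tensor_VconnH\<close>). Linearity over functions
makes it depend on values at a point only (\<open>tensorial_pointwise\<close>, with bump functions), so the
definite description of \<open>A\<close> has a value (\<open>A_eq\<close>). Since \<open>\<langle>H Y, V Z\<rangle> = 0\<close> and the metric is parallel,
\<open>\<langle>\<nabla>\<^sub>X (H Y), V Z\<rangle> = - \<langle>H Y, \<nabla>\<^sub>X (V Z)\<rangle>\<close>. This is the formula for the adjoint (\<open>HconnV_adjoint\<close>,
\<open>A_adj_eq\<close>), and it says that the adjoint is minus the tensor with \<open>H\<close> and \<open>V\<close> exchanged (\<open>A_adj_swap\<close>).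

In an ambient space \<open>\<nabla>\<^sub>X (H Y) = D\<^sub>X (H Y) + \<Gamma>(X, H Y)\<close>. Differentiating the identities \<open>V (H Y) = 0\<close> and
\<open>\<Pi> (H Y) = H Y\<close> gives \<open>V D\<^sub>X (H Y) = - (D\<^sub>X V) H Y\<close> and \<open>V (D\<^sub>X \<Pi>) H Y = 0\<close>, and hence the formula with
\<open>\<Gamma>\<^sub>V\<close> (\<open>ambient_A\<close>). This needs differentiable projections. They are, because the Gram-Schmidt process
expresses the projection onto the span of a smooth frame by inner products and divisions
(\<open>smooth_on_orth_proj\<close>).

For a Riemannian submersion the key is \<open>A\<^sub>\<xi> \<xi> = 0\<close> for horizontal \<open>\<xi>\<close> (\<open>A_horizontal_self\<close>). For \<open>X\<close>
horizontal and \<open>U\<close> vertical, \<open>\<langle>\<nabla>\<^sub>X X, U\<rangle> = - \<langle>X, [X, U]\<rangle> - U \<langle>X, X\<rangle> / 2\<close>, and the two terms cancel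
(\<open>vertical_derivative_of_horizontal_norm\<close>): \<open>\<langle>X, X\<rangle>\<close> is the squared length of \<open>dq X\<close>, and \<open>dq U = 0\<close>
turns the derivative of \<open>dq X\<close> along \<open>U\<close> into \<open>- dq [X, U]\<close>, by symmetry of second derivatives
(\<open>dird_commutator\<close>). So \<open>A\<close> is skew on horizontal vectors, and absence of torsion gives
\<open>2 A\<^sub>X Y = V [X, Y]\<close>. The same commutator formula for the embedding, with \<open>D Y = (D H) Y + H (D Y)\<close> for
horizontal \<open>Y\<close>, expresses this bracket through \<open>D H\<close> (\<open>ambient_V_bracket\<close>).
\<close>

section \<open>Calculus of \<open>C\<^sup>k\<close> maps\<close>

lemma frechet_derivative_eqI:
  "(f has_derivative f') (at x) \<Longrightarrow> frechet_derivative f (at x) = f'"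
  by (metis frechet_derivative_at)

lemma has_frechet_derivative:
  "f differentiable (at x) \<Longrightarrow> (f has_derivative frechet_derivative f (at x)) (at x)"
  by (simp add: frechet_derivative_works)

lemma frechet_derivative_cong_open:
  assumes "open S" "x \<in> S" "\<And>y. y \<in> S \<Longrightarrow> f y = g y"
  shows "frechet_derivative f (at x) = frechet_derivative g (at x)"
proof -
  have "(f has_derivative f') (at x) \<longleftrightarrow> (g has_derivative f') (at x)" for f'
    using has_derivative_transform_within_open[of f f' x UNIV S g]
      has_derivative_transform_within_open[of g f' x UNIV S f] assms by auto
  then show ?thesis unfolding frechet_derivative_def by simp
qed

lemma differentiable_cong_open:
  assumes "open S" "x \<in> S" "\<And>y. y \<in> S \<Longrightarrow> f y = g y" "f differentiable (at x)"
  shows "g differentiable (at x)"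
  using assms has_derivative_transform_within_open[of f _ x UNIV S g]
  unfolding differentiable_def by metis

lemma frechet_derivative_chain:
  assumes "f differentiable (at x)" "g differentiable (at (f x))"
  shows "(\<lambda>y. g (f y)) differentiable (at x)"
    "frechet_derivative (\<lambda>y. g (f y)) (at x) v = frechet_derivative g (at (f x)) (frechet_derivative f (at x) v)"
proof -
  have *: "((g \<circ> f) has_derivative frechet_derivative g (at (f x)) \<circ> frechet_derivative f (at x)) (at x)"
    using assms by (intro diff_chain_at has_frechet_derivative)
  show "(\<lambda>y. g (f y)) differentiable (at x)"
    using differentiableI[OF *] by (simp add: o_def)
  show "frechet_derivative (\<lambda>y. g (f y)) (at x) v = frechet_derivative g (at (f x)) (frechet_derivative f (at x) v)"
    using fun_cong[OF frechet_derivative_eqI[OF *], of v] by (simp add: o_def)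
qed

lemma frechet_derivative_bilinear:
  assumes "bounded_bilinear b" "f differentiable (at x)" "g differentiable (at x)"
  shows "(\<lambda>y. b (f y) (g y)) differentiable (at x)"
    "frechet_derivative (\<lambda>y. b (f y) (g y)) (at x) v =
       b (f x) (frechet_derivative g (at x) v) + b (frechet_derivative f (at x) v) (g x)"
proof -
  have *: "((\<lambda>y. b (f y) (g y)) has_derivative (\<lambda>v. b (f x) (frechet_derivative g (at x) v) +
      b (frechet_derivative f (at x) v) (g x))) (at x)"
    by (rule bounded_bilinear.FDERIV[OF assms(1) assms(2,3)[THEN has_frechet_derivative]])
  show "(\<lambda>y. b (f y) (g y)) differentiable (at x)"
    using differentiableI[OF *] by (simp add: o_def)
  show "frechet_derivative (\<lambda>y. b (f y) (g y)) (at x) v =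
       b (f x) (frechet_derivative g (at x) v) + b (frechet_derivative f (at x) v) (g x)"
    using fun_cong[OF frechet_derivative_eqI[OF *], of v] by (simp add: o_def)
qed

lemma frechet_derivative_bounded_linear:
  assumes "bounded_linear L" "f differentiable (at x)"
  shows "(\<lambda>y. L (f y)) differentiable (at x)"
    "frechet_derivative (\<lambda>y. L (f y)) (at x) v = L (frechet_derivative f (at x) v)"
proof -
  have *: "((\<lambda>y. L (f y)) has_derivative (\<lambda>v. L (frechet_derivative f (at x) v))) (at x)"
    by (rule bounded_linear.has_derivative[OF assms(1) has_frechet_derivative[OF assms(2)]])
  show "(\<lambda>y. L (f y)) differentiable (at x)"
    by (rule differentiableI[OF *])
  show "frechet_derivative (\<lambda>y. L (f y)) (at x) v = L (frechet_derivative f (at x) v)"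
    by (simp add: frechet_derivative_eqI[OF *])
qed

lemma frechet_derivative_plus:
  assumes "f differentiable (at x)" "g differentiable (at x)"
  shows "frechet_derivative (\<lambda>y. f y + g y) (at x) v =
       frechet_derivative f (at x) v + frechet_derivative g (at x) v"
  using has_derivative_add[OF assms[THEN has_frechet_derivative]]
  by (auto dest: frechet_derivative_eqI)

lemma Ck_on_cong:
  assumes "open S" "\<And>x. x \<in> S \<Longrightarrow> f x = g x" "Ck_on k S f"
  shows "Ck_on k S g"
  using assms(2,3)
proof (induction k arbitrary: f g)
  case 0 then show ?case using continuous_on_cong by (metis Ck_on.simps(1))
next
  case (Suc k)
  have "Ck_on k S (\<lambda>x. frechet_derivative g (at x) v)" for v
    by (rule Suc.IH[of "\<lambda>x. frechet_derivative f (at x) v"])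
      (use Suc.prems frechet_derivative_cong_open[OF assms(1), of _ f g] in auto)
  then show ?case
    using Suc.prems differentiable_cong_open[OF assms(1), of _ f g] by auto
qed

lemma Ck_on_subset: "Ck_on k S f \<Longrightarrow> T \<subseteq> S \<Longrightarrow> Ck_on k T f"
  by (induction k arbitrary: f) (auto intro: continuous_on_subset)

lemma Ck_on_continuous_on: "Ck_on k S f \<Longrightarrow> continuous_on S f"
  by (cases k) (auto intro!: continuous_at_imp_continuous_on differentiable_imp_continuous_within)

lemma Ck_on_Suc_imp: "Ck_on (Suc k) S f \<Longrightarrow> Ck_on k S f"
proof (induction k arbitrary: f)
  case 0 then show ?case using Ck_on_continuous_on by (metis Ck_on.simps(1))
next
  case (Suc k)
  then show ?case by (auto simp del: Ck_on.simps simp: Ck_on.simps(2)[of "Suc k"] Ck_on.simps(2)[of k])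
qed

lemma Ck_on_local:
  assumes "\<And>x. x \<in> S \<Longrightarrow> \<exists>N. open N \<and> x \<in> N \<and> Ck_on k N f"
  shows "Ck_on k S f"
  using assms
proof (induction k arbitrary: f)
  case 0
  have "isCont f x" if "x \<in> S" for x
    using 0[OF that] by (auto simp: continuous_on_eq_continuous_at)
  then show ?case by (simp add: continuous_at_imp_continuous_on)
next
  case (Suc k)
  have "Ck_on k S (\<lambda>x. frechet_derivative f (at x) v)" for v
    by (rule Suc.IH) (use Suc.prems in fastforce)
  moreover have "f differentiable (at x)" if "x \<in> S" for x
    using Suc.prems[OF that] by auto
  ultimately show ?case by simp
qed

lemma Ck_on_const: "Ck_on k S (\<lambda>x. c)"
  by (induction k arbitrary: c) auto

lemma Ck_on_bounded_linear:
  assumes "open S" "bounded_linear L" "Ck_on k S f"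
  shows "Ck_on k S (\<lambda>x. L (f x))"
  using assms(3)
proof (induction k arbitrary: f)
  case 0
  then show ?case using assms(2) by (auto intro: bounded_linear.continuous_on)
next
  case (Suc k)
  have d: "f differentiable (at x)" if "x \<in> S" for x using Suc.prems that by simp
  have "Ck_on k S (\<lambda>x. frechet_derivative (\<lambda>x. L (f x)) (at x) v)" for v
  proof (rule Ck_on_cong[OF assms(1)])
    show "Ck_on k S (\<lambda>x. L (frechet_derivative f (at x) v))" using Suc by simp
  qed (simp add: frechet_derivative_bounded_linear(2)[OF assms(2) d])
  then show ?case by (simp add: frechet_derivative_bounded_linear(1)[OF assms(2) d])
qed

lemma Ck_on_add:
  assumes "open S" "Ck_on k S f" "Ck_on k S g"
  shows "Ck_on k S (\<lambda>x. f x + g x)"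
  using assms(2,3)
proof (induction k arbitrary: f g)
  case 0
  then show ?case by (auto intro: continuous_on_add)
next
  case (Suc k)
  have "Ck_on k S (\<lambda>x. frechet_derivative (\<lambda>x. f x + g x) (at x) v)" for v
  proof (rule Ck_on_cong[OF assms(1)])
    show "Ck_on k S (\<lambda>x. frechet_derivative f (at x) v + frechet_derivative g (at x) v)"
      using Suc by simp
  qed (use Suc.prems frechet_derivative_plus[of f _ g v] in auto)
  then show ?case using Suc.prems by auto
qed

lemma Ck_on_bilinear:
  assumes "open S" "bounded_bilinear b" "Ck_on k S f" "Ck_on k S g"
  shows "Ck_on k S (\<lambda>x. b (f x) (g x))"
  using assms(3,4)
proof (induction k arbitrary: f g)
  case 0
  then show ?case using assms(2) by (auto intro: bounded_bilinear.continuous_on)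
next
  case (Suc k)
  have "Ck_on k S (\<lambda>x. b (f x) (frechet_derivative g (at x) v) + b (frechet_derivative f (at x) v) (g x))" for v
    using Suc.prems by (intro Ck_on_add[OF assms(1)] Suc.IH Suc.prems[THEN Ck_on_Suc_imp]) simp_all
  then have "Ck_on k S (\<lambda>x. frechet_derivative (\<lambda>x. b (f x) (g x)) (at x) v)" for v
    by (rule Ck_on_cong[OF assms(1), rotated])
      (use Suc.prems frechet_derivative_bilinear(2)[OF assms(2), of f _ g v] in auto)
  then show ?case using Suc.prems frechet_derivative_bilinear(1)[OF assms(2), of f _ g] by auto
qed

lemma Ck_on_sum:
  assumes "open S" "\<And>i. i \<in> I \<Longrightarrow> Ck_on k S (f i)"
  shows "Ck_on k S (\<lambda>x. \<Sum>i\<in>I. f i x)"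
  using assms(2)
  by (induction I rule: infinite_finite_induct) (auto intro: Ck_on_const Ck_on_add[OF assms(1)])

lemma linear_euclidean_expansion:
  fixes L :: "'a::euclidean_space \<Rightarrow> 'b::real_vector"
  assumes "linear L"
  shows "L v = (\<Sum>b\<in>Basis. (v \<bullet> b) *\<^sub>R L b)"
proof -
  have "L v = L (\<Sum>b\<in>Basis. (v \<bullet> b) *\<^sub>R b)" by (simp add: euclidean_representation)
  then show ?thesis by (simp add: linear_sum[OF assms] linear_scale[OF assms])
qed

text \<open>The class \<open>C\<^sup>k\<close> is defined through derivatives in fixed directions, while the chain rule
  applies \<open>Dg\<close> to the variable vector \<open>Df x v\<close>. Expanding this vector in the standard basis of the
  Euclidean intermediate space brings the induction back to fixed directions.\<close>

lemma Ck_on_compose: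
  fixes f :: "'a::real_normed_vector \<Rightarrow> 'b::euclidean_space" and g :: "'b \<Rightarrow> 'c::real_normed_vector"
  assumes "open S" "Ck_on k S f" "Ck_on k T g" "f ` S \<subseteq> T"
  shows "Ck_on k S (\<lambda>x. g (f x))"
  using assms(2,3)
proof (induction k arbitrary: g)
  case 0
  then show ?case using assms(4) by (auto intro: continuous_on_compose2)
next
  case (Suc k)
  have T: "g differentiable (at (f x))" "f differentiable (at x)" if "x \<in> S" for x
    using Suc.prems assms(4) that by auto
  have "Ck_on k S (\<lambda>x. \<Sum>b\<in>Basis. (frechet_derivative f (at x) v \<bullet> b) *\<^sub>R frechet_derivative g (at (f x)) b)" for v
    by (intro Ck_on_sum Ck_on_bilinear[OF _ bounded_bilinear_scaleR]
        Ck_on_bounded_linear[OF _ bounded_linear_inner_left] assms(1) Suc.IH Suc.prems(1)[THEN Ck_on_Suc_imp])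
      (use Suc.prems in simp_all)
  then have "Ck_on k S (\<lambda>x. frechet_derivative (\<lambda>x. g (f x)) (at x) v)" for v
    by (rule Ck_on_cong[OF assms(1), rotated])
      (simp add: frechet_derivative_chain(2)[OF T(2,1)]
        linear_euclidean_expansion[OF linear_frechet_derivative[OF T(1)], symmetric])
  then show ?case using frechet_derivative_chain(1)[OF T(2,1)] by simp
qed

lemma frechet_derivative_inverse_real:
  fixes f :: "'a::real_normed_vector \<Rightarrow> real"
  assumes "f differentiable (at x)" "f x \<noteq> 0"
  shows "(\<lambda>y. inverse (f y)) differentiable (at x)"
    "frechet_derivative (\<lambda>y. inverse (f y)) (at x) v =
      - (inverse (f x) * frechet_derivative f (at x) v * inverse (f x))"
proof -
  have *: "((\<lambda>y. inverse (f y)) has_derivative (\<lambda>v. - (inverse (f x) * frechet_derivative f (at x) v * inverse (f x)))) (at x)"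
    by (rule Deriv.has_derivative_inverse[OF assms(2) has_frechet_derivative[OF assms(1)]])
  show "(\<lambda>y. inverse (f y)) differentiable (at x)"
    using differentiableI[OF *] by (simp add: o_def)
  show "frechet_derivative (\<lambda>y. inverse (f y)) (at x) v =
      - (inverse (f x) * frechet_derivative f (at x) v * inverse (f x))"
    using fun_cong[OF frechet_derivative_eqI[OF *], of v] by (simp add: o_def)
qed

lemma Ck_on_inverse:
  fixes f :: "'a::real_normed_vector \<Rightarrow> real"
  assumes "open S" "Ck_on k S f" "\<And>x. x \<in> S \<Longrightarrow> f x \<noteq> 0"
  shows "Ck_on k S (\<lambda>x. inverse (f x))"
  using assms(2)
proof (induction k)
  case 0
  then show ?case using assms(3) by (auto intro: continuous_on_inverse)
next
  case (Suc k)
  have I: "Ck_on k S (\<lambda>x. inverse (f x))" using Suc.IH Ck_on_Suc_imp[OF Suc.prems] by blast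
  have "Ck_on k S (\<lambda>x. - (inverse (f x) * frechet_derivative f (at x) v * inverse (f x)))" for v
    using Suc.prems
    by (intro Ck_on_bounded_linear[OF assms(1) bounded_linear_minus[OF bounded_linear_ident]]
      Ck_on_bilinear[OF assms(1) bounded_bilinear_mult] I) auto
  then have "Ck_on k S (\<lambda>x. frechet_derivative (\<lambda>x. inverse (f x)) (at x) v)" for v
    by (rule Ck_on_cong[OF assms(1), rotated])
      (use Suc.prems assms(3) frechet_derivative_inverse_real(2)[of f _ v] in auto)
  then show ?case using Suc.prems assms(3) frechet_derivative_inverse_real(1)[of f] by auto
qed

subsection \<open>Smooth maps\<close>

lemma smooth_on_cong:
  assumes "smooth_on S f" "open S" "\<And>x. x \<in> S \<Longrightarrow> f x = g x"
  shows "smooth_on S g"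
  using assms Ck_on_cong unfolding smooth_on_def by blast

lemma smooth_on_subset: "smooth_on S f \<Longrightarrow> T \<subseteq> S \<Longrightarrow> smooth_on T f"
  using Ck_on_subset unfolding smooth_on_def by blast

lemma smooth_on_local:
  assumes "\<And>x. x \<in> S \<Longrightarrow> \<exists>N. open N \<and> x \<in> N \<and> smooth_on N f"
  shows "smooth_on S f"
  unfolding smooth_on_def
proof
  fix k
  show "Ck_on k S f"
  proof (rule Ck_on_local)
    fix x assume "x \<in> S"
    then show "\<exists>N. open N \<and> x \<in> N \<and> Ck_on k N f"
      using assms[of x] unfolding smooth_on_def by metis
  qed
qed

lemma smooth_on_differentiable: "smooth_on S f \<Longrightarrow> x \<in> S \<Longrightarrow> f differentiable (at x)"
  using Ck_on.simps(2)[of 0 S f] unfolding smooth_on_def by blast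

lemma smooth_on_continuous_on: "smooth_on S f \<Longrightarrow> continuous_on S f"
  using Ck_on.simps(1)[of S f] unfolding smooth_on_def by blast

lemma smooth_on_frechet_const: "smooth_on S f \<Longrightarrow> smooth_on S (\<lambda>x. frechet_derivative f (at x) v)"
  unfolding smooth_on_def by (metis Ck_on.simps(2))

lemma smooth_on_const: "smooth_on S (\<lambda>x. c)"
  by (simp add: smooth_on_def Ck_on_const)

lemma smooth_on_bounded_linear:
  "open S \<Longrightarrow> bounded_linear L \<Longrightarrow> smooth_on S f \<Longrightarrow> smooth_on S (\<lambda>x. L (f x))"
  by (simp add: smooth_on_def Ck_on_bounded_linear)

lemma smooth_on_ident: "open S \<Longrightarrow> smooth_on S (\<lambda>x. x)"
  unfolding smooth_on_def
proof
  fix k assume "open S" then show "Ck_on k S (\<lambda>x. x)" by (cases k) (auto simp: Ck_on_const)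
qed

lemma smooth_on_add: "open S \<Longrightarrow> smooth_on S f \<Longrightarrow> smooth_on S g \<Longrightarrow> smooth_on S (\<lambda>x. f x + g x)"
  by (simp add: smooth_on_def Ck_on_add)

lemma smooth_on_bilinear:
  "open S \<Longrightarrow> bounded_bilinear b \<Longrightarrow> smooth_on S f \<Longrightarrow> smooth_on S g \<Longrightarrow> smooth_on S (\<lambda>x. b (f x) (g x))"
  by (simp add: smooth_on_def Ck_on_bilinear)

lemmas smooth_on_scaleR = smooth_on_bilinear[OF _ bounded_bilinear_scaleR]
lemmas smooth_on_mult = smooth_on_bilinear[OF _ bounded_bilinear_mult]
lemmas smooth_on_inner = smooth_on_bilinear[OF _ bounded_bilinear_inner]

lemma smooth_on_diff:
  assumes "open S" "smooth_on S f" "smooth_on S g" shows "smooth_on S (\<lambda>x. f x - g x)"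
  using smooth_on_add[OF assms(1,2) smooth_on_bounded_linear[OF assms(1) bounded_linear_minus[OF bounded_linear_ident] assms(3)]]
  by simp

lemma smooth_on_sum:
  "open S \<Longrightarrow> (\<And>i. i \<in> I \<Longrightarrow> smooth_on S (f i)) \<Longrightarrow> smooth_on S (\<lambda>x. \<Sum>i\<in>I. f i x)"
  by (simp add: smooth_on_def Ck_on_sum)

lemma smooth_on_compose:
  fixes f :: "'a::real_normed_vector \<Rightarrow> 'b::euclidean_space"
  shows "open S \<Longrightarrow> smooth_on S f \<Longrightarrow> smooth_on T g \<Longrightarrow> f ` S \<subseteq> T \<Longrightarrow> smooth_on S (\<lambda>x. g (f x))"
  using Ck_on_compose[of S _ f T g] unfolding smooth_on_def by metis

lemma smooth_on_divide:
  fixes f g :: "'a::real_normed_vector \<Rightarrow> real"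
  assumes "open S" "smooth_on S f" "smooth_on S g" "\<And>x. x \<in> S \<Longrightarrow> g x \<noteq> 0"
  shows "smooth_on S (\<lambda>x. f x / g x)"
proof -
  have "smooth_on S (\<lambda>x. inverse (g x))" using assms by (simp add: smooth_on_def Ck_on_inverse)
  then show ?thesis unfolding divide_inverse using assms by (intro smooth_on_mult)
qed

lemma smooth_on_frechet:
  fixes f :: "'a::euclidean_space \<Rightarrow> 'b::real_normed_vector"
  assumes "open S" "smooth_on S f" "smooth_on S v"
  shows "smooth_on S (\<lambda>x. frechet_derivative f (at x) (v x))"
proof (rule smooth_on_cong[OF _ assms(1)])
  show "smooth_on S (\<lambda>x. \<Sum>b\<in>Basis. (v x \<bullet> b) *\<^sub>R frechet_derivative f (at x) b)"
    using assms by (intro smooth_on_sum smooth_on_scaleR smooth_on_inner smooth_on_frechet_const smooth_on_const)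
  fix x assume "x \<in> S"
  then show "(\<Sum>b\<in>Basis. (v x \<bullet> b) *\<^sub>R frechet_derivative f (at x) b) = frechet_derivative f (at x) (v x)"
    using linear_euclidean_expansion[OF linear_frechet_derivative[OF smooth_on_differentiable[OF assms(2)]]] by metis
qed

subsection \<open>Symmetry of the second derivative\<close>

lemma line_derivative:
  fixes f :: "'a::real_normed_vector \<Rightarrow> real"
  assumes "f differentiable (at (a + t *\<^sub>R v))"
  shows "((\<lambda>t. f (a + t *\<^sub>R v)) has_real_derivative frechet_derivative f (at (a + t *\<^sub>R v)) v) (at t)"
proof -
  have 1: "((\<lambda>t. a + t *\<^sub>R v) has_derivative (\<lambda>s. s *\<^sub>R v)) (at t)"
    by (auto intro!: derivative_eq_intros)
  have "((\<lambda>t. f (a + t *\<^sub>R v)) has_derivative (\<lambda>s. frechet_derivative f (at (a + t *\<^sub>R v)) (s *\<^sub>R v))) (at t)"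
    using diff_chain_at[OF 1 has_frechet_derivative[OF assms]] by (simp add: o_def)
  then show ?thesis
    unfolding has_field_derivative_def
    by (simp add: linear_scale[OF linear_frechet_derivative[OF assms]] mult_commute_abs)
qed

text \<open>The mean value theorem, applied first in direction \<open>v\<close> and then in direction \<open>w\<close>, turns the
  second difference of \<open>f\<close> over a small parallelogram into a mixed derivative at an intermediate
  point. The second difference is symmetric in \<open>v\<close> and \<open>w\<close>, which is why the mixed derivatives
  agree.\<close>

lemma second_difference:
  fixes f :: "'a::real_normed_vector \<Rightarrow> real"
  assumes d: "\<And>y. y \<in> ball x r \<Longrightarrow> f differentiable (at y)"
    and dd: "\<And>y. y \<in> ball x r \<Longrightarrow> (\<lambda>y. frechet_derivative f (at y) v) differentiable (at y)"
    and h: "0 < h" "h * (norm v + norm w) < r"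
  shows "\<exists>s t. 0 \<le> s \<and> s \<le> h \<and> 0 \<le> t \<and> t \<le> h \<and>
    f (x + h *\<^sub>R v + h *\<^sub>R w) - f (x + h *\<^sub>R v) - f (x + h *\<^sub>R w) + f x =
      h^2 * frechet_derivative (\<lambda>y. frechet_derivative f (at y) v) (at (x + s *\<^sub>R v + t *\<^sub>R w)) w"
proof -
  have B: "x + s *\<^sub>R v + t *\<^sub>R w \<in> ball x r" if "0 \<le> s" "s \<le> h" "0 \<le> t" "t \<le> h" for s t
  proof -
    have "norm (s *\<^sub>R v + t *\<^sub>R w) \<le> norm (s *\<^sub>R v) + norm (t *\<^sub>R w)" by (rule norm_triangle_ineq)
    also have "\<dots> \<le> h * norm v + h * norm w" using that by (intro add_mono) (auto intro: mult_right_mono)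
    also have "\<dots> < r" using h by (simp add: algebra_simps)
    finally show ?thesis by (simp add: dist_norm norm_minus_commute algebra_simps)
  qed
  define u where "u = (\<lambda>s. f ((x + h *\<^sub>R w) + s *\<^sub>R v) - f (x + s *\<^sub>R v))"
  define fv where "fv = (\<lambda>y. frechet_derivative f (at y) v)"
  have "(u has_real_derivative fv ((x + h *\<^sub>R w) + s *\<^sub>R v) - fv (x + s *\<^sub>R v)) (at s)" if "0 \<le> s" "s \<le> h" for s
    unfolding u_def fv_def
    by (intro DERIV_diff line_derivative d) (use B[of s h] B[of s 0] that h in \<open>auto simp: algebra_simps\<close>)
  from MVT2[OF h(1) this] obtain s where s: "0 < s" "s < h"
    "u h - u 0 = h * (fv ((x + h *\<^sub>R w) + s *\<^sub>R v) - fv (x + s *\<^sub>R v))" by auto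
  have "((\<lambda>t. fv ((x + s *\<^sub>R v) + t *\<^sub>R w)) has_real_derivative frechet_derivative fv (at ((x + s *\<^sub>R v) + t *\<^sub>R w)) w) (at t)"
    if "0 \<le> t" "t \<le> h" for t
    by (intro line_derivative) (use dd[of "x + s *\<^sub>R v + t *\<^sub>R w"] B[of s t] s that in \<open>auto simp: fv_def\<close>)
  from MVT2[OF h(1) this] obtain t where t: "0 < t" "t < h"
    "fv ((x + s *\<^sub>R v) + h *\<^sub>R w) - fv ((x + s *\<^sub>R v)) = h * frechet_derivative fv (at ((x + s *\<^sub>R v) + t *\<^sub>R w)) w" by auto
  have "f (x + h *\<^sub>R v + h *\<^sub>R w) - f (x + h *\<^sub>R v) - f (x + h *\<^sub>R w) + f x = u h - u 0"
    by (simp add: u_def algebra_simps)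
  also have "\<dots> = h * (fv ((x + s *\<^sub>R v) + h *\<^sub>R w) - fv (x + s *\<^sub>R v))"
    using s(3) by (simp add: algebra_simps)
  also have "\<dots> = h^2 * frechet_derivative fv (at (x + s *\<^sub>R v + t *\<^sub>R w)) w"
    using t(3) by (simp add: power2_eq_square)
  finally show ?thesis using s t unfolding fv_def by (intro exI[of _ s] exI[of _ t]) auto
qed

lemma symmetric_second_derivative_real:
  fixes f :: "'a::real_normed_vector \<Rightarrow> real"
  assumes S: "open S" "smooth_on S f" "x \<in> S"
  shows "frechet_derivative (\<lambda>y. frechet_derivative f (at y) v) (at x) w =
         frechet_derivative (\<lambda>y. frechet_derivative f (at y) w) (at x) v"
proof -
  define F where "F = (\<lambda>v w y. frechet_derivative (\<lambda>y. frechet_derivative f (at y) v) (at y) w)"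
  have F: "isCont (F v w) x" for v w
    unfolding F_def using S smooth_on_continuous_on[OF smooth_on_frechet_const[OF smooth_on_frechet_const[OF S(2)]]]
    by (metis continuous_on_eq_continuous_at)
  obtain r0 where r0: "r0 > 0" "ball x r0 \<subseteq> S" using S openE by blast
  have "\<bar>F v w x - F w v x\<bar> \<le> 2 * e" if e: "e > 0" for e
  proof -
    obtain r1 where r1: "r1 > 0" "\<And>y. dist y x < r1 \<Longrightarrow> dist (F v w y) (F v w x) < e"
      using F[of v w] e unfolding continuous_at_eps_delta by (metis)
    obtain r2 where r2: "r2 > 0" "\<And>y. dist y x < r2 \<Longrightarrow> dist (F w v y) (F w v x) < e"
      using F[of w v] e unfolding continuous_at_eps_delta by (metis)
    (* h is so small that the parallelogram lies in the ball where f is smooth and both mixed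
       derivatives differ by less than e from their values at x *)
    define r where "r = min r0 (min r1 r2)"
    define h where "h = r / (norm v + norm w + 1)"
    have n: "norm v + norm w + 1 > 0" using norm_ge_zero[of v] norm_ge_zero[of w] by linarith
    have r: "r > 0" using r0 r1 r2 by (simp add: r_def)
    have h: "h > 0" "h * (norm v + norm w) < r"
      using n r by (simp_all add: h_def field_simps)
    have D: "f differentiable (at y)" "(\<lambda>y. frechet_derivative f (at y) u) differentiable (at y)" if "y \<in> ball x r" for y u
      using that r0(2) smooth_on_differentiable[OF S(2)] smooth_on_differentiable[OF smooth_on_frechet_const[OF S(2)]]
      by (auto simp: r_def)
    have near: "dist (x + s *\<^sub>R a + t *\<^sub>R b) x < r" if "0 \<le> s" "s \<le> h" "0 \<le> t" "t \<le> h" "norm a + norm b = norm v + norm w" for s t a b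
    proof -
      have "norm (s *\<^sub>R a + t *\<^sub>R b) \<le> norm (s *\<^sub>R a) + norm (t *\<^sub>R b)" by (rule norm_triangle_ineq)
      also have "\<dots> \<le> h * norm a + h * norm b" using that by (intro add_mono) (auto intro: mult_right_mono)
      also have "\<dots> = h * (norm v + norm w)" using that(5) by (metis distrib_left)
      also have "\<dots> < r" by (rule h)
      finally show ?thesis by (simp add: dist_norm)
    qed
    obtain s t where st: "0 \<le> s" "s \<le> h" "0 \<le> t" "t \<le> h"
      "f (x + h *\<^sub>R v + h *\<^sub>R w) - f (x + h *\<^sub>R v) - f (x + h *\<^sub>R w) + f x = h^2 * F v w (x + s *\<^sub>R v + t *\<^sub>R w)"
      using second_difference[of x r f v h w] D h unfolding F_def by auto
    obtain s' t' where st': "0 \<le> s'" "s' \<le> h" "0 \<le> t'" "t' \<le> h"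
      "f (x + h *\<^sub>R w + h *\<^sub>R v) - f (x + h *\<^sub>R w) - f (x + h *\<^sub>R v) + f x = h^2 * F w v (x + s' *\<^sub>R w + t' *\<^sub>R v)"
      using second_difference[of x r f w h v] D h unfolding F_def by (auto simp: add.commute)
    have "h^2 * F v w (x + s *\<^sub>R v + t *\<^sub>R w) = h^2 * F w v (x + s' *\<^sub>R w + t' *\<^sub>R v)"
      using st(5) st'(5) by (simp add: algebra_simps)
    then have "F v w (x + s *\<^sub>R v + t *\<^sub>R w) = F w v (x + s' *\<^sub>R w + t' *\<^sub>R v)" using h by simp
    moreover have "dist (F v w (x + s *\<^sub>R v + t *\<^sub>R w)) (F v w x) < e"
      using near[OF st(1-4), of v w] by (intro r1(2)) (simp add: r_def)
    moreover have "dist (F w v (x + s' *\<^sub>R w + t' *\<^sub>R v)) (F w v x) < e"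
      using near[OF st'(1-4), of w v] by (intro r2(2)) (simp add: r_def)
    ultimately show ?thesis by (simp add: dist_real_def)
  qed
  (* for this e the estimate bounds the difference by two thirds of itself *)
  from this[of "\<bar>F v w x - F w v x\<bar> / 3"] have "F v w x = F w v x" by fastforce
  then show ?thesis by (simp add: F_def)
qed

lemma symmetric_second_derivative:
  fixes f :: "'a::real_normed_vector \<Rightarrow> 'b::euclidean_space"
  assumes S: "open S" "smooth_on S f" "x \<in> S"
  shows "frechet_derivative (\<lambda>y. frechet_derivative f (at y) v) (at x) w =
         frechet_derivative (\<lambda>y. frechet_derivative f (at y) w) (at x) v"
proof (rule euclidean_eqI)
  fix b :: 'b
  have 1: "frechet_derivative (\<lambda>y. f y \<bullet> b) (at y) u = frechet_derivative f (at y) u \<bullet> b" if "y \<in> S" for y u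
    using frechet_derivative_bounded_linear(2)[OF bounded_linear_inner_left smooth_on_differentiable[OF S(2) that]] .
  have 2: "frechet_derivative (\<lambda>y. frechet_derivative f (at y) u) (at x) u' \<bullet> b =
    frechet_derivative (\<lambda>y. frechet_derivative (\<lambda>y. f y \<bullet> b) (at y) u) (at x) u'" for u u'
    using frechet_derivative_bounded_linear(2)[OF bounded_linear_inner_left
      smooth_on_differentiable[OF smooth_on_frechet_const[OF S(2)] S(3)], of u b u']
      frechet_derivative_cong_open[OF S(1,3), of "\<lambda>y. frechet_derivative (\<lambda>y. f y \<bullet> b) (at y) u"
          "\<lambda>y. frechet_derivative f (at y) u \<bullet> b"] 1 by simp
  show "frechet_derivative (\<lambda>y. frechet_derivative f (at y) v) (at x) w \<bullet> b =
         frechet_derivative (\<lambda>y. frechet_derivative f (at y) w) (at x) v \<bullet> b"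
    unfolding 2 by (intro symmetric_second_derivative_real[OF S(1) _ S(3)] smooth_on_bounded_linear[OF S(1) bounded_linear_inner_left S(2)])
qed

text \<open>The product rule for \<open>Df y (v y)\<close>, once for the dependence of \<open>Df\<close> on \<open>y\<close> and once for \<open>v\<close>; it is
  obtained by expanding \<open>v\<close> in the standard basis.\<close>

lemma frechet_derivative_frechet:
  fixes f :: "'a::euclidean_space \<Rightarrow> 'b::real_normed_vector"
  assumes S: "open S" "smooth_on S f" "x \<in> S" and v: "smooth_on S v"
  shows "frechet_derivative (\<lambda>y. frechet_derivative f (at y) (v y)) (at x) w =
    frechet_derivative (\<lambda>y. frechet_derivative f (at y) (v x)) (at x) w +
    frechet_derivative f (at x) (frechet_derivative v (at x) w)"
proof -
  define E where "E = (\<lambda>b y. frechet_derivative f (at y) b)"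
  have lin: "linear (\<lambda>b. E b y)" if "y \<in> S" for y
    unfolding E_def using linear_frechet_derivative[OF smooth_on_differentiable[OF S(2) that]] .
  have dE: "E b differentiable (at x)" for b
    unfolding E_def using smooth_on_differentiable[OF smooth_on_frechet_const[OF S(2)] S(3)] .
  have dv: "v differentiable (at x)" using smooth_on_differentiable[OF v S(3)] .
  have vb: "((\<lambda>y. v y \<bullet> b) has_derivative (\<lambda>w. frechet_derivative v (at x) w \<bullet> b)) (at x)" for b
    by (rule has_derivative_inner_left[OF has_frechet_derivative[OF dv]])
  have "((\<lambda>y. \<Sum>b\<in>Basis. (v y \<bullet> b) *\<^sub>R E b y) has_derivative
      (\<lambda>w. \<Sum>b\<in>Basis. (v x \<bullet> b) *\<^sub>R frechet_derivative (E b) (at x) w + (frechet_derivative v (at x) w \<bullet> b) *\<^sub>R E b x)) (at x)"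
    by (intro has_derivative_sum has_derivative_scaleR has_frechet_derivative dE vb)
  then have 1: "((\<lambda>y. E (v y) y) has_derivative
      (\<lambda>w. \<Sum>b\<in>Basis. (v x \<bullet> b) *\<^sub>R frechet_derivative (E b) (at x) w + (frechet_derivative v (at x) w \<bullet> b) *\<^sub>R E b x)) (at x)"
    by (rule has_derivative_transform_within_open[OF _ S(1,3)])
      (simp add: linear_euclidean_expansion[OF lin, symmetric])
  have "((\<lambda>y. \<Sum>b\<in>Basis. (v x \<bullet> b) *\<^sub>R E b y) has_derivative
      (\<lambda>w. \<Sum>b\<in>Basis. (v x \<bullet> b) *\<^sub>R frechet_derivative (E b) (at x) w)) (at x)"
    by (intro has_derivative_sum has_derivative_scaleR_right has_frechet_derivative dE)
  then have 2: "((\<lambda>y. E (v x) y) has_derivative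
      (\<lambda>w. \<Sum>b\<in>Basis. (v x \<bullet> b) *\<^sub>R frechet_derivative (E b) (at x) w)) (at x)"
    by (rule has_derivative_transform_within_open[OF _ S(1,3)])
      (simp add: linear_euclidean_expansion[OF lin, symmetric])
  show ?thesis
    using frechet_derivative_eqI[OF 1] frechet_derivative_eqI[OF 2]
      linear_euclidean_expansion[OF lin[OF S(3)], of "frechet_derivative v (at x) w"]
    by (simp add: E_def sum.distrib)
qed

text \<open>In the commutator of \<open>D\<^sub>u\<close> and \<open>D\<^sub>v\<close> the second derivatives of \<open>f\<close> cancel; only the derivative
  of \<open>f\<close> along the coordinate bracket is left.\<close>

lemma frechet_derivative_commutator:
  fixes f :: "'a::euclidean_space \<Rightarrow> 'b::euclidean_space"
  assumes S: "open S" "smooth_on S f" "x \<in> S" and uv: "smooth_on S u" "smooth_on S v"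
  shows "frechet_derivative (\<lambda>y. frechet_derivative f (at y) (v y)) (at x) (u x) -
      frechet_derivative (\<lambda>y. frechet_derivative f (at y) (u y)) (at x) (v x) =
    frechet_derivative f (at x) (frechet_derivative v (at x) (u x) - frechet_derivative u (at x) (v x))"
proof -
  have lin: "linear (frechet_derivative f (at x))"
    using linear_frechet_derivative[OF smooth_on_differentiable[OF S(2,3)]] .
  show ?thesis
    unfolding frechet_derivative_frechet[OF S uv(2)] frechet_derivative_frechet[OF S uv(1)] linear_diff[OF lin]
    using symmetric_second_derivative[OF S, of "v x" "u x"] by simp
qed

section \<open>Orthogonal projections\<close>

definition inner_form :: "('v::real_vector \<Rightarrow> 'v \<Rightarrow> real) \<Rightarrow> bool" where
  "inner_form b \<longleftrightarrow> bilinear b \<and> (\<forall>u v. b u v = b v u) \<and> (\<forall>u. u \<noteq> 0 \<longrightarrow> b u u > 0)"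

lemma inner_form_simps:
  assumes "inner_form b"
  shows "b (u + v) w = b u w + b v w" "b w (u + v) = b w u + b w v"
    "b (u - v) w = b u w - b v w" "b w (u - v) = b w u - b w v"
    "b (c *\<^sub>R u) w = c * b u w" "b w (c *\<^sub>R u) = c * b w u"
    "b 0 w = 0" "b w 0 = 0" "b (- u) w = - b u w" "b w (- u) = - b w u"
proof -
  have "linear (\<lambda>v. b v w)" "linear (b w)" using assms unfolding inner_form_def bilinear_def by auto
  from linear_add[OF this(1)] linear_add[OF this(2)] linear_diff[OF this(1)] linear_diff[OF this(2)]
    linear_scale[OF this(1)] linear_scale[OF this(2)] linear_0[OF this(1)] linear_0[OF this(2)]
    linear_neg[OF this(1)] linear_neg[OF this(2)]
  show "b (u + v) w = b u w + b v w" "b w (u + v) = b w u + b w v"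
    "b (u - v) w = b u w - b v w" "b w (u - v) = b w u - b w v"
    "b (c *\<^sub>R u) w = c * b u w" "b w (c *\<^sub>R u) = c * b w u"
    "b 0 w = 0" "b w 0 = 0" "b (- u) w = - b u w" "b w (- u) = - b w u" by auto
qed

lemma inner_form_commute: "inner_form b \<Longrightarrow> b u v = b v u"
  unfolding inner_form_def by blast

lemma inner_form_eq_0: "inner_form b \<Longrightarrow> b u u = 0 \<longleftrightarrow> u = 0"
  using inner_form_simps(7)[of b 0] unfolding inner_form_def by (metis less_irrefl)

lemma inner_form_eqI:
  assumes "inner_form b" "\<And>w. b u w = b v w" shows "u = v"
  using assms inner_form_eq_0[of b "u - v"] inner_form_simps(3)[of b u v "u - v"] by simp

lemma orth_proj_eqI:
  assumes "inner_form b" "subspace S" "w \<in> S" "\<And>s. s \<in> S \<Longrightarrow> b (v - w) s = 0"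
  shows "orth_proj b S v = w"
  unfolding orth_proj_def
proof (rule the_equality)
  fix w' assume w': "w' \<in> S \<and> (\<forall>s\<in>S. b (v - w') s = 0)"
  have "w' - w \<in> S" using w' assms by (simp add: subspace_diff)
  then have "b (v - w) (w' - w) - b (v - w') (w' - w) = 0" using w' assms by simp
  then have "b (w' - w) (w' - w) = 0" by (simp add: inner_form_simps[OF assms(1)])
  then show "w' = w" using inner_form_eq_0[OF assms(1)] by simp
qed (use assms in auto)

text \<open>One Gram-Schmidt step adds to the projection onto the span of \<open>e 0, \<dots>, e (k - 1)\<close> the
  component along the part of \<open>e k\<close> that is orthogonal to this span. If that part vanishes, the
  step adds zero because division by zero gives zero.\<close>

fun gram_schmidt_proj :: "('v::real_vector \<Rightarrow> 'v \<Rightarrow> real) \<Rightarrow> (nat \<Rightarrow> 'v) \<Rightarrow> nat \<Rightarrow> 'v \<Rightarrow> 'v" where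
  "gram_schmidt_proj b e 0 v = 0"
| "gram_schmidt_proj b e (Suc k) v = gram_schmidt_proj b e k v +
     (let u = e k - gram_schmidt_proj b e k (e k) in (b v u / b u u) *\<^sub>R u)"

lemma gram_schmidt_proj:
  assumes b: "inner_form b"
  shows "gram_schmidt_proj b e k v \<in> span (e ` {..<k}) \<and>
    (\<forall>s\<in>span (e ` {..<k}). b (v - gram_schmidt_proj b e k v) s = 0)"
proof (induction k arbitrary: v)
  case 0
  then show ?case by (simp add: inner_form_simps[OF b])
next
  case (Suc k)
  define P where "P = gram_schmidt_proj b e k"
  define u where "u = e k - P (e k)"
  define t where "t = b v u / b u u"
  have P: "P v \<in> span (e ` {..<k})" "\<And>s. s \<in> span (e ` {..<k}) \<Longrightarrow> b (v - P v) s = 0" for v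
    using Suc.IH[of v] unfolding P_def by auto
  have sub: "span (e ` {..<k}) \<subseteq> span (e ` {..<Suc k})" by (intro span_mono) auto
  have ek: "e k \<in> span (e ` {..<Suc k})" by (intro span_base) auto
  have u: "u \<in> span (e ` {..<Suc k})" unfolding u_def using ek P(1)[of "e k"] sub by (intro span_diff) auto
  have tu: "t * b u u = b v u" unfolding t_def using inner_form_eq_0[OF b, of u] inner_form_simps(8)[OF b] by auto
  have bPu: "b (P v) u = 0" using P(2)[of "P v" "e k"] P(1)[of v] inner_form_commute[OF b] by (metis u_def)
  have "b (v - (P v + t *\<^sub>R u)) s = 0" if s: "s \<in> span (e ` {..<Suc k})" for s
  proof -
    have "s \<in> span (insert (e k) (e ` {..<k}))" using s by (simp add: lessThan_Suc)
    then obtain c where "s - c *\<^sub>R e k \<in> span (e ` {..<k})" by (auto simp: span_insert)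
    then have s': "s - c *\<^sub>R u \<in> span (e ` {..<k})"
      using span_add[OF _ span_scale[OF P(1)[of "e k"], of c], of "s - c *\<^sub>R e k"] by (simp add: u_def algebra_simps)
    have "b (v - (P v + t *\<^sub>R u)) (s - c *\<^sub>R u) = b (v - P v) (s - c *\<^sub>R u) - t * b u (s - c *\<^sub>R u)"
      using inner_form_simps(3)[OF b, of "v - P v" "t *\<^sub>R u"] by (simp add: inner_form_simps(5)[OF b] diff_diff_add)
    also have "\<dots> = 0" using P(2)[OF s', of v] P(2)[OF s', of "e k"] by (simp add: u_def)
    finally have 1: "b (v - (P v + t *\<^sub>R u)) (s - c *\<^sub>R u) = 0" .
    have 2: "b (v - (P v + t *\<^sub>R u)) u = 0"
      using tu bPu by (simp add: inner_form_simps[OF b])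
    show ?thesis using 1 2 inner_form_simps(4,6)[OF b] by simp
  qed
  moreover have "P v + t *\<^sub>R u \<in> span (e ` {..<Suc k})"
    using P(1)[of v] sub u by (intro span_add span_scale) auto
  ultimately show ?case unfolding P_def u_def t_def by (simp add: Let_def)
qed

lemma orth_proj_span:
  "inner_form b \<Longrightarrow> orth_proj b (span (e ` {..<k})) v = gram_schmidt_proj b e k v"
  using gram_schmidt_proj[of b e k v] by (intro orth_proj_eqI) auto

lemma orth_proj:
  fixes S :: "'v::euclidean_space set"
  assumes b: "inner_form b" and S: "subspace S"
  shows "orth_proj b S v \<in> S" "s \<in> S \<Longrightarrow> b (v - orth_proj b S v) s = 0"
    "s \<in> S \<Longrightarrow> b (orth_proj b S v) s = b v s"
proof -
  obtain B where B: "B \<subseteq> S" "independent B" "S \<subseteq> span B" using basis_exists[of S] by metis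
  then have f: "finite B" using independent_imp_finite by blast
  obtain e where e: "bij_betw e {0..<card B} B" using ex_bij_betw_nat_finite[OF f] by blast
  have SB: "S = span (e ` {..<card B})"
    using B S e span_minimal[OF B(1) S] by (auto simp: bij_betw_def atLeast0LessThan)
  note P = gram_schmidt_proj[OF b, of e "card B" v, folded orth_proj_span[OF b] SB]
  show "orth_proj b S v \<in> S" "s \<in> S \<Longrightarrow> b (v - orth_proj b S v) s = 0" using P by auto
  show "b (orth_proj b S v) s = b v s" if "s \<in> S"
    using P that by (simp add: inner_form_simps[OF b])
qed

lemma orth_proj_ident:
  assumes "inner_form b" "subspace S" "v \<in> S" shows "orth_proj b S v = v"
  using assms by (intro orth_proj_eqI) (auto simp: inner_form_simps)

lemma orth_proj_perp:
  assumes "inner_form b" "subspace S" "\<And>s. s \<in> S \<Longrightarrow> b v s = 0" shows "orth_proj b S v = 0"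
  using assms by (intro orth_proj_eqI) (auto simp: inner_form_simps subspace_0)

lemma linear_orth_proj:
  fixes S :: "'v::euclidean_space set"
  assumes b: "inner_form b" and S: "subspace S"
  shows "linear (orth_proj b S)"
proof (rule linearI)
  fix u v show "orth_proj b S (u + v) = orth_proj b S u + orth_proj b S v"
    by (intro orth_proj_eqI[OF b S]) (auto simp: inner_form_simps[OF b] orth_proj[OF b S] intro: subspace_add[OF S])
next
  fix c v show "orth_proj b S (c *\<^sub>R v) = c *\<^sub>R orth_proj b S v"
    by (intro orth_proj_eqI[OF b S]) (auto simp: inner_form_simps[OF b] orth_proj[OF b S] intro: subspace_scale[OF S])
qed

lemma orth_proj_orth_proj:
  fixes S T :: "'v::euclidean_space set"
  assumes b: "inner_form b" and S: "subspace S" and T: "subspace T" and "S \<subseteq> T"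
  shows "orth_proj b S (orth_proj b T v) = orth_proj b S v"
proof (rule orth_proj_eqI[OF b S orth_proj(1)[OF b S]])
  fix s assume s: "s \<in> S"
  then have "b (orth_proj b T v) s = b v s" using orth_proj(3)[OF b T] assms(4) by blast
  then show "b (orth_proj b T v - orth_proj b S v) s = 0"
    using orth_proj(2)[OF b S s, of v] by (simp add: inner_form_simps[OF b])
qed

lemma orth_proj_self_adjoint:
  fixes S :: "'v::euclidean_space set"
  assumes b: "inner_form b" and S: "subspace S"
  shows "b (orth_proj b S u) v = b u (orth_proj b S v)"
  using orth_proj(3)[OF b S orth_proj(1)[OF b S], of u v] orth_proj(3)[OF b S orth_proj(1)[OF b S], of v u]
    inner_form_commute[OF b] by metis

text \<open>Applied to the differential of a chart, this computes projections in coordinates; applied to the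
  differential of the embedding, it compares projections in \<open>TM\<close> and in \<open>\<E>\<close>.\<close>

lemma orth_proj_linear_image:
  fixes S :: "'v::euclidean_space set" and L :: "'v \<Rightarrow> 'w::real_vector"
  assumes b: "inner_form b" and S: "subspace S" and b': "inner_form b'" and L: "linear L"
    and iso: "\<And>u v. b' (L u) (L v) = b u v"
  shows "orth_proj b' (L ` S) (L v) = L (orth_proj b S v)"
proof (rule orth_proj_eqI[OF b'])
  show "subspace (L ` S)" using L S by (rule linear_subspace_image)
  show "L (orth_proj b S v) \<in> L ` S" using orth_proj(1)[OF b S] by blast
  fix s assume "s \<in> L ` S"
  then show "b' (L v - L (orth_proj b S v)) s = 0"
    by (auto simp: linear_diff[OF L, symmetric] iso orth_proj(2)[OF b S])
qed

lemma smooth_on_bilinear_form: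
  fixes G :: "'a::real_normed_vector \<Rightarrow> 'v::euclidean_space \<Rightarrow> 'v \<Rightarrow> real"
  assumes S: "open S" and G: "\<And>a b. smooth_on S (\<lambda>x. G x a b)"
    and bil: "\<And>x. x \<in> S \<Longrightarrow> bilinear (G x)"
    and uv: "smooth_on S u" "smooth_on S v"
  shows "smooth_on S (\<lambda>x. G x (u x) (v x))"
proof (rule smooth_on_cong[OF _ S])
  show "smooth_on S (\<lambda>x. \<Sum>j\<in>Basis. (v x \<bullet> j) * (\<Sum>i\<in>Basis. (u x \<bullet> i) * G x i j))"
    by (intro smooth_on_sum smooth_on_mult smooth_on_inner S G uv smooth_on_const)
  fix x assume "x \<in> S"
  then have "linear (\<lambda>u. G x u w)" "linear (G x w)" for w using bil unfolding bilinear_def by auto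
  note e = this[THEN linear_euclidean_expansion]
  show "(\<Sum>j\<in>Basis. (v x \<bullet> j) * (\<Sum>i\<in>Basis. (u x \<bullet> i) * G x i j)) = G x (u x) (v x)"
    unfolding e(2)[of "u x" "v x"] using e(1)[of "u x"] by simp
qed

text \<open>Gram-Schmidt only uses inner products and divisions by \<open>G x u u\<close>, where \<open>u\<close> is the part of a
  frame vector orthogonal to its predecessors, nonzero by independence. So the projection onto the
  span of a smooth frame is smooth.\<close>

lemma smooth_on_orth_proj:
  fixes G :: "'a::real_normed_vector \<Rightarrow> 'v::euclidean_space \<Rightarrow> 'v \<Rightarrow> real"
    and e :: "nat \<Rightarrow> 'a \<Rightarrow> 'v"
  assumes S: "open S" and G: "\<And>a b. smooth_on S (\<lambda>x. G x a b)"
    and form: "\<And>x. x \<in> S \<Longrightarrow> inner_form (G x)"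
    and e: "\<And>i. i < k \<Longrightarrow> smooth_on S (e i)"
    and indep: "\<And>x. x \<in> S \<Longrightarrow> inj_on (\<lambda>i. e i x) {..<k} \<and> independent ((\<lambda>i. e i x) ` {..<k})"
    and c: "smooth_on S c"
  shows "smooth_on S (\<lambda>x. orth_proj (G x) (span ((\<lambda>i. e i x) ` {..<k})) (c x))"
proof -
  have "smooth_on S (\<lambda>x. gram_schmidt_proj (G x) (\<lambda>i. e i x) k (c x))"
    using e indep c
  proof (induction k arbitrary: c)
    case 0
    then show ?case by (simp add: smooth_on_const)
  next
    case (Suc k)
    have IH: "smooth_on S (\<lambda>x. gram_schmidt_proj (G x) (\<lambda>i. e i x) k (c x))" if "smooth_on S c" for c
    proof (rule Suc.IH)
      show "inj_on (\<lambda>i. e i x) {..<k} \<and> independent ((\<lambda>i. e i x) ` {..<k})" if "x \<in> S" for x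
        using Suc.prems(2)[OF that]
          independent_mono[of "(\<lambda>i. e i x) ` {..<Suc k}" "(\<lambda>i. e i x) ` {..<k}"]
        by (auto intro: inj_on_subset simp: image_mono)
    qed (use Suc.prems that in auto)
    define u where "u = (\<lambda>x. e k x - gram_schmidt_proj (G x) (\<lambda>i. e i x) k (e k x))"
    have u: "smooth_on S u" unfolding u_def using Suc.prems IH by (intro smooth_on_diff S) auto
    have nz: "G x (u x) (u x) \<noteq> 0" if x: "x \<in> S" for x
    proof
      assume "G x (u x) (u x) = 0"
      then have "u x = 0" using inner_form_eq_0[OF form[OF x]] by simp
      then have "e k x \<in> span ((\<lambda>i. e i x) ` {..<k})"
        using gram_schmidt_proj[OF form[OF x], of "\<lambda>i. e i x" k "e k x"] by (simp add: u_def)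
      moreover have "e k x \<notin> span ((\<lambda>i. e i x) ` {..<Suc k} - {e k x})"
        using Suc.prems(2)[OF x] unfolding dependent_def by (auto)
      moreover have "(\<lambda>i. e i x) ` {..<Suc k} - {e k x} = (\<lambda>i. e i x) ` {..<k}"
        using Suc.prems(2)[OF x] by (auto simp: lessThan_Suc inj_on_def)
      ultimately show False by simp
    qed
    have bil: "bilinear (G x)" if "x \<in> S" for x using form[OF that] by (simp add: inner_form_def)
    show ?case
      unfolding gram_schmidt_proj.simps Let_def fun_cong[OF u_def, symmetric]
      using Suc.prems(3) nz
      by (intro smooth_on_add smooth_on_scaleR smooth_on_divide S smooth_on_bilinear_form[OF S G bil] u IH) auto
  qed
  then show ?thesis by (rule smooth_on_cong[OF _ S]) (simp add: orth_proj_span[OF form])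
qed

text \<open>Smoothness of an operator-valued map is tested on vectors: an operator on a Euclidean space is
  the sum of the rank-one operators \<open>v \<mapsto> (v \<bullet> b) P b\<close> over the standard basis.\<close>

lemma smooth_on_Blinfun:
  fixes P :: "'a::real_normed_vector \<Rightarrow> 'v::euclidean_space \<Rightarrow> 'w::real_normed_vector"
  assumes S: "open S" and P: "\<And>v. smooth_on S (\<lambda>x. P x v)" and lin: "\<And>x. x \<in> S \<Longrightarrow> linear (P x)"
  shows "smooth_on S (\<lambda>x. Blinfun (P x))"
proof (rule smooth_on_cong[OF _ S])
  show "smooth_on S (\<lambda>x. \<Sum>b\<in>Basis. blinfun_scaleR_left (P x b) o\<^sub>L blinfun_inner_left b)"
    by (intro smooth_on_sum S P smooth_on_bounded_linear[OF S bounded_linear_compose[OF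
        bounded_bilinear.bounded_linear_left[OF bounded_bilinear_blinfun_compose]
        bounded_linear_blinfun_scaleR_left]])
  fix x assume "x \<in> S"
  then have l: "linear (P x)" by (rule lin)
  show "(\<Sum>b\<in>Basis. blinfun_scaleR_left (P x b) o\<^sub>L blinfun_inner_left b) = Blinfun (P x)"
  proof (rule blinfun_eqI)
    fix v
    have "blinfun_apply (Blinfun (P x)) v = P x v"
      using l by (simp add: bounded_linear_Blinfun_apply linear_conv_bounded_linear)
    also have "\<dots> = (\<Sum>b\<in>Basis. (v \<bullet> b) *\<^sub>R P x b)" by (rule linear_euclidean_expansion[OF l])
    finally show "blinfun_apply (\<Sum>b\<in>Basis. blinfun_scaleR_left (P x b) o\<^sub>L blinfun_inner_left b) v =
        blinfun_apply (Blinfun (P x)) v"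
      by (simp add: blinfun.sum_left)
  qed
qed

section \<open>Charts, directional derivatives and coordinates\<close>

locale smooth_mfd =
  fixes M :: "('m, 'n::euclidean_space) manifold"
  assumes smooth_manifold: "smooth_manifold M"
begin

lemma chart_in_pts: "c \<in> atlas M \<Longrightarrow> fst c \<subseteq> pts M"
  using smooth_manifold unfolding smooth_manifold_def by auto

lemma
  assumes "c \<in> atlas M"
  shows chart_openin: "openin (mtop M) (fst c)"
    and chart_open_image: "open (snd c ` fst c)"
    and chart_homeomorphic: "homeomorphic_map (subtopology (mtop M) (fst c)) (top_of_set (snd c ` fst c)) (snd c)"
  using smooth_manifold assms unfolding smooth_manifold_def by fastforce+

lemma topspace_chart: "c \<in> atlas M \<Longrightarrow> topspace (subtopology (mtop M) (fst c)) = fst c"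
  using chart_in_pts[of c] by (auto simp: pts_def)

lemma chart_inj_on: "c \<in> atlas M \<Longrightarrow> inj_on (snd c) (fst c)"
  using chart_homeomorphic homeomorphic_imp_injective_map topspace_chart by metis

lemma chart_inv_chart [simp]: "c \<in> atlas M \<Longrightarrow> x \<in> fst c \<Longrightarrow> chart_inv c (snd c x) = x"
  unfolding chart_inv_def by (simp add: chart_inj_on)

lemma open_chart_image:
  assumes c: "c \<in> atlas M" and W: "openin (mtop M) W"
  shows "open (snd c ` (fst c \<inter> W))"
proof -
  have "open_map (subtopology (mtop M) (fst c)) (top_of_set (snd c ` fst c)) (snd c)"
    using chart_homeomorphic[OF c] homeomorphic_imp_open_map by blast
  moreover have "openin (subtopology (mtop M) (fst c)) (fst c \<inter> W)"
    by (rule openin_subtopology_Int2[OF W])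
  ultimately have "openin (top_of_set (snd c ` fst c)) (snd c ` (fst c \<inter> W))"
    unfolding open_map_def by blast
  then show ?thesis using chart_open_image[OF c] openin_open_trans by blast
qed

lemma chart_at: "x \<in> pts M \<Longrightarrow> chart_at M x \<in> atlas M \<and> x \<in> fst (chart_at M x)"
proof -
  assume "x \<in> pts M"
  then have "\<exists>c. c \<in> atlas M \<and> x \<in> fst c"
    using smooth_manifold unfolding smooth_manifold_def by auto
  then show ?thesis unfolding chart_at_def by (rule someI_ex)
qed

lemma chart_at_chart: "c \<in> atlas M \<Longrightarrow> x \<in> fst c \<Longrightarrow> chart_at M x \<in> atlas M \<and> x \<in> fst (chart_at M x)"
  using chart_at chart_in_pts by blast

lemma smooth_transition:
  assumes "c \<in> atlas M" "c' \<in> atlas M"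
  shows "smooth_on (snd c ` (fst c \<inter> fst c')) (\<lambda>p. snd c' (chart_inv c p))"
  using smooth_manifold assms unfolding smooth_manifold_def by (fastforce simp: o_def)

lemma smooth_fun_iff:
  "smooth_fun M f \<longleftrightarrow> (\<forall>c\<in>atlas M. smooth_on (snd c ` fst c) (\<lambda>p. f (chart_inv c p)))"
  unfolding smooth_fun_def by (fastforce simp: o_def)

lemma smooth_vf_on_iff:
  "smooth_vf_on M W X \<longleftrightarrow> (\<forall>c\<in>atlas M. smooth_on (snd c ` (fst c \<inter> W)) (vf_rep M c X))"
  unfolding smooth_vf_on_def by fastforce

lemma smooth_vf_iff:
  "smooth_vf M X \<longleftrightarrow> (\<forall>c\<in>atlas M. smooth_on (snd c ` fst c) (vf_rep M c X))"
proof -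
  have "fst c \<inter> pts M = fst c" if "c \<in> atlas M" for c using chart_in_pts[OF that] by blast
  then show ?thesis unfolding smooth_vf_on_iff by auto
qed

subsection \<open>Directional derivatives\<close>

text \<open>Differentiability is tested in the preferred chart, where the directional derivative is
  computed; by smoothness of the transition maps every other chart gives the same notion.\<close>

definition mdiff :: "('m \<Rightarrow> 'a::real_normed_vector) \<Rightarrow> 'm \<Rightarrow> bool" where
  "mdiff F x \<longleftrightarrow> (\<lambda>p. F (chart_inv (chart_at M x) p)) differentiable (at (snd (chart_at M x) x))"

lemma dird_def': "dird M F x = frechet_derivative (\<lambda>p. F (chart_inv (chart_at M x) p)) (at (snd (chart_at M x) x))"
  unfolding dird_def o_def by (rule refl)

text \<open>Near \<open>x\<close> one has \<open>F \<circ> c\<^sup>-\<^sup>1 = (F \<circ> c'\<^sup>-\<^sup>1) \<circ> (c' \<circ> c\<^sup>-\<^sup>1)\<close>, so this is the chain rule.\<close>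

lemma chart_change:
  assumes c: "c \<in> atlas M" "c' \<in> atlas M" and x: "x \<in> fst c" "x \<in> fst c'"
    and d: "(\<lambda>p. F (chart_inv c' p)) differentiable (at (snd c' x))"
  shows "(\<lambda>p. F (chart_inv c p)) differentiable (at (snd c x))"
    "frechet_derivative (\<lambda>p. F (chart_inv c p)) (at (snd c x)) v =
     frechet_derivative (\<lambda>p. F (chart_inv c' p)) (at (snd c' x))
       (frechet_derivative (\<lambda>p. snd c' (chart_inv c p)) (at (snd c x)) v)"
proof -
  let ?S = "snd c ` (fst c \<inter> fst c')"
  have S: "open ?S" "snd c x \<in> ?S"
    using open_chart_image[OF c(1) chart_openin[OF c(2)]] x by auto
  have t: "(\<lambda>p. snd c' (chart_inv c p)) differentiable (at (snd c x))"
    using smooth_on_differentiable[OF smooth_transition[OF c] S(2)] .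
  have d': "(\<lambda>p. F (chart_inv c' p)) differentiable (at (snd c' (chart_inv c (snd c x))))"
    using d c x by simp
  have eq: "F (chart_inv c' (snd c' (chart_inv c p))) = F (chart_inv c p)" if "p \<in> ?S" for p
    using that c by auto
  note ch = frechet_derivative_chain[OF t d']
  show "(\<lambda>p. F (chart_inv c p)) differentiable (at (snd c x))"
    by (rule differentiable_cong_open[OF S eq ch(1)])
  show "frechet_derivative (\<lambda>p. F (chart_inv c p)) (at (snd c x)) v =
     frechet_derivative (\<lambda>p. F (chart_inv c' p)) (at (snd c' x))
       (frechet_derivative (\<lambda>p. snd c' (chart_inv c p)) (at (snd c x)) v)"
    using ch(2)[of v] frechet_derivative_cong_open[OF S eq] c x by simp
qed

lemma mdiff_iff:
  assumes c: "c \<in> atlas M" "x \<in> fst c"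
  shows "mdiff F x \<longleftrightarrow> (\<lambda>p. F (chart_inv c p)) differentiable (at (snd c x))"
proof -
  note x = chart_at[of x] chart_in_pts[OF c(1)] c(2)
  then have "chart_at M x \<in> atlas M" "x \<in> fst (chart_at M x)" by auto
  with c show ?thesis unfolding mdiff_def using chart_change(1)[of _ _ x F] by metis
qed

lemma dird_chart:
  assumes c: "c \<in> atlas M" "x \<in> fst c" and F: "mdiff F x"
  shows "dird M F x \<xi> = frechet_derivative (\<lambda>p. F (chart_inv c p)) (at (snd c x)) (dird M (snd c) x \<xi>)"
proof -
  have x: "chart_at M x \<in> atlas M" "x \<in> fst (chart_at M x)" using chart_at_chart[OF c] by auto
  show ?thesis
    unfolding dird_def' by (rule chart_change(2)[OF x(1) c(1) x(2) c(2) F[unfolded mdiff_iff[OF c]]])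
qed

lemma linear_dird: "mdiff F x \<Longrightarrow> linear (dird M F x)"
  unfolding mdiff_def dird_def' by (rule linear_frechet_derivative)

lemma mdiff_smooth_fun: "smooth_fun M F \<Longrightarrow> x \<in> pts M \<Longrightarrow> mdiff F x"
  unfolding mdiff_def smooth_fun_iff using chart_at[of x] by (auto intro: smooth_on_differentiable)

lemma local_chart_nbhd:
  assumes "x \<in> pts M" "openin (mtop M) W" "x \<in> W"
  shows "open (snd (chart_at M x) ` (fst (chart_at M x) \<inter> W))"
    "snd (chart_at M x) x \<in> snd (chart_at M x) ` (fst (chart_at M x) \<inter> W)"
    "p \<in> snd (chart_at M x) ` (fst (chart_at M x) \<inter> W) \<Longrightarrow> chart_inv (chart_at M x) p \<in> W"
  using open_chart_image[of "chart_at M x" W] assms chart_at[of x] by auto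

lemma openin_pts: "openin (mtop M) (pts M)"
  by (simp add: pts_def)

lemma openin_subset_pts: "openin (mtop M) W \<Longrightarrow> W \<subseteq> pts M"
  by (simp add: pts_def openin_subset)

lemma dird_cong:
  assumes W: "openin (mtop M) W" "x \<in> W" and eq: "\<And>y. y \<in> W \<Longrightarrow> F y = G y"
  shows "dird M F x = dird M G x"
proof -
  have x: "x \<in> pts M" using W openin_subset_pts by blast
  note N = local_chart_nbhd[OF x W]
  show ?thesis
    unfolding dird_def' by (rule frechet_derivative_cong_open[OF N(1,2)]) (simp add: eq N(3))
qed

lemma dird_const [simp]: "dird M (\<lambda>y. a) x \<xi> = 0"
  by (simp add: dird_def')

lemma dird_bilinear:
  assumes "bounded_bilinear b" "x \<in> pts M" "mdiff F x" "mdiff G x"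
  shows "dird M (\<lambda>y. b (F y) (G y)) x \<xi> = b (F x) (dird M G x \<xi>) + b (dird M F x \<xi>) (G x)"
  using frechet_derivative_bilinear(2)[OF assms(1) assms(3,4)[unfolded mdiff_def]] chart_at[OF assms(2)]
  by (simp add: dird_def')

subsection \<open>Coordinates of tangent vectors\<close>

lemma mdiff_chart:
  assumes c: "c \<in> atlas M" "x \<in> fst c" shows "mdiff (snd c) x"
  unfolding mdiff_iff[OF c]
proof (rule differentiable_cong_open[OF chart_open_image[OF c(1)]])
  show "(\<lambda>p. p) differentiable (at (snd c x))" by simp
qed (use c in auto)

lemma dird_chart_coord_vec:
  assumes c: "c \<in> atlas M" "x \<in> fst c"
  shows "dird M (snd c) x (coord_vec M c a x) = a"
proof -
  have x: "chart_at M x \<in> atlas M" "x \<in> fst (chart_at M x)" using chart_at_chart[OF c] by auto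
  have "frechet_derivative (\<lambda>p. snd c (chart_inv c p)) (at (snd c x)) a = frechet_derivative (\<lambda>p. p) (at (snd c x)) a"
    by (rule fun_cong[OF frechet_derivative_cong_open[OF chart_open_image[OF c(1)]]]) (use c in auto)
  then show ?thesis
    unfolding dird_def' coord_vec_def o_def
    using chart_change(2)[OF c(1) x(1) c(2) x(2) mdiff_chart[OF c, unfolded mdiff_def], of a] by simp
qed

lemma coord_vec_dird_chart:
  assumes c: "c \<in> atlas M" "x \<in> fst c"
  shows "coord_vec M c (dird M (snd c) x \<xi>) x = \<xi>"
proof -
  have x: "chart_at M x \<in> atlas M" "x \<in> fst (chart_at M x)" using chart_at_chart[OF c] by auto
  let ?c = "chart_at M x"
  have "frechet_derivative (\<lambda>p. snd ?c (chart_inv ?c p)) (at (snd ?c x)) \<xi> = frechet_derivative (\<lambda>p. p) (at (snd ?c x)) \<xi>"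
    by (rule fun_cong[OF frechet_derivative_cong_open[OF chart_open_image[OF x(1)]]]) (use x in auto)
  then show ?thesis
    unfolding dird_def' coord_vec_def o_def
    using chart_change(2)[OF x(1) c(1) x(2) c(2) mdiff_chart[OF x, unfolded mdiff_iff[OF c]], of \<xi>] by simp
qed

lemma dird_chart_at: "x \<in> pts M \<Longrightarrow> dird M (snd (chart_at M x)) x \<xi> = \<xi>"
proof -
  assume "x \<in> pts M"
  then have x: "chart_at M x \<in> atlas M" "x \<in> fst (chart_at M x)" using chart_at by auto
  let ?c = "chart_at M x"
  have "frechet_derivative (\<lambda>p. snd ?c (chart_inv ?c p)) (at (snd ?c x)) \<xi> = frechet_derivative (\<lambda>p. p) (at (snd ?c x)) \<xi>"
    by (rule fun_cong[OF frechet_derivative_cong_open[OF chart_open_image[OF x(1)]]]) (use x in auto)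
  then show ?thesis by (simp add: dird_def')
qed

lemma linear_dird_chart: "c \<in> atlas M \<Longrightarrow> x \<in> fst c \<Longrightarrow> linear (dird M (snd c) x)"
  by (intro linear_dird mdiff_chart)

lemma inj_dird_chart: "c \<in> atlas M \<Longrightarrow> x \<in> fst c \<Longrightarrow> inj (dird M (snd c) x)"
  by (metis coord_vec_dird_chart injI)

lemma coord_vec_linear: "c \<in> atlas M \<Longrightarrow> x \<in> fst c \<Longrightarrow> linear (\<lambda>a. coord_vec M c a x)"
proof (rule linearI)
  assume c: "c \<in> atlas M" "x \<in> fst c"
  show "coord_vec M c (a + b) x = coord_vec M c a x + coord_vec M c b x" for a b
    by (rule injD[OF inj_dird_chart[OF c]]) (simp add: dird_chart_coord_vec[OF c] linear_add[OF linear_dird_chart[OF c]])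
  show "coord_vec M c (r *\<^sub>R b) x = r *\<^sub>R coord_vec M c b x" for r b
    by (rule injD[OF inj_dird_chart[OF c]]) (simp add: dird_chart_coord_vec[OF c] linear_scale[OF linear_dird_chart[OF c]])
qed

lemma vf_rep_chart: "c \<in> atlas M \<Longrightarrow> y \<in> fst c \<Longrightarrow> vf_rep M c X (snd c y) = dird M (snd c) y (X y)"
  by (simp add: vf_rep_def)

lemma coord_vec_vf_rep: "c \<in> atlas M \<Longrightarrow> y \<in> fst c \<Longrightarrow> coord_vec M c (vf_rep M c X (snd c y)) y = X y"
  by (simp add: vf_rep_chart coord_vec_dird_chart)

lemma dird_vf:
  assumes c: "c \<in> atlas M" "y \<in> fst c" and F: "mdiff F y"
  shows "dird M F y (X y) = frechet_derivative (\<lambda>p. F (chart_inv c p)) (at (snd c y)) (vf_rep M c X (snd c y))"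
  using dird_chart[OF assms] c by (simp add: vf_rep_chart)

text \<open>Smoothness on an open part of \<open>M\<close>: a submersion followed by a chart of its target is only
  meaningful on the preimage of the chart domain.\<close>

definition smooth_fun_on :: "'m set \<Rightarrow> ('m \<Rightarrow> 'a::real_normed_vector) \<Rightarrow> bool" where
  "smooth_fun_on W F \<longleftrightarrow> (\<forall>c\<in>atlas M. smooth_on (snd c ` (fst c \<inter> W)) (\<lambda>p. F (chart_inv c p)))"

lemma smooth_fun_imp_smooth_fun_on: "smooth_fun M F \<Longrightarrow> smooth_fun_on W F"
  unfolding smooth_fun_iff smooth_fun_on_def by (blast intro: smooth_on_subset)

lemma smooth_fun_on_pts: "smooth_fun_on (pts M) F \<longleftrightarrow> smooth_fun M F"
proof -
  have "fst c \<inter> pts M = fst c" if "c \<in> atlas M" for c using chart_in_pts[OF that] by blast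
  then show ?thesis unfolding smooth_fun_on_def smooth_fun_iff by auto
qed

lemma mdiff_smooth_fun_on:
  assumes "smooth_fun_on W F" "openin (mtop M) W" "x \<in> W" shows "mdiff F x"
proof -
  have x: "x \<in> pts M" using assms openin_subset_pts by blast
  show ?thesis unfolding mdiff_def
    by (rule smooth_on_differentiable[OF _ local_chart_nbhd(2)[OF x assms(2,3)]])
      (use assms chart_at[OF x] in \<open>auto simp: smooth_fun_on_def\<close>)
qed

lemma smooth_fun_on_dird_vf:
  assumes F: "smooth_fun_on W F" and X: "smooth_vf_on M W X" and W: "openin (mtop M) W"
  shows "smooth_fun_on W (\<lambda>y. dird M F y (X y))"
  unfolding smooth_fun_on_def
proof
  fix c assume c: "c \<in> atlas M"
  have o: "open (snd c ` (fst c \<inter> W))" by (rule open_chart_image[OF c W])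
  have "smooth_on (snd c ` (fst c \<inter> W)) (\<lambda>p. frechet_derivative (\<lambda>p. F (chart_inv c p)) (at p) (vf_rep M c X p))"
    using F X c unfolding smooth_fun_on_def smooth_vf_on_iff by (intro smooth_on_frechet o) auto
  then show "smooth_on (snd c ` (fst c \<inter> W)) (\<lambda>p. dird M F (chart_inv c p) (X (chart_inv c p)))"
  proof (rule smooth_on_cong[OF _ o])
    fix p assume "p \<in> snd c ` (fst c \<inter> W)"
    then obtain y where y: "y \<in> fst c" "p = snd c y" "y \<in> W" by blast
    from dird_vf[OF c y(1) mdiff_smooth_fun_on[OF F W y(3)]]
    show "frechet_derivative (\<lambda>p. F (chart_inv c p)) (at p) (vf_rep M c X p) =
        dird M F (chart_inv c p) (X (chart_inv c p))" using y c by simp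
  qed
qed

lemma smooth_fun_dird_vf:
  "smooth_fun M F \<Longrightarrow> smooth_vf M X \<Longrightarrow> smooth_fun M (\<lambda>y. dird M F y (X y))"
  using smooth_fun_on_dird_vf[OF _ _ openin_pts] by (simp add: smooth_fun_on_pts)

text \<open>Transition maps are smooth and smoothness is local, so one well-chosen chart near each point is
  enough, both for functions and for vector fields.\<close>

lemma smooth_funI:
  fixes F :: "'m \<Rightarrow> 'a::real_normed_vector"
  assumes "\<And>x. x \<in> pts M \<Longrightarrow> \<exists>c\<in>atlas M. \<exists>W. openin (mtop M) W \<and> x \<in> fst c \<inter> W \<and>
      smooth_on (snd c ` (fst c \<inter> W)) (\<lambda>p. F (chart_inv c p))"
  shows "smooth_fun M F"
  unfolding smooth_fun_iff
proof
  fix c assume c: "c \<in> atlas M"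
  show "smooth_on (snd c ` fst c) (\<lambda>p. F (chart_inv c p))"
  proof (rule smooth_on_local)
    fix p assume "p \<in> snd c ` fst c"
    then obtain x where x: "x \<in> fst c" "p = snd c x" by blast
    then obtain c' W where W: "c' \<in> atlas M" "openin (mtop M) W" "x \<in> fst c' \<inter> W"
      "smooth_on (snd c' ` (fst c' \<inter> W)) (\<lambda>p. F (chart_inv c' p))"
      using assms chart_in_pts[OF c] by blast
    let ?N = "snd c ` (fst c \<inter> (fst c' \<inter> W))"
    have o: "open ?N" using W chart_openin[OF W(1)] by (intro open_chart_image[OF c]) auto
    have "smooth_on ?N (\<lambda>p. snd c' (chart_inv c p))"
      by (rule smooth_on_subset[OF smooth_transition[OF c W(1)]]) auto
    from smooth_on_compose[OF o this W(4)]
    have "smooth_on ?N (\<lambda>p. F (chart_inv c' (snd c' (chart_inv c p))))" using c by fastforce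
    then have "smooth_on ?N (\<lambda>p. F (chart_inv c p))"
      by (rule smooth_on_cong[OF _ o]) (use c W in auto)
    then show "\<exists>N. open N \<and> p \<in> N \<and> smooth_on N (\<lambda>p. F (chart_inv c p))"
      using o x W(3) by blast
  qed
qed

lemma smooth_vfI:
  assumes "\<And>x. x \<in> pts M \<Longrightarrow> \<exists>c\<in>atlas M. \<exists>W. openin (mtop M) W \<and> x \<in> fst c \<inter> W \<and>
      smooth_on (snd c ` (fst c \<inter> W)) (vf_rep M c X)"
  shows "smooth_vf M X"
  unfolding smooth_vf_iff
proof
  fix c assume c: "c \<in> atlas M"
  show "smooth_on (snd c ` fst c) (vf_rep M c X)"
  proof (rule smooth_on_local)
    fix p assume "p \<in> snd c ` fst c"
    then obtain x where x: "x \<in> fst c" "p = snd c x" by blast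
    then obtain c' W where W: "c' \<in> atlas M" "openin (mtop M) W" "x \<in> fst c' \<inter> W"
      "smooth_on (snd c' ` (fst c' \<inter> W)) (vf_rep M c' X)"
      using assms chart_in_pts[OF c] by blast
    let ?N = "snd c ` (fst c \<inter> (fst c' \<inter> W))" and ?N' = "snd c' ` (fst c' \<inter> (fst c \<inter> W))"
    have o: "open ?N" "open ?N'" using W chart_openin[OF W(1)] chart_openin[OF c] c by (auto intro!: open_chart_image)
    have "smooth_on ?N' (\<lambda>z. frechet_derivative (\<lambda>z. snd c (chart_inv c' z)) (at z) (vf_rep M c' X z))"
      by (intro smooth_on_frechet o(2) smooth_on_subset[OF smooth_transition[OF W(1) c]] smooth_on_subset[OF W(4)]) auto
    moreover have "smooth_on ?N (\<lambda>p. snd c' (chart_inv c p))"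
      by (rule smooth_on_subset[OF smooth_transition[OF c W(1)]]) auto
    moreover have "(\<lambda>p. snd c' (chart_inv c p)) ` ?N \<subseteq> ?N'" using c by auto
    ultimately have "smooth_on ?N (\<lambda>p. frechet_derivative (\<lambda>z. snd c (chart_inv c' z)) (at (snd c' (chart_inv c p)))
        (vf_rep M c' X (snd c' (chart_inv c p))))"
      using smooth_on_compose[OF o(1)] by blast
    then have "smooth_on ?N (vf_rep M c X)"
    proof (rule smooth_on_cong[OF _ o(1)])
      fix p assume "p \<in> ?N"
      then obtain y where y: "p = snd c y" "y \<in> fst c" "y \<in> fst c'" by blast
      then show "frechet_derivative (\<lambda>z. snd c (chart_inv c' z)) (at (snd c' (chart_inv c p)))
        (vf_rep M c' X (snd c' (chart_inv c p))) = vf_rep M c X p"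
        using dird_vf[OF W(1) y(3) mdiff_chart[OF c y(2)], of X] c by (simp add: vf_rep_chart)
    qed
    then show "\<exists>N. open N \<and> p \<in> N \<and> smooth_on N (vf_rep M c X)"
      using o x W(3) by blast
  qed
qed

lemma smooth_vf_imp_smooth_vf_on:
  assumes "smooth_vf M X" shows "smooth_vf_on M W X"
  unfolding smooth_vf_on_iff
proof
  fix c assume "c \<in> atlas M"
  then have "smooth_on (snd c ` fst c) (vf_rep M c X)" using assms smooth_vf_iff by blast
  then show "smooth_on (snd c ` (fst c \<inter> W)) (vf_rep M c X)" by (rule smooth_on_subset) auto
qed

lemma smooth_vf_cong:
  assumes "smooth_vf M X" "\<And>x. x \<in> pts M \<Longrightarrow> X x = Y x" shows "smooth_vf M Y"
  unfolding smooth_vf_iff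
proof
  fix c assume c: "c \<in> atlas M"
  then have "smooth_on (snd c ` fst c) (vf_rep M c X)" using assms unfolding smooth_vf_iff by blast
  then show "smooth_on (snd c ` fst c) (vf_rep M c Y)"
    by (rule smooth_on_cong[OF _ chart_open_image[OF c]]) (use c assms(2) chart_in_pts[OF c] in \<open>auto simp: vf_rep_chart\<close>)
qed

lemma smooth_vf_add:
  assumes "smooth_vf M X" "smooth_vf M Y" shows "smooth_vf M (\<lambda>x. X x + Y x)"
  unfolding smooth_vf_iff
proof
  fix c assume c: "c \<in> atlas M"
  then have "smooth_on (snd c ` fst c) (\<lambda>p. vf_rep M c X p + vf_rep M c Y p)"
    using assms unfolding smooth_vf_iff by (intro smooth_on_add chart_open_image) auto
  then show "smooth_on (snd c ` fst c) (vf_rep M c (\<lambda>x. X x + Y x))"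
    by (rule smooth_on_cong[OF _ chart_open_image[OF c]])
      (use c in \<open>auto simp: vf_rep_chart linear_add[OF linear_dird_chart]\<close>)
qed

lemma smooth_vf_scaleR:
  assumes "smooth_fun M f" "smooth_vf M X" shows "smooth_vf M (\<lambda>x. f x *\<^sub>R X x)"
  unfolding smooth_vf_iff
proof
  fix c assume c: "c \<in> atlas M"
  then have "smooth_on (snd c ` fst c) (\<lambda>p. f (chart_inv c p) *\<^sub>R vf_rep M c X p)"
    using assms unfolding smooth_vf_iff smooth_fun_iff by (intro smooth_on_scaleR chart_open_image) auto
  then show "smooth_on (snd c ` fst c) (vf_rep M c (\<lambda>x. f x *\<^sub>R X x))"
    by (rule smooth_on_cong[OF _ chart_open_image[OF c]])
      (use c in \<open>auto simp: vf_rep_chart linear_scale[OF linear_dird_chart]\<close>)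
qed

lemma smooth_fun_const: "smooth_fun M (\<lambda>x. a)"
  by (simp add: smooth_fun_iff smooth_on_const)

lemma smooth_vf_0: "smooth_vf M (\<lambda>x. 0)"
  unfolding smooth_vf_iff
proof
  fix c assume c: "c \<in> atlas M"
  show "smooth_on (snd c ` fst c) (vf_rep M c (\<lambda>x. 0))"
    by (rule smooth_on_cong[OF smooth_on_const chart_open_image[OF c]])
      (use c in \<open>auto simp: vf_rep_chart linear_0[OF linear_dird_chart]\<close>)
qed

text \<open>The commutator formula for second derivatives, read in the preferred chart of \<open>x\<close>, where tangent
  vectors at \<open>x\<close> are their own coordinate vectors. It serves twice: for the embedding into \<open>\<E>\<close>,
  and for a submersion written in a chart of its target.\<close>

lemma dird_commutator:
  fixes F :: "'m \<Rightarrow> 'e::euclidean_space"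
  assumes F: "smooth_fun_on W F" and W: "openin (mtop M) W" "x \<in> W"
    and XY: "smooth_vf M X" "smooth_vf M Y"
  shows "dird M (\<lambda>y. dird M F y (Y y)) x (X x) - dird M (\<lambda>y. dird M F y (X y)) x (Y x) =
    dird M F x (lie_bracket M X Y x)"
proof -
  have x: "x \<in> pts M" using W openin_subset_pts by blast
  define c where "c = chart_at M x"
  have c: "c \<in> atlas M" "x \<in> fst c" using chart_at[OF x] by (auto simp: c_def)
  let ?S = "snd c ` (fst c \<inter> W)" and ?p = "snd c x" and ?F = "\<lambda>p. F (chart_inv c p)"
  have S: "open ?S" "?p \<in> ?S" using open_chart_image[OF c(1) W(1)] c W(2) by auto
  have sm: "smooth_on ?S ?F" "smooth_on ?S (vf_rep M c X)" "smooth_on ?S (vf_rep M c Y)"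
    using F XY c unfolding smooth_fun_on_def smooth_vf_iff by (auto intro: smooth_on_subset)
  have at: "vf_rep M c Z ?p = Z x" for Z
    using c dird_chart_at[OF x] by (simp add: vf_rep_chart) (simp add: c_def)
  have D: "dird M (\<lambda>y. dird M F y (Z y)) x \<xi> =
      frechet_derivative (\<lambda>p. frechet_derivative ?F (at p) (vf_rep M c Z p)) (at ?p) \<xi>" for Z \<xi>
  proof -
    have "dird M (\<lambda>y. dird M F y (Z y)) x \<xi> = frechet_derivative (\<lambda>p. dird M F (chart_inv c p) (Z (chart_inv c p))) (at ?p) \<xi>"
      unfolding dird_def'[of "\<lambda>y. dird M F y (Z y)"] c_def ..
    also have "\<dots> = frechet_derivative (\<lambda>p. frechet_derivative ?F (at p) (vf_rep M c Z p)) (at ?p) \<xi>"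
    proof (rule fun_cong[OF frechet_derivative_cong_open[OF S]])
      fix p assume "p \<in> ?S"
      then obtain y where y: "y \<in> fst c" "p = snd c y" "y \<in> W" by blast
      from dird_vf[OF c(1) y(1) mdiff_smooth_fun_on[OF F W(1) y(3)]] y c show "dird M F (chart_inv c p) (Z (chart_inv c p)) =
        frechet_derivative ?F (at p) (vf_rep M c Z p)" by simp
    qed
    finally show ?thesis .
  qed
  have "dird M F x (lie_bracket M X Y x) = frechet_derivative ?F (at ?p) (lie_bracket M X Y x)"
    unfolding dird_def' c_def ..
  then show ?thesis
    unfolding D lie_bracket_def Let_def c_def[symmetric]
    using frechet_derivative_commutator[OF S(1) sm(1) S(2) sm(2,3), unfolded at] by simp
qed

end

section \<open>Bump functions and tensoriality\<close>

text \<open>For \<open>n = 0\<close> this is the usual smooth function that vanishes for \<open>t \<le> 0\<close>; the other \<open>n\<close> make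
  the family closed under differentiation, up to linear combinations.\<close>

definition flat_exp :: "nat \<Rightarrow> real \<Rightarrow> real" where
  "flat_exp n t = (if t > 0 then exp (- (1 / t)) / t ^ n else 0)"

lemma flat_exp_tendsto_0: "(flat_exp n \<longlongrightarrow> 0) (at 0)"
proof (subst filterlim_at_split, rule conjI)
  have "eventually (\<lambda>t. flat_exp n t = 0) (at_left 0)"
    by (auto simp: flat_exp_def eventually_at_filter)
  then show "(flat_exp n \<longlongrightarrow> 0) (at_left 0)" by (rule tendsto_eventually)
  have "((\<lambda>t. inverse t ^ n / exp (inverse t)) \<longlongrightarrow> (0::real)) (at_right 0)"
    by (rule filterlim_compose[OF tendsto_power_div_exp_0 filterlim_inverse_at_top_right])
  then show "(flat_exp n \<longlongrightarrow> 0) (at_right 0)"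
    by (rule Lim_transform_eventually)
      (auto simp: flat_exp_def eventually_at_filter exp_minus field_simps)
qed

lemma flat_exp_derivative:
  "(flat_exp n has_real_derivative (flat_exp (Suc (Suc n)) t - real n * flat_exp (Suc n) t)) (at t)"
proof (cases t "0::real" rule: linorder_cases)
  case less
  have "((\<lambda>t. 0) has_real_derivative 0) (at t)" by simp
  then have "(flat_exp n has_real_derivative 0) (at t)"
    by (rule has_field_derivative_transform_within_open[of _ _ _ "{..<0}"]) (use less in \<open>auto simp: flat_exp_def\<close>)
  then show ?thesis using less by (simp add: flat_exp_def)
next
  case equal
  have "((\<lambda>h. (flat_exp n (0 + h) - flat_exp n 0) / h) \<longlongrightarrow> 0) (at 0)"
    by (rule Lim_transform_eventually[OF flat_exp_tendsto_0[of "Suc n"]])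
      (auto simp: flat_exp_def eventually_at_filter field_simps)
  then show ?thesis unfolding DERIV_def equal by (simp add: flat_exp_def)
next
  case greater
  have "((\<lambda>t. exp (- (1 / t)) / t ^ n) has_real_derivative
      (flat_exp (Suc (Suc n)) t - real n * flat_exp (Suc n) t)) (at t)"
  proof (cases n)
    case 0
    then show ?thesis using greater
      by (auto intro!: derivative_eq_intros simp: flat_exp_def field_simps power2_eq_square)
  next
    case (Suc m)
    then show ?thesis using greater
      by (auto intro!: derivative_eq_intros simp: flat_exp_def field_simps power2_eq_square) (cases m; simp)
  qed
  then show ?thesis
    by (rule has_field_derivative_transform_within_open[of _ _ _ "{0<..}"]) (use greater in \<open>auto simp: flat_exp_def\<close>)
qed

lemma smooth_on_flat_exp: "smooth_on UNIV (flat_exp n)"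
  unfolding smooth_on_def
proof
  fix k show "Ck_on k UNIV (flat_exp n)"
  proof (induction k arbitrary: n)
    case 0
    show ?case using flat_exp_derivative[THEN DERIV_isCont] by (simp add: continuous_on_eq_continuous_at)
  next
    case (Suc k)
    have d: "(flat_exp n has_derivative (\<lambda>h. (flat_exp (Suc (Suc n)) t + (- real n) * flat_exp (Suc n) t) * h)) (at t)" for t
      using flat_exp_derivative[of n t] by (simp add: has_field_derivative_def)
    have "Ck_on k UNIV (\<lambda>t. (flat_exp (Suc (Suc n)) t + (- real n) * flat_exp (Suc n) t) * h)" for h
      by (intro Ck_on_bilinear[OF open_UNIV bounded_bilinear_mult] Ck_on_add[OF open_UNIV] Ck_on_const Suc.IH)
    then show ?case using differentiableI[OF d] frechet_derivative_eqI[OF d] by simp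
  qed
qed

lemma smooth_bump:
  fixes p :: "'a::real_inner"
  assumes "r > 0"
  obtains \<beta> :: "'a \<Rightarrow> real" where "smooth_on UNIV \<beta>" "\<beta> p \<noteq> 0" "\<And>q. q \<notin> cball p r \<Longrightarrow> \<beta> q = 0"
proof
  define f where "f = (\<lambda>q. flat_exp 0 (r^2 - (q - p) \<bullet> (q - p)))"
  show "smooth_on UNIV f" unfolding f_def
    by (rule smooth_on_compose[OF open_UNIV _ smooth_on_flat_exp])
      (intro smooth_on_diff smooth_on_inner smooth_on_const smooth_on_ident open_UNIV, simp)
  show "f p \<noteq> 0" using assms by (simp add: f_def flat_exp_def)
  show "f q = 0" if "q \<notin> cball p r" for q
  proof -
    have "r < norm (q - p)" using that by (simp add: dist_norm norm_minus_commute)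
    then have "r^2 < (norm (q - p))^2" using assms by (intro power_strict_mono) auto
    then show ?thesis by (simp add: f_def flat_exp_def power2_norm_eq_inner)
  qed
qed

context smooth_mfd
begin

text \<open>The closed set \<open>K\<close> is compact in the chart domain, hence closed in \<open>M\<close> by the Hausdorff
  property; this is what makes extension by zero smooth.\<close>

lemma chart_bump:
  assumes c: "c \<in> atlas M" and x: "x \<in> fst c"
  obtains \<beta> :: "'n \<Rightarrow> real" and K where "smooth_on UNIV \<beta>" "\<beta> (snd c x) \<noteq> 0"
    "closedin (mtop M) K" "K \<subseteq> fst c" "\<And>y. y \<in> fst c - K \<Longrightarrow> \<beta> (snd c y) = 0"
proof -
  obtain r where r: "r > 0" "cball (snd c x) r \<subseteq> snd c ` fst c"
    using open_contains_cball chart_open_image[OF c] x by blast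
  obtain \<beta> :: "'n \<Rightarrow> real" where b: "smooth_on UNIV \<beta>" "\<beta> (snd c x) \<noteq> 0"
    "\<And>q. q \<notin> cball (snd c x) r \<Longrightarrow> \<beta> q = 0" using smooth_bump[OF r(1)] by blast
  define K where "K = {y \<in> fst c. snd c y \<in> cball (snd c x) r}"
  have K: "snd c ` K = cball (snd c x) r" "K \<subseteq> fst c" using r by (auto simp: K_def)
  have "compactin (top_of_set (snd c ` fst c)) (snd c ` K)"
    unfolding K using r(2) by (simp add: compactin_subtopology)
  then have "compactin (subtopology (mtop M) (fst c)) K"
    using homeomorphic_map_compactness[OF chart_homeomorphic[OF c]] K(2) topspace_chart[OF c] by blast
  then have "compactin (mtop M) K" by (simp add: compactin_subtopology)
  then have "closedin (mtop M) K"
    using smooth_manifold compactin_imp_closedin unfolding smooth_manifold_def by blast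
  with b K(2) show ?thesis by (intro that[of \<beta> K]) (auto simp: K_def)
qed

lemma smooth_fun_extend:
  fixes G :: "'n \<Rightarrow> real"
  assumes c: "c \<in> atlas M" and b: "smooth_on UNIV (\<beta> :: 'n \<Rightarrow> real)"
    and K: "closedin (mtop M) K" "\<And>y. y \<in> fst c - K \<Longrightarrow> \<beta> (snd c y) = 0"
    and K': "K \<subseteq> fst c"
    and G: "smooth_on (snd c ` fst c) G"
  shows "smooth_fun M (\<lambda>y. if y \<in> fst c then \<beta> (snd c y) * G (snd c y) else 0)"
proof (rule smooth_funI)
  fix x assume x: "x \<in> pts M"
  let ?f = "\<lambda>y. if y \<in> fst c then \<beta> (snd c y) * G (snd c y) else 0"
  show "\<exists>c'\<in>atlas M. \<exists>W. openin (mtop M) W \<and> x \<in> fst c' \<inter> W \<and>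
      smooth_on (snd c' ` (fst c' \<inter> W)) (\<lambda>p. ?f (chart_inv c' p))"
  proof (cases "x \<in> fst c")
    case True
    have "smooth_on (snd c ` (fst c \<inter> fst c)) (\<lambda>p. ?f (chart_inv c p))"
    proof (rule smooth_on_cong)
      show "smooth_on (snd c ` (fst c \<inter> fst c)) (\<lambda>p. \<beta> p * G p)"
        using G chart_open_image[OF c] by (intro smooth_on_mult smooth_on_subset[OF b]) auto
      show "open (snd c ` (fst c \<inter> fst c))" using chart_open_image[OF c] by simp
    qed (use c in auto)
    then show ?thesis using c True chart_openin[OF c] by blast
  next
    case False
    let ?W = "pts M - K" and ?c = "chart_at M x"
    have W: "openin (mtop M) ?W" using K(1) by (simp add: closedin_def pts_def)
    have c': "?c \<in> atlas M" "x \<in> fst ?c" using chart_at[OF x] by auto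
    have "smooth_on (snd ?c ` (fst ?c \<inter> ?W)) (\<lambda>p. ?f (chart_inv ?c p))"
      by (rule smooth_on_cong[OF smooth_on_const[of _ 0] open_chart_image[OF c'(1) W]])
        (use K c' in auto)
    then show ?thesis using c' W False K' x by blast
  qed
qed

lemma smooth_vf_extend:
  assumes c: "c \<in> atlas M" and b: "smooth_on UNIV (\<beta> :: 'n \<Rightarrow> real)"
    and K: "closedin (mtop M) K" "\<And>y. y \<in> fst c - K \<Longrightarrow> \<beta> (snd c y) = 0"
    and K': "K \<subseteq> fst c"
  shows "smooth_vf M (\<lambda>y. if y \<in> fst c then \<beta> (snd c y) *\<^sub>R coord_vec M c a y else 0)"
proof (rule smooth_vfI)
  fix x assume x: "x \<in> pts M"
  let ?X = "\<lambda>y. if y \<in> fst c then \<beta> (snd c y) *\<^sub>R coord_vec M c a y else 0"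
  show "\<exists>c'\<in>atlas M. \<exists>W. openin (mtop M) W \<and> x \<in> fst c' \<inter> W \<and>
      smooth_on (snd c' ` (fst c' \<inter> W)) (vf_rep M c' ?X)"
  proof (cases "x \<in> fst c")
    case True
    have "smooth_on (snd c ` (fst c \<inter> fst c)) (vf_rep M c ?X)"
    proof (rule smooth_on_cong)
      show "smooth_on (snd c ` (fst c \<inter> fst c)) (\<lambda>p. \<beta> p *\<^sub>R a)"
        using chart_open_image[OF c] by (intro smooth_on_scaleR smooth_on_subset[OF b] smooth_on_const) auto
      show "open (snd c ` (fst c \<inter> fst c))" using chart_open_image[OF c] by simp
    qed (use c in \<open>auto simp: vf_rep_chart linear_scale[OF linear_dird_chart] dird_chart_coord_vec\<close>)
    then show ?thesis using c True chart_openin[OF c] by blast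
  next
    case False
    let ?W = "pts M - K" and ?c = "chart_at M x"
    have W: "openin (mtop M) ?W" using K(1) by (simp add: closedin_def pts_def)
    have c': "?c \<in> atlas M" "x \<in> fst ?c" using chart_at[OF x] by auto
    have "smooth_on (snd ?c ` (fst ?c \<inter> ?W)) (vf_rep M ?c ?X)"
      by (rule smooth_on_cong[OF smooth_on_const[of _ 0] open_chart_image[OF c'(1) W]])
        (use K c' in \<open>auto simp: vf_rep_chart linear_0[OF linear_dird_chart]\<close>)
    then show ?thesis using c' W False K' x by blast
  qed
qed

text \<open>Multiply a field with constant coordinates by a bump function. The coordinates are divided by
  the value of the bump function at \<open>x\<close>, which need not be one.\<close>

lemma tangent_vector_extends:
  assumes x: "x \<in> pts M" obtains X where "smooth_vf M X" "X x = \<xi>"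
proof -
  let ?c = "chart_at M x"
  have c: "?c \<in> atlas M" "x \<in> fst ?c" using chart_at[OF x] by auto
  obtain \<beta> :: "'n \<Rightarrow> real" and K where b: "smooth_on UNIV \<beta>" "\<beta> (snd ?c x) \<noteq> 0"
    "closedin (mtop M) K" "K \<subseteq> fst ?c" "\<And>y. y \<in> fst ?c - K \<Longrightarrow> \<beta> (snd ?c y) = 0"
    using chart_bump[OF c] by blast
  let ?a = "dird M (snd ?c) x ((1 / \<beta> (snd ?c x)) *\<^sub>R \<xi>)"
  show ?thesis
    by (rule that[OF smooth_vf_extend[OF c(1) b(1,3,5,4), of ?a]]) (use c b in \<open>auto simp: coord_vec_dird_chart\<close>)
qed

text \<open>If \<open>\<beta>\<close> is a bump function in a chart with coordinate fields \<open>E\<^sub>i\<close>, then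
  \<open>\<beta>\<^sup>2 Z = \<Sum>\<^sub>i (\<beta> Z\<^sup>i) (\<beta> E\<^sub>i)\<close> with globally defined smooth \<open>\<beta> Z\<^sup>i\<close> and \<open>\<beta> E\<^sub>i\<close>. Linearity over smooth
  functions pulls out the values \<open>\<beta> Z\<^sup>i\<close> at \<open>x\<close>, which are zero.\<close>

lemma tensorial_vanishes:
  fixes T :: "('m \<Rightarrow> 'n) \<Rightarrow> 'v::real_vector"
  assumes x: "x \<in> pts M"
    and add: "\<And>Y Z. smooth_vf M Y \<Longrightarrow> smooth_vf M Z \<Longrightarrow> T (\<lambda>y. Y y + Z y) = T Y + T Z"
    and scale: "\<And>f Y. smooth_fun M (f :: 'm \<Rightarrow> real) \<Longrightarrow> smooth_vf M Y \<Longrightarrow> T (\<lambda>y. f y *\<^sub>R Y y) = f x *\<^sub>R T Y"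
    and Z: "smooth_vf M Z" "Z x = 0"
  shows "T Z = 0"
proof -
  define c where "c = chart_at M x"
  have c: "c \<in> atlas M" "x \<in> fst c" using chart_at[OF x] by (auto simp: c_def)
  obtain \<beta> :: "'n \<Rightarrow> real" and K where b: "smooth_on UNIV \<beta>" "\<beta> (snd c x) \<noteq> 0"
    "closedin (mtop M) K" "K \<subseteq> fst c" "\<And>y. y \<in> fst c - K \<Longrightarrow> \<beta> (snd c y) = 0"
    using chart_bump[OF c] by blast
  define f where "f = (\<lambda>y. if y \<in> fst c then \<beta> (snd c y) * 1 else 0)"
  define E where "E = (\<lambda>i y. if y \<in> fst c then \<beta> (snd c y) *\<^sub>R coord_vec M c i y else 0)"
  define g where "g = (\<lambda>i y. if y \<in> fst c then \<beta> (snd c y) * (vf_rep M c Z (snd c y) \<bullet> i) else 0)"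
  have f: "smooth_fun M f" unfolding f_def
    by (rule smooth_fun_extend[OF c(1) b(1,3,5,4)]) (simp_all add: smooth_on_const)
  have E: "smooth_vf M (E i)" for i unfolding E_def
    by (rule smooth_vf_extend[OF c(1) b(1,3,5,4)])
  have g: "smooth_fun M (g i)" for i unfolding g_def
    by (rule smooth_fun_extend[OF c(1) b(1,3,5,4)])
      (use Z c in \<open>auto intro!: smooth_on_inner chart_open_image smooth_on_const simp: smooth_vf_iff\<close>)
  have eq: "(\<lambda>y. f y *\<^sub>R (f y *\<^sub>R Z y)) = (\<lambda>y. \<Sum>i\<in>Basis. g i y *\<^sub>R E i y)"
  proof
    fix y show "f y *\<^sub>R (f y *\<^sub>R Z y) = (\<Sum>i\<in>Basis. g i y *\<^sub>R E i y)"
    proof (cases "y \<in> fst c")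
      case True
      have "Z y = (\<Sum>i\<in>Basis. (vf_rep M c Z (snd c y) \<bullet> i) *\<^sub>R coord_vec M c i y)"
        using linear_euclidean_expansion[OF coord_vec_linear[OF c(1) True], of "vf_rep M c Z (snd c y)"]
          coord_vec_vf_rep[OF c(1) True, of Z] by simp
      then show ?thesis using True
        by (simp add: f_def g_def E_def scaleR_sum_right mult_ac)
    qed (simp add: f_def g_def)
  qed
  have sum: "smooth_vf M (\<lambda>y. \<Sum>i\<in>B. g i y *\<^sub>R E i y) \<and> T (\<lambda>y. \<Sum>i\<in>B. g i y *\<^sub>R E i y) = (\<Sum>i\<in>B. g i x *\<^sub>R T (E i))"
    if "finite B" for B
    using that
  proof (induction B)
    case empty
    have "T (\<lambda>y. 0) = 0" using scale[OF smooth_fun_const[of 0] smooth_vf_0] by simp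
    then show ?case using smooth_vf_0 by simp
  next
    case (insert i B)
    have gE: "smooth_vf M (\<lambda>y. g i y *\<^sub>R E i y)" by (rule smooth_vf_scaleR[OF g E])
    show ?case
      using insert add[OF gE conjunct1[OF insert.IH]] smooth_vf_add[OF gE conjunct1[OF insert.IH]] scale[OF g E]
      by simp
  qed
  have gx: "g i x = 0" for i
    using c Z(2) by (simp add: g_def vf_rep_chart linear_0[OF linear_dird_chart])
  have "f x *\<^sub>R (f x *\<^sub>R T Z) = T (\<lambda>y. f y *\<^sub>R (f y *\<^sub>R Z y))"
    using scale[OF f smooth_vf_scaleR[OF f Z(1)]] scale[OF f Z(1)] by simp
  also have "\<dots> = 0" unfolding eq using sum[OF finite_Basis] gx by simp
  finally show ?thesis using b(2) c by (simp add: f_def)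
qed

lemma tensorial_pointwise:
  fixes T :: "('m \<Rightarrow> 'n) \<Rightarrow> 'v::real_vector"
  assumes x: "x \<in> pts M"
    and add: "\<And>Y Z. smooth_vf M Y \<Longrightarrow> smooth_vf M Z \<Longrightarrow> T (\<lambda>y. Y y + Z y) = T Y + T Z"
    and scale: "\<And>f Y. smooth_fun M (f :: 'm \<Rightarrow> real) \<Longrightarrow> smooth_vf M Y \<Longrightarrow> T (\<lambda>y. f y *\<^sub>R Y y) = f x *\<^sub>R T Y"
    and YZ: "smooth_vf M Y" "smooth_vf M Z" "Y x = Z x"
  shows "T Y = T Z"
proof -
  have n: "smooth_vf M (\<lambda>y. (-1) *\<^sub>R Z y)" by (rule smooth_vf_scaleR[OF smooth_fun_const YZ(2)])
  have "T (\<lambda>y. Y y + (-1) *\<^sub>R Z y) = 0"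
    by (rule tensorial_vanishes[where T = T, OF x add scale smooth_vf_add[OF YZ(1) n]]) (use YZ in auto)
  then show ?thesis using add[OF YZ(1) n] scale[OF smooth_fun_const[of "-1"] YZ(2)] by simp
qed

text \<open>Vector fields are functions on the whole type, and a connection is an operator on such
  functions. Its values on \<open>M\<close> do not depend on the values of the field off \<open>M\<close>: the
  characteristic function of the complement of \<open>M\<close> is smooth, and multiplication with it fixes a
  field that vanishes on \<open>M\<close>.\<close>

lemma connection_cong:
  assumes conn: "affine_connection M conn" and X: "smooth_vf M X" and Y: "smooth_vf M Y" "smooth_vf M Y'"
    and eq: "\<And>y. y \<in> pts M \<Longrightarrow> Y y = Y' y" and x: "x \<in> pts M"
  shows "conn X Y x = conn X Y' x"
proof -
  define f :: "'m \<Rightarrow> real" where "f = (\<lambda>y. if y \<in> pts M then 0 else 1)"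
  define Z where "Z = (\<lambda>y. Y' y + (-1) *\<^sub>R Y y)"
  have f: "smooth_fun M f" unfolding smooth_fun_iff
  proof
    fix c assume c: "c \<in> atlas M"
    show "smooth_on (snd c ` fst c) (\<lambda>p. f (chart_inv c p))"
      by (rule smooth_on_cong[OF smooth_on_const[of _ 0] chart_open_image[OF c]])
        (use c chart_in_pts[OF c] in \<open>auto simp: f_def\<close>)
  qed
  have Z: "smooth_vf M Z" unfolding Z_def by (intro smooth_vf_add smooth_vf_scaleR smooth_fun_const Y)
  have "Z = (\<lambda>y. f y *\<^sub>R Z y)" using eq by (auto simp: f_def Z_def)
  moreover have "conn X (\<lambda>y. f y *\<^sub>R Z y) x = f x *\<^sub>R conn X Z x + dird M f x (X x) *\<^sub>R Z x"
    using conn f X Z x unfolding affine_connection_def by blast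
  moreover have "f x = 0" "Z x = 0" using x eq by (auto simp: f_def Z_def)
  ultimately have 0: "conn X Z x = 0" by simp
  have "conn X (\<lambda>y. Y y + Z y) x = conn X Y x + conn X Z x"
    using conn X Y Z x unfolding affine_connection_def by blast
  then show ?thesis using 0 by (simp add: Z_def)
qed

end

section \<open>Projections onto subbundles\<close>

lemma inner_form_pullback:
  assumes b: "inner_form b" and L: "linear L" "inj L"
  shows "inner_form (\<lambda>u v. b (L u) (L v))"
  unfolding inner_form_def bilinear_def
proof (intro conjI allI impI)
  fix u
  show "linear (\<lambda>v. b (L u) (L v))" "linear (\<lambda>v. b (L v) (L u))"
    by (rule linearI; simp add: linear_add[OF L(1)] linear_scale[OF L(1)] inner_form_simps[OF b])+
  show "b (L u) (L v) = b (L v) (L u)" for v by (rule inner_form_commute[OF b])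
  assume "u \<noteq> 0"
  then have "L u \<noteq> 0" using L by (metis injD linear_0)
  then show "0 < b (L u) (L u)" using b unfolding inner_form_def by blast
qed

context smooth_mfd
begin

lemma subbundle_frame:
  assumes "subbundle M F" "x \<in> pts M"
  obtains W k and e :: "nat \<Rightarrow> 'm \<Rightarrow> 'n" where "openin (mtop M) W" "x \<in> W"
    "\<And>i. i < k \<Longrightarrow> smooth_vf_on M W (e i)" "\<And>y. y \<in> W \<Longrightarrow> inj_on (\<lambda>i. e i y) {..<k}"
    "\<And>y. y \<in> W \<Longrightarrow> independent ((\<lambda>i. e i y) ` {..<k})"
    "\<And>y. y \<in> W \<Longrightarrow> F y = span ((\<lambda>i. e i y) ` {..<k})"
  using assms unfolding subbundle_def by metis

lemma subbundle_subspace: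
  assumes "subbundle M F" "x \<in> pts M" shows "subspace (F x)"
  using subbundle_frame[OF assms] by (metis subspace_span)

lemma frame_linear_image:
  fixes L :: "'n \<Rightarrow> 'w::real_vector" and e :: "nat \<Rightarrow> 'n"
  assumes L: "linear L" "inj L" and e: "inj_on e {..<k}" "independent (e ` {..<k})"
  shows "inj_on (\<lambda>i. L (e i)) {..<k}" "independent ((\<lambda>i. L (e i)) ` {..<k})"
    "L ` span (e ` {..<k}) = span ((\<lambda>i. L (e i)) ` {..<k})"
proof -
  show "inj_on (\<lambda>i. L (e i)) {..<k}" using e(1) L(2) by (auto simp: inj_on_def)
  have *: "(\<lambda>i. L (e i)) ` {..<k} = L ` (e ` {..<k})" by (simp add: image_image)
  show "independent ((\<lambda>i. L (e i)) ` {..<k})"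
    unfolding * using linear_independent_injective_image[OF L(1) e(2)] inj_on_subset[OF L(2)] by blast
  show "L ` span (e ` {..<k}) = span ((\<lambda>i. L (e i)) ` {..<k})"
    unfolding * by (rule linear_span_image[OF L(1), symmetric])
qed

lemma smooth_coord_vec:
  assumes c: "c \<in> atlas M" shows "smooth_vf_on M (fst c) (coord_vec M c a)"
  unfolding smooth_vf_on_iff
proof
  fix c' assume c': "c' \<in> atlas M"
  let ?N = "snd c' ` (fst c' \<inter> fst c)"
  have o: "open ?N" by (rule open_chart_image[OF c' chart_openin[OF c]])
  have "smooth_on (snd c ` (fst c \<inter> fst c')) (\<lambda>z. frechet_derivative (\<lambda>p. snd c' (chart_inv c p)) (at z) a)"
    by (rule smooth_on_frechet_const[OF smooth_transition[OF c c']])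
  then have "smooth_on ?N (\<lambda>p. frechet_derivative (\<lambda>p. snd c' (chart_inv c p)) (at (snd c (chart_inv c' p))) a)"
    by (rule smooth_on_compose[OF o smooth_transition[OF c' c]]) (use c' in auto)
  then show "smooth_on ?N (vf_rep M c' (coord_vec M c a))"
  proof (rule smooth_on_cong[OF _ o])
    fix p assume "p \<in> ?N"
    then obtain y where y: "p = snd c' y" "y \<in> fst c'" "y \<in> fst c" by blast
    show "frechet_derivative (\<lambda>p. snd c' (chart_inv c p)) (at (snd c (chart_inv c' p))) a = vf_rep M c' (coord_vec M c a) p"
      using dird_chart[OF c y(3) mdiff_chart[OF c' y(2)], of "coord_vec M c a y"] y c c'
      by (simp add: vf_rep_chart dird_chart_coord_vec)
  qed
qed

text \<open>The coordinate fields of a chart are a local frame. This makes the projection \<open>\<Pi>\<close> onto the whole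
  tangent bundle a special case of the projections onto subbundles.\<close>

lemma subbundle_UNIV: "subbundle M (\<lambda>_. UNIV)"
  unfolding subbundle_def
proof
  fix x assume x: "x \<in> pts M"
  let ?c = "chart_at M x"
  have c: "?c \<in> atlas M" "x \<in> fst ?c" using chart_at[OF x] by auto
  obtain b where b: "bij_betw b {0..<DIM('n)} (Basis :: 'n set)"
    using ex_bij_betw_nat_finite[OF finite_Basis] by blast
  then have b': "inj_on b {..<DIM('n)}" "b ` {..<DIM('n)} = Basis" by (auto simp: bij_betw_def atLeast0LessThan)
  let ?e = "\<lambda>i. coord_vec M ?c (b i)"
  have "inj_on (\<lambda>i. ?e i y) {..<DIM('n)} \<and> independent ((\<lambda>i. ?e i y) ` {..<DIM('n)}) \<and>
        UNIV = span ((\<lambda>i. ?e i y) ` {..<DIM('n)})" if y: "y \<in> fst ?c" for y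
  proof -
    have L: "linear (\<lambda>a. coord_vec M ?c a y)" "inj (\<lambda>a. coord_vec M ?c a y)" "surj (\<lambda>a. coord_vec M ?c a y)"
      using coord_vec_linear[OF c(1) y]
        inj_on_inverseI[of UNIV "dird M (snd ?c) y", OF dird_chart_coord_vec[OF c(1) y]]
        surjI[of "\<lambda>a. coord_vec M ?c a y", OF coord_vec_dird_chart[OF c(1) y]] by blast+
    show ?thesis
      using frame_linear_image[OF L(1,2) b'(1)] b'(2) L(3) independent_Basis[where 'a = 'n] by simp
  qed
  then show "\<exists>W k (e :: nat \<Rightarrow> 'm \<Rightarrow> 'n).
     openin (mtop M) W \<and> x \<in> W \<and> (\<forall>i<k. smooth_vf_on M W (e i)) \<and>
     (\<forall>y\<in>W. inj_on (\<lambda>i. e i y) {..<k} \<and> independent ((\<lambda>i. e i y) ` {..<k}) \<and>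
        UNIV = span ((\<lambda>i. e i y) ` {..<k}))"
    using c chart_openin[OF c(1)] smooth_coord_vec[OF c(1)]
    by (intro exI[of _ "fst ?c"] exI[of _ "DIM('n)"] exI[of _ ?e]) blast
qed

end

locale riem_mfd = smooth_mfd M for M :: "('m, 'n::euclidean_space) manifold" +
  fixes R :: "'m \<Rightarrow> 'n \<Rightarrow> 'n \<Rightarrow> real"
  assumes riemannian: "riemannian_manifold M R"
begin

lemma inner_form_R: "x \<in> pts M \<Longrightarrow> inner_form (R x)"
  using riemannian unfolding riemannian_manifold_def inner_form_def by blast

definition metric_chart :: "('m, 'n) chart \<Rightarrow> 'n \<Rightarrow> 'n \<Rightarrow> 'n \<Rightarrow> real" where
  "metric_chart c p a b =
     R (chart_inv c p) (coord_vec M c a (chart_inv c p)) (coord_vec M c b (chart_inv c p))"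

lemma smooth_metric_chart:
  "c \<in> atlas M \<Longrightarrow> smooth_on (snd c ` fst c) (\<lambda>p. metric_chart c p a b)"
  using riemannian unfolding riemannian_manifold_def metric_chart_def by (fastforce simp: o_def)

lemma inner_form_metric_chart:
  assumes c: "c \<in> atlas M" and p: "p \<in> snd c ` fst c" shows "inner_form (metric_chart c p)"
proof -
  obtain y where y: "y \<in> fst c" "p = snd c y" using p by blast
  have "inj (\<lambda>a. coord_vec M c a y)" using dird_chart_coord_vec[OF c y(1)] by (metis injI)
  then show ?thesis
    using inner_form_pullback[OF inner_form_R coord_vec_linear[OF c y(1)]] y chart_in_pts[OF c] c
    unfolding metric_chart_def by (auto simp: subset_iff)
qed

lemma metric_chart:
  "c \<in> atlas M \<Longrightarrow> y \<in> fst c \<Longrightarrow> metric_chart c (snd c y) (dird M (snd c) y u) (dird M (snd c) y v) = R y u v"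
  by (simp add: metric_chart_def coord_vec_dird_chart)

text \<open>In a chart the projection is the projection, for the metric in coordinates, onto the span of a
  smooth frame.\<close>

lemma smooth_vf_proj:
  assumes F: "subbundle M F" and X: "smooth_vf M X"
  shows "smooth_vf M (vf_proj R F X)"
proof (rule smooth_vfI)
  fix x assume x: "x \<in> pts M"
  obtain W k and e :: "nat \<Rightarrow> 'm \<Rightarrow> 'n" where W: "openin (mtop M) W" "x \<in> W"
    and e: "\<And>i. i < k \<Longrightarrow> smooth_vf_on M W (e i)" "\<And>y. y \<in> W \<Longrightarrow> inj_on (\<lambda>i. e i y) {..<k}"
    "\<And>y. y \<in> W \<Longrightarrow> independent ((\<lambda>i. e i y) ` {..<k})"
    "\<And>y. y \<in> W \<Longrightarrow> F y = span ((\<lambda>i. e i y) ` {..<k})"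
    using subbundle_frame[OF F x] by blast
  define c where "c = chart_at M x"
  have c: "c \<in> atlas M" "x \<in> fst c" using chart_at[OF x] by (auto simp: c_def)
  let ?N = "snd c ` (fst c \<inter> W)"
  have N: "open ?N" by (rule open_chart_image[OF c(1) W(1)])
  have L: "linear (dird M (snd c) y)" "inj (dird M (snd c) y)" if "y \<in> fst c" for y
    using linear_dird_chart[OF c(1) that] inj_dird_chart[OF c(1) that] by auto
  have "smooth_on ?N (\<lambda>p. orth_proj (metric_chart c p) (span ((\<lambda>i. vf_rep M c (e i) p) ` {..<k})) (vf_rep M c X p))"
  proof (rule smooth_on_orth_proj[OF N])
    show "smooth_on ?N (\<lambda>p. metric_chart c p a b)" for a b
      by (rule smooth_on_subset[OF smooth_metric_chart[OF c(1)]]) auto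
    show "inner_form (metric_chart c p)" if "p \<in> ?N" for p using inner_form_metric_chart[OF c(1)] that by auto
    show "smooth_on ?N (vf_rep M c (e i))" if "i < k" for i using e(1)[OF that] c(1) unfolding smooth_vf_on_iff by blast
    show "smooth_on ?N (vf_rep M c X)"
      by (rule smooth_on_subset[of "snd c ` fst c"]) (use X c(1) in \<open>auto simp: smooth_vf_iff\<close>)
    fix p assume "p \<in> ?N"
    then obtain y where y: "y \<in> fst c" "y \<in> W" "p = snd c y" by blast
    show "inj_on (\<lambda>i. vf_rep M c (e i) p) {..<k} \<and> independent ((\<lambda>i. vf_rep M c (e i) p) ` {..<k})"
      using frame_linear_image(1,2)[OF L[OF y(1)] e(2,3)[OF y(2)]] y c by (simp add: vf_rep_chart)
  qed
  then have "smooth_on ?N (vf_rep M c (vf_proj R F X))"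
  proof (rule smooth_on_cong[OF _ N])
    fix p assume "p \<in> ?N"
    then obtain y where y: "y \<in> fst c" "y \<in> W" "p = snd c y" by blast
    have yp: "y \<in> pts M" using y(1) chart_in_pts[OF c(1)] by blast
    have "vf_rep M c (vf_proj R F X) p = dird M (snd c) y (orth_proj (R y) (F y) (X y))"
      using y c by (simp add: vf_rep_chart vf_proj_def)
    also have "\<dots> = orth_proj (metric_chart c p) (dird M (snd c) y ` F y) (dird M (snd c) y (X y))"
      by (rule orth_proj_linear_image[OF inner_form_R[OF yp] subbundle_subspace[OF F yp]
          inner_form_metric_chart[OF c(1)] L(1)[OF y(1)], symmetric]) (use y c in \<open>auto simp: metric_chart\<close>)
    also have "dird M (snd c) y ` F y = span ((\<lambda>i. vf_rep M c (e i) p) ` {..<k})"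
      using frame_linear_image(3)[OF L[OF y(1)] e(2,3)[OF y(2)]] e(4)[OF y(2)] y c by (simp add: vf_rep_chart)
    finally show "orth_proj (metric_chart c p) (span ((\<lambda>i. vf_rep M c (e i) p) ` {..<k})) (vf_rep M c X p) =
      vf_rep M c (vf_proj R F X) p" using y c by (simp add: vf_rep_chart)
  qed
  then show "\<exists>c\<in>atlas M. \<exists>W. openin (mtop M) W \<and> x \<in> fst c \<inter> W \<and> smooth_on (snd c ` (fst c \<inter> W)) (vf_rep M c (vf_proj R F X))"
    using c W by blast
qed

end

subsection \<open>Ambient projections\<close>

locale ambient_mfd = riem_mfd M R for M :: "('m, 'n::euclidean_space) manifold" and R +
  fixes \<iota> :: "'m \<Rightarrow> 'e::euclidean_space" and g :: "'m \<Rightarrow> ('e, 'e) blinfun"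
  assumes ambient: "ambient_structure M R \<iota> g"
begin

abbreviation "d \<equiv> dird M \<iota>"

definition amb_form :: "'m \<Rightarrow> 'e \<Rightarrow> 'e \<Rightarrow> real" where
  "amb_form x v w = v \<bullet> blinfun_apply (g x) w"

lemma smooth_embedding: "smooth_fun M \<iota>"
  using ambient unfolding ambient_structure_def smooth_embedding_def by blast

lemma linear_d: "x \<in> pts M \<Longrightarrow> linear (d x)"
  by (intro linear_dird mdiff_smooth_fun smooth_embedding)

lemma inj_d: "x \<in> pts M \<Longrightarrow> inj (d x)"
  using ambient unfolding ambient_structure_def smooth_embedding_def by blast

lemma amb_form_d: "x \<in> pts M \<Longrightarrow> amb_form x (d x u) (d x v) = R x u v"
  using ambient unfolding ambient_structure_def amb_form_def by blast

lemma inner_form_amb: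
  assumes "x \<in> pts M" shows "inner_form (amb_form x)"
  unfolding inner_form_def bilinear_def
proof (intro conjI allI impI)
  have s: "v \<bullet> blinfun_apply (g x) w = blinfun_apply (g x) v \<bullet> w"
    and p: "v \<noteq> 0 \<Longrightarrow> v \<bullet> blinfun_apply (g x) v > 0" for v w
    using ambient assms unfolding ambient_structure_def by auto
  fix u
  show "linear (amb_form x u)" "linear (\<lambda>v. amb_form x v u)"
    by (rule linearI; simp add: amb_form_def blinfun.add_right blinfun.scaleR_right inner_simps)+
  show "amb_form x u v = amb_form x v u" for v
    unfolding amb_form_def by (metis s inner_commute)
  show "u \<noteq> 0 \<Longrightarrow> 0 < amb_form x u u" unfolding amb_form_def by (rule p)
qed

lemma subspace_image_d:
  "subbundle M F \<Longrightarrow> x \<in> pts M \<Longrightarrow> subspace (d x ` F x)"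
  by (intro linear_subspace_image linear_d subbundle_subspace)

lemma amb_proj_apply:
  assumes "subbundle M F" "x \<in> pts M"
  shows "blinfun_apply (amb_proj M \<iota> g F x) = orth_proj (amb_form x) (d x ` F x)"
  unfolding amb_proj_def amb_form_def[symmetric, abs_def]
  using linear_orth_proj[OF inner_form_amb subspace_image_d, OF assms(2) assms]
  by (simp add: bounded_linear_Blinfun_apply linear_conv_bounded_linear)

text \<open>On tangent vectors the ambient projection agrees with the projection inside \<open>TM\<close>, because the
  differential of the embedding is isometric for \<open>\<langle>\<cdot>, g \<cdot>\<rangle>\<close>.\<close>

lemma amb_proj_d:
  assumes "subbundle M F" "x \<in> pts M"
  shows "blinfun_apply (amb_proj M \<iota> g F x) (d x u) = d x (orth_proj (R x) (F x) u)"
  unfolding amb_proj_apply[OF assms]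
  by (rule orth_proj_linear_image[OF inner_form_R subbundle_subspace inner_form_amb linear_d amb_form_d])
    (use assms in auto)

lemma smooth_amb_proj:
  assumes F: "subbundle M F" shows "smooth_fun M (amb_proj M \<iota> g F)"
proof (rule smooth_funI)
  fix x assume x: "x \<in> pts M"
  obtain W k and e :: "nat \<Rightarrow> 'm \<Rightarrow> 'n" where W: "openin (mtop M) W" "x \<in> W"
    and e: "\<And>i. i < k \<Longrightarrow> smooth_vf_on M W (e i)" "\<And>y. y \<in> W \<Longrightarrow> inj_on (\<lambda>i. e i y) {..<k}"
    "\<And>y. y \<in> W \<Longrightarrow> independent ((\<lambda>i. e i y) ` {..<k})"
    "\<And>y. y \<in> W \<Longrightarrow> F y = span ((\<lambda>i. e i y) ` {..<k})"
    using subbundle_frame[OF F x] by blast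
  define c where "c = chart_at M x"
  have c: "c \<in> atlas M" "x \<in> fst c" using chart_at[OF x] by (auto simp: c_def)
  let ?N = "snd c ` (fst c \<inter> W)"
  have N: "open ?N" by (rule open_chart_image[OF c(1) W(1)])
  have y: "chart_inv c p \<in> pts M" "chart_inv c p \<in> W" if "p \<in> ?N" for p
    using that c openin_subset_pts[OF W(1)] by auto
  have im: "d y ` F y = span ((\<lambda>i. d y (e i y)) ` {..<k})" if "y \<in> pts M" "y \<in> W" for y
    using frame_linear_image(3)[OF linear_d inj_d e(2,3)] e(4) that by simp
  have g: "smooth_on ?N (\<lambda>p. g (chart_inv c p))"
    by (rule smooth_on_subset[of "snd c ` fst c"])
      (use ambient c in \<open>auto simp: ambient_structure_def smooth_fun_iff\<close>)
  have "smooth_on ?N (\<lambda>p. orth_proj (amb_form (chart_inv c p)) (span ((\<lambda>i. d (chart_inv c p) (e i (chart_inv c p))) ` {..<k})) v)" for v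
  proof (rule smooth_on_orth_proj[OF N])
    show "smooth_on ?N (\<lambda>p. amb_form (chart_inv c p) a b)" for a b
      unfolding amb_form_def
      by (intro smooth_on_inner N smooth_on_const smooth_on_bilinear[OF N bounded_bilinear_blinfun_apply] g)
    show "smooth_on ?N (\<lambda>p. d (chart_inv c p) (e i (chart_inv c p)))" if "i < k" for i
      using smooth_fun_on_dird_vf[OF smooth_fun_imp_smooth_fun_on[OF smooth_embedding] e(1)[OF that] W(1)] c(1)
      unfolding smooth_fun_on_def by blast
    fix p assume p: "p \<in> ?N"
    show "inner_form (amb_form (chart_inv c p))" by (rule inner_form_amb[OF y(1)[OF p]])
    show "inj_on (\<lambda>i. d (chart_inv c p) (e i (chart_inv c p))) {..<k} \<and>
        independent ((\<lambda>i. d (chart_inv c p) (e i (chart_inv c p))) ` {..<k})"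
      using frame_linear_image(1,2)[OF linear_d[OF y(1)[OF p]] inj_d[OF y(1)[OF p]] e(2,3)[OF y(2)[OF p]]] by simp
  qed (rule smooth_on_const)
  then have "smooth_on ?N (\<lambda>p. orth_proj (amb_form (chart_inv c p)) (d (chart_inv c p) ` F (chart_inv c p)) v)" for v
    by (rule smooth_on_cong[OF _ N]) (simp add: im y)
  then have "smooth_on ?N (\<lambda>p. Blinfun (orth_proj (amb_form (chart_inv c p)) (d (chart_inv c p) ` F (chart_inv c p))))"
    by (rule smooth_on_Blinfun[OF N]) (use F y in \<open>auto intro!: linear_orth_proj inner_form_amb subspace_image_d\<close>)
  then have "smooth_on ?N (\<lambda>p. amb_proj M \<iota> g F (chart_inv c p))"
    unfolding amb_proj_def amb_form_def[abs_def] .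
  then show "\<exists>c\<in>atlas M. \<exists>W. openin (mtop M) W \<and> x \<in> fst c \<inter> W \<and>
      smooth_on (snd c ` (fst c \<inter> W)) (\<lambda>p. amb_proj M \<iota> g F (chart_inv c p))"
    using c W by blast
qed

end

section \<open>The tensor \<open>A\<close> and its adjoint\<close>

locale orthogonal_subbundles = riem_mfd M R for M :: "('m, 'n::euclidean_space) manifold" and R +
  fixes conn :: "('m \<Rightarrow> 'n) \<Rightarrow> ('m \<Rightarrow> 'n) \<Rightarrow> 'm \<Rightarrow> 'n" and HH VV :: "'m \<Rightarrow> 'n set"
  assumes levi_civita: "levi_civita M R conn"
    and subbundles: "subbundle M HH" "subbundle M VV"
    and orthogonal: "orthogonal_bundles M R HH VV"
begin

abbreviation "H \<equiv> vf_proj R HH"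
abbreviation "V \<equiv> vf_proj R VV"
abbreviation "A \<equiv> A_tensor M R conn HH VV"

lemma swap_subbundles: "orthogonal_subbundles M R conn VV HH"
proof (rule orthogonal_subbundles.intro[OF riem_mfd_axioms orthogonal_subbundles_axioms.intro])
  show "orthogonal_bundles M R VV HH"
    using orthogonal inner_form_commute[OF inner_form_R] unfolding orthogonal_bundles_def by metis
qed (rule levi_civita subbundles)+

lemma affine: "affine_connection M conn"
  using levi_civita unfolding levi_civita_def by blast

lemmas affine_rules = affine[unfolded affine_connection_def]

lemma smooth_conn: "smooth_vf M X \<Longrightarrow> smooth_vf M Y \<Longrightarrow> smooth_vf M (conn X Y)"
  by (rule conjunct1[OF affine_rules, rule_format, OF conjI])

lemma smooth_H: "smooth_vf M X \<Longrightarrow> smooth_vf M (H X)"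
  by (rule smooth_vf_proj[OF subbundles(1)])

lemma smooth_V: "smooth_vf M X \<Longrightarrow> smooth_vf M (V X)"
  by (rule smooth_vf_proj[OF subbundles(2)])

context
  fixes x assumes x: "x \<in> pts M"
begin

lemma conn_add_left: "smooth_vf M X \<Longrightarrow> smooth_vf M Y \<Longrightarrow> smooth_vf M Z \<Longrightarrow>
    conn (\<lambda>y. X y + Y y) Z x = conn X Z x + conn Y Z x"
  by (rule conjunct1[OF conjunct2[OF affine_rules], rule_format, OF _ x, THEN conjunct1]) simp

lemma conn_add_right: "smooth_vf M X \<Longrightarrow> smooth_vf M Y \<Longrightarrow> smooth_vf M Z \<Longrightarrow>
    conn X (\<lambda>y. Y y + Z y) x = conn X Y x + conn X Z x"
  by (rule conjunct1[OF conjunct2[OF affine_rules], rule_format, OF _ x, THEN conjunct2]) simp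

lemma conn_scale_left: "smooth_fun M (f :: 'm \<Rightarrow> real) \<Longrightarrow> smooth_vf M X \<Longrightarrow> smooth_vf M Y \<Longrightarrow>
    conn (\<lambda>y. f y *\<^sub>R X y) Y x = f x *\<^sub>R conn X Y x"
  by (rule conjunct2[OF conjunct2[OF affine_rules], rule_format, OF _ x, THEN conjunct1]) simp

lemma conn_scale_right: "smooth_fun M (f :: 'm \<Rightarrow> real) \<Longrightarrow> smooth_vf M X \<Longrightarrow> smooth_vf M Y \<Longrightarrow>
    conn X (\<lambda>y. f y *\<^sub>R Y y) x = f x *\<^sub>R conn X Y x + dird M f x (X x) *\<^sub>R Y x"
  by (rule conjunct2[OF conjunct2[OF affine_rules], rule_format, OF _ x, THEN conjunct2]) simp

lemma torsion_free: "smooth_vf M X \<Longrightarrow> smooth_vf M Y \<Longrightarrow> conn X Y x - conn Y X x = lie_bracket M X Y x"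
  using levi_civita x unfolding levi_civita_def by blast

lemma metric_compatible: "smooth_vf M X \<Longrightarrow> smooth_vf M Y \<Longrightarrow> smooth_vf M Z \<Longrightarrow>
    dird M (\<lambda>y. R y (Y y) (Z y)) x (X x) = R x (conn X Y x) (Z x) + R x (Y x) (conn X Z x)"
  using levi_civita x unfolding levi_civita_def by blast

lemmas form = inner_form_R[OF x]
lemmas subH = subbundle_subspace[OF subbundles(1) x]
lemmas subV = subbundle_subspace[OF subbundles(2) x]
lemmas linH = linear_orth_proj[OF form subH]
lemmas linV = linear_orth_proj[OF form subV]

lemma H_in: "H X x \<in> HH x" unfolding vf_proj_def by (rule orth_proj(1)[OF form subH])
lemma V_in: "V X x \<in> VV x" unfolding vf_proj_def by (rule orth_proj(1)[OF form subV])

lemma R_HV: "a \<in> HH x \<Longrightarrow> b \<in> VV x \<Longrightarrow> R x a b = 0"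
  using orthogonal x unfolding orthogonal_bundles_def by blast

lemma V_of_H: "a \<in> HH x \<Longrightarrow> orth_proj (R x) (VV x) a = 0"
  by (rule orth_proj_perp[OF form subV]) (rule R_HV)

lemma H_ident: "X x \<in> HH x \<Longrightarrow> H X x = X x" unfolding vf_proj_def by (rule orth_proj_ident[OF form subH])

end

text \<open>In the second argument the Leibniz rule produces the extra term \<open>(X f) H Y\<close>. It is horizontal, so
  \<open>V\<close> kills it, and the expression is a tensor although the connection is not.\<close>

lemma tensor_VconnH: "tensor_1_2 M (\<lambda>X Y. V (conn X (H Y)))"
  unfolding tensor_1_2_def
proof (intro conjI allI impI ballI; elim conjE)
  show "smooth_vf M (V (conn X (H Y)))" if "smooth_vf M X" "smooth_vf M Y" for X Y
    by (intro smooth_V smooth_conn smooth_H that)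
next
  fix X Y Z x assume sm: "smooth_vf M X" "smooth_vf M Y" "smooth_vf M Z" and x: "x \<in> pts M"
  show "V (conn (\<lambda>y. X y + Y y) (H Z)) x = V (conn X (H Z)) x + V (conn Y (H Z)) x"
    by (simp add: vf_proj_def conn_add_left[OF x sm(1,2) smooth_H[OF sm(3)], unfolded vf_proj_def] linear_add[OF linV[OF x]])
  have "conn X (H (\<lambda>y. Y y + Z y)) x = conn X (\<lambda>y. H Y y + H Z y) x"
    by (rule connection_cong[OF affine sm(1) smooth_H[OF smooth_vf_add[OF sm(2,3)]]
          smooth_vf_add[OF smooth_H[OF sm(2)] smooth_H[OF sm(3)]] _ x])
      (simp add: vf_proj_def linear_add[OF linH])
  also have "\<dots> = conn X (H Y) x + conn X (H Z) x"
    by (rule conn_add_right[OF x sm(1) sm(2,3)[THEN smooth_H]])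
  finally show "V (conn X (H (\<lambda>y. Y y + Z y))) x = V (conn X (H Y)) x + V (conn X (H Z)) x"
    by (simp add: vf_proj_def linear_add[OF linV[OF x]])
next
  fix f :: "'m \<Rightarrow> real" and X Y x
  assume sm: "smooth_fun M f" "smooth_vf M X" "smooth_vf M Y" and x: "x \<in> pts M"
  show "V (conn (\<lambda>y. f y *\<^sub>R X y) (H Y)) x = f x *\<^sub>R V (conn X (H Y)) x"
    by (simp add: vf_proj_def conn_scale_left[OF x sm(1,2) smooth_H[OF sm(3)], unfolded vf_proj_def] linear_scale[OF linV[OF x]])
  have "conn X (H (\<lambda>y. f y *\<^sub>R Y y)) x = conn X (\<lambda>y. f y *\<^sub>R H Y y) x"
    by (rule connection_cong[OF affine sm(2) smooth_H[OF smooth_vf_scaleR[OF sm(1,3)]]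
          smooth_vf_scaleR[OF sm(1) smooth_H[OF sm(3)]] _ x])
      (simp add: vf_proj_def linear_scale[OF linH])
  also have "\<dots> = f x *\<^sub>R conn X (H Y) x + dird M f x (X x) *\<^sub>R H Y x"
    by (rule conn_scale_right[OF x sm(1,2) smooth_H[OF sm(3)]])
  finally show "V (conn X (H (\<lambda>y. f y *\<^sub>R Y y))) x = f x *\<^sub>R V (conn X (H Y)) x"
    using V_of_H[OF x H_in[OF x], of Y]
    by (simp add: vf_proj_def[of R VV] linear_add[OF linV[OF x]] linear_scale[OF linV[OF x]])
qed

lemma VconnH_pointwise:
  assumes x: "x \<in> pts M" and sm: "smooth_vf M X" "smooth_vf M X'" "smooth_vf M Y" "smooth_vf M Y'"
    and eq: "X x = X' x" "Y x = Y' x"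
  shows "V (conn X (H Y)) x = V (conn X' (H Y')) x"
proof -
  note T = tensor_VconnH[unfolded tensor_1_2_def]
  have "V (conn X (H Y)) x = V (conn X' (H Y)) x"
    by (rule tensorial_pointwise[where T = "\<lambda>X. V (conn X (H Y)) x", OF x _ _ sm(1,2) eq(1)])
      (use T sm x in blast)+
  also have "\<dots> = V (conn X' (H Y')) x"
    by (rule tensorial_pointwise[where T = "\<lambda>Y. V (conn X' (H Y)) x", OF x _ _ sm(3,4) eq(2)])
      (use T sm x in blast)+
  finally show ?thesis .
qed

lemma A_eq:
  assumes x: "x \<in> pts M" and sm: "smooth_vf M X" "smooth_vf M Y"
  shows "A x (X x) (Y x) = V (conn X (H Y)) x"
  unfolding A_tensor_def
proof (rule the_equality)
  show "\<exists>c1 c2. smooth_vf M c1 \<and> smooth_vf M c2 \<and> c1 x = X x \<and> c2 x = Y x \<and> V (conn X (H Y)) x = V (conn c1 (H c2)) x"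
    using sm by blast
qed (use VconnH_pointwise[OF x] sm in metis)

lemma A_in: "x \<in> pts M \<Longrightarrow> A x \<xi> \<eta> \<in> VV x"
  using A_eq V_in by (metis tangent_vector_extends)

lemma bilinear_A:
  assumes x: "x \<in> pts M" shows "bilinear (A x)"
  unfolding bilinear_def
proof (intro conjI allI)
  note T = tensor_VconnH[unfolded tensor_1_2_def]
  fix \<xi>
  obtain X where X: "smooth_vf M X" "X x = \<xi>" using tangent_vector_extends[OF x] by blast
  show "linear (A x \<xi>)"
  proof (rule linearI)
    fix u v r
    obtain Y where Y: "smooth_vf M Y" "Y x = u" using tangent_vector_extends[OF x] by blast
    obtain Z where Z: "smooth_vf M Z" "Z x = v" using tangent_vector_extends[OF x] by blast
    show "A x \<xi> (u + v) = A x \<xi> u + A x \<xi> v"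
      using A_eq[OF x X(1) smooth_vf_add[OF Y(1) Z(1)]] A_eq[OF x X(1) Y(1)] A_eq[OF x X(1) Z(1)] T X Y Z x by simp
    show "A x \<xi> (r *\<^sub>R u) = r *\<^sub>R A x \<xi> u"
      using A_eq[OF x X(1) smooth_vf_scaleR[OF smooth_fun_const[of r] Y(1)]] A_eq[OF x X(1) Y(1)] T X Y x smooth_fun_const[of r] by simp
  qed
  show "linear (\<lambda>v. A x v \<xi>)"
  proof (rule linearI)
    fix u v r
    obtain Y where Y: "smooth_vf M Y" "Y x = u" using tangent_vector_extends[OF x] by blast
    obtain Z where Z: "smooth_vf M Z" "Z x = v" using tangent_vector_extends[OF x] by blast
    show "A x (u + v) \<xi> = A x u \<xi> + A x v \<xi>"
      using A_eq[OF x smooth_vf_add[OF Y(1) Z(1)] X(1)] A_eq[OF x Y(1) X(1)] A_eq[OF x Z(1) X(1)] T X Y Z x by simp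
    show "A x (r *\<^sub>R u) \<xi> = r *\<^sub>R A x u \<xi>"
      using A_eq[OF x smooth_vf_scaleR[OF smooth_fun_const[of r] Y(1)] X(1)] A_eq[OF x Y(1) X(1)] T X Y x smooth_fun_const[of r] by simp
  qed
qed

lemma smooth_A:
  "smooth_vf M X \<Longrightarrow> smooth_vf M Y \<Longrightarrow> smooth_vf M (\<lambda>x. A x (X x) (Y x))"
  by (rule smooth_vf_cong[OF smooth_V[OF smooth_conn[OF _ smooth_H]]]) (simp_all add: A_eq)

text \<open>The function \<open>\<langle>H Y, V Z\<rangle>\<close> vanishes, and the metric is parallel.\<close>

lemma HconnV_adjoint:
  assumes x: "x \<in> pts M" and sm: "smooth_vf M X" "smooth_vf M Y" "smooth_vf M Z"
  shows "R x (H (conn X (V Z)) x) (Y x) = - R x (Z x) (V (conn X (H Y)) x)"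
proof -
  have "dird M (\<lambda>y. R y (H Y y) (V Z y)) x (X x) = dird M (\<lambda>y. 0 :: real) x (X x)"
    by (rule fun_cong[OF dird_cong[OF openin_pts x]]) (use R_HV H_in V_in in auto)
  then have "R x (conn X (H Y) x) (V Z x) + R x (H Y x) (conn X (V Z) x) = 0"
    using metric_compatible[OF x sm(1) smooth_H[OF sm(2)] smooth_V[OF sm(3)]] by simp
  moreover have "R x (H (conn X (V Z)) x) (Y x) = R x (H Y x) (conn X (V Z) x)"
    unfolding vf_proj_def[of R HH] using orth_proj_self_adjoint[OF form[OF x] subH[OF x]] inner_form_commute[OF form[OF x]] by metis
  moreover have "R x (Z x) (V (conn X (H Y)) x) = R x (conn X (H Y) x) (V Z x)"
    unfolding vf_proj_def[of R VV] using orth_proj_self_adjoint[OF form[OF x] subV[OF x]] inner_form_commute[OF form[OF x]] by metis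
  ultimately show ?thesis by simp
qed

text \<open>The adjoint is specified by a definite description. A witness is built by extending every
  tangent vector to a field; nondegeneracy of the metric makes it the only one and makes its values
  independent of the extensions.\<close>

lemma A_adj_eq:
  assumes x: "x \<in> pts M" and sm: "smooth_vf M X" "smooth_vf M Z"
  shows "A_adj M R conn HH VV x (X x) (Z x) = - H (conn X (V Z)) x"
proof -
  let ?P = "\<lambda>S. \<forall>v w. R x (S v) w = R x v (A x (X x) w)"
  have val: "R x (- H (conn X (V Z)) x) w = R x (Z x) (A x (X x) w)" if Z: "smooth_vf M Z" for Z w
  proof -
    obtain Y where Y: "smooth_vf M Y" "Y x = w" using tangent_vector_extends[OF x] by blast
    then show ?thesis
      using HconnV_adjoint[OF x sm(1) Y(1) Z] A_eq[OF x sm(1) Y(1)] by (simp add: inner_form_simps[OF form[OF x]])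
  qed
  have "\<forall>v. \<exists>Z. smooth_vf M Z \<and> Z x = v" using tangent_vector_extends[OF x] by blast
  then obtain E where E: "\<And>v. smooth_vf M (E v)" "\<And>v. E v x = v" by metis
  have ex: "?P (\<lambda>v. - H (conn X (V (E v))) x)"
    using val[OF E(1), unfolded E(2)] by blast
  have "S = S'" if "?P S" "?P S'" for S S'
    by (rule ext, rule inner_form_eqI[OF form[OF x]]) (use that in simp)
  with ex have "\<exists>!S. ?P S" by (intro ex_ex1I exI)
  then have "?P (A_adj M R conn HH VV x (X x))"
    unfolding A_adj_def adjoint_wrt_def by (rule theI')
  then show ?thesis using val[OF sm(2)] by (intro inner_form_eqI[OF form[OF x]]) simp
qed

text \<open>The adjoint is minus the same tensor with the two subbundles exchanged, so every formula for \<open>A\<close>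
  yields one for its adjoint.\<close>

lemma A_adj_swap:
  assumes x: "x \<in> pts M"
  shows "A_adj M R conn HH VV x \<xi> \<eta> = - A_tensor M R conn VV HH x \<xi> \<eta>"
proof -
  obtain X where X: "smooth_vf M X" "X x = \<xi>" using tangent_vector_extends[OF x] by blast
  obtain Z where Z: "smooth_vf M Z" "Z x = \<eta>" using tangent_vector_extends[OF x] by blast
  show ?thesis
    using A_adj_eq[OF x X(1) Z(1)] orthogonal_subbundles.A_eq[OF swap_subbundles x X(1) Z(1)] X(2) Z(2) by simp
qed

end

section \<open>Derivatives of projections in the ambient space\<close>

context ambient_mfd
begin

lemma dird_amb_proj:
  assumes F: "subbundle M F" and Y: "smooth_vf M Y" and x: "x \<in> pts M"
  shows "dird M (\<lambda>y. blinfun_apply (amb_proj M \<iota> g F y) (d y (Y y))) x \<xi> =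
    blinfun_apply (amb_proj M \<iota> g F x) (dird M (\<lambda>y. d y (Y y)) x \<xi>) +
    blinfun_apply (dird M (amb_proj M \<iota> g F) x \<xi>) (d x (Y x))"
  by (rule dird_bilinear[OF bounded_bilinear_blinfun_apply x
        mdiff_smooth_fun[OF smooth_amb_proj[OF F] x]
        mdiff_smooth_fun[OF smooth_fun_dird_vf[OF smooth_embedding Y] x]])

text \<open>Differentiate \<open>\<Pi>\<^sub>F Y = Y\<close>.\<close>

lemma dird_section:
  assumes F: "subbundle M F" and Y: "smooth_vf M Y" "\<And>y. y \<in> pts M \<Longrightarrow> Y y \<in> F y" and x: "x \<in> pts M"
  shows "dird M (\<lambda>y. d y (Y y)) x \<xi> =
    blinfun_apply (amb_proj M \<iota> g F x) (dird M (\<lambda>y. d y (Y y)) x \<xi>) +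
    blinfun_apply (dird M (amb_proj M \<iota> g F) x \<xi>) (d x (Y x))"
proof -
  have "dird M (\<lambda>y. d y (Y y)) x = dird M (\<lambda>y. blinfun_apply (amb_proj M \<iota> g F y) (d y (Y y))) x"
    by (rule dird_cong[OF openin_pts x])
      (simp add: amb_proj_d[OF F] orth_proj_ident[OF inner_form_R subbundle_subspace[OF F] Y(2)])
  then show ?thesis using dird_amb_proj[OF F Y(1) x, of \<xi>] by metis
qed

text \<open>Differentiate \<open>\<Pi>\<^sub>F Y = 0\<close>.\<close>

lemma dird_perp_section:
  assumes F: "subbundle M F" and Y: "smooth_vf M Y" "\<And>y s. y \<in> pts M \<Longrightarrow> s \<in> F y \<Longrightarrow> R y (Y y) s = 0" and x: "x \<in> pts M"
  shows "blinfun_apply (amb_proj M \<iota> g F x) (dird M (\<lambda>y. d y (Y y)) x \<xi>) =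
    - blinfun_apply (dird M (amb_proj M \<iota> g F) x \<xi>) (d x (Y x))"
proof -
  have "dird M (\<lambda>y. 0 :: 'e) x = dird M (\<lambda>y. blinfun_apply (amb_proj M \<iota> g F y) (d y (Y y))) x"
    by (rule dird_cong[OF openin_pts x])
      (simp add: amb_proj_d[OF F] orth_proj_perp[OF inner_form_R subbundle_subspace[OF F] Y(2)] linear_0[OF linear_d])
  then have "dird M (\<lambda>y. blinfun_apply (amb_proj M \<iota> g F y) (d y (Y y))) x \<xi> = 0"
    by (metis dird_const)
  then show ?thesis using dird_amb_proj[OF F Y(1) x, of \<xi>] by (simp add: eq_neg_iff_add_eq_0)
qed

lemma amb_proj_tangent:
  assumes F: "subbundle M F" and x: "x \<in> pts M"
  shows "blinfun_apply (amb_proj M \<iota> g F x) (blinfun_apply (amb_proj M \<iota> g (\<lambda>_. UNIV) x) v) =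
    blinfun_apply (amb_proj M \<iota> g F x) v"
  unfolding amb_proj_apply[OF F x] amb_proj_apply[OF subbundle_UNIV x]
  by (rule orth_proj_orth_proj) (use inner_form_amb[OF x] subspace_image_d[OF F x] subspace_image_d[OF subbundle_UNIV x] in auto)

end

locale ambient_subbundles = orthogonal_subbundles M R conn HH VV + ambient_mfd M R \<iota> g
  for M :: "('m, 'n::euclidean_space) manifold" and R conn HH VV
    and \<iota> :: "'m \<Rightarrow> 'e::euclidean_space" and g
begin

text \<open>Differentiating \<open>V (H Y) = 0\<close> turns \<open>V D(H Y)\<close> into \<open>- (D V) H Y\<close>; differentiating
  \<open>\<Pi> (H Y) = H Y\<close> shows that the extra term \<open>V (D \<Pi>) H Y\<close> in the formula vanishes.\<close>

lemma ambient_A: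
  assumes \<Gamma>: "christoffel M conn \<iota> \<Gamma>" and x: "x \<in> pts M"
  shows "d x (A x \<xi> \<eta>) = Gamma_sub M \<iota> g \<Gamma> VV x \<xi> (blinfun_apply (amb_proj M \<iota> g HH x) (d x \<eta>))"
proof -
  obtain X where X: "smooth_vf M X" "X x = \<xi>" using tangent_vector_extends[OF x] by blast
  obtain Z where Z: "smooth_vf M Z" "Z x = \<eta>" using tangent_vector_extends[OF x] by blast
  define Y where "Y = H Z"
  define w where "w = dird M (\<lambda>y. d y (Y y)) x \<xi>"
  have Y: "smooth_vf M Y" "\<And>y. y \<in> pts M \<Longrightarrow> Y y \<in> HH y" unfolding Y_def using smooth_H[OF Z(1)] H_in by auto
  let ?V = "blinfun_apply (amb_proj M \<iota> g VV x)" and ?G = "blinfun_apply (blinfun_apply (\<Gamma> x) (d x \<xi>)) (d x (Y x))"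
  let ?D = "\<lambda>F. blinfun_apply (dird M (amb_proj M \<iota> g F) x \<xi>) (d x (Y x))"
  have Yx: "blinfun_apply (amb_proj M \<iota> g HH x) (d x \<eta>) = d x (Y x)"
    unfolding amb_proj_d[OF subbundles(1) x] Y_def vf_proj_def Z(2) ..
  have V1: "?V w = - ?D VV"
    unfolding w_def by (rule dird_perp_section[OF subbundles(2) Y(1) _ x]) (use R_HV Y(2) in auto)
  have "w = blinfun_apply (amb_proj M \<iota> g (\<lambda>_. UNIV) x) w + ?D (\<lambda>_. UNIV)"
    unfolding w_def by (rule dird_section[OF subbundle_UNIV Y(1) _ x]) auto
  then have "?V w = ?V w + ?V (?D (\<lambda>_. UNIV))"
    using amb_proj_tangent[OF subbundles(2) x] blinfun.add_right by metis
  then have V2: "?V (?D (\<lambda>_. UNIV)) = 0" by simp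
  have "d x (A x \<xi> \<eta>) = ?V (d x (conn X Y x))"
    using A_eq[OF x X(1) Z(1)] X(2) Z(2) amb_proj_d[OF subbundles(2) x] by (simp add: Y_def vf_proj_def)
  also have "d x (conn X Y x) = w + ?G"
    using \<Gamma> X Y(1) x unfolding christoffel_def w_def by blast
  finally show ?thesis
    using V1 V2 by (simp add: Gamma_sub_def Gamma_ring_def Yx blinfun.add_right)
qed

end

section \<open>Riemannian submersions\<close>

text \<open>Along a direction \<open>u\<close> in which \<open>Q\<close> is stationary, the inner products \<open>G (Q s)\<close> are constant to first
  order, so only the two arguments \<open>a s\<close> contribute.\<close>

lemma frechet_derivative_form_along_fibre:
  fixes G :: "'k::euclidean_space \<Rightarrow> 'k \<Rightarrow> 'k \<Rightarrow> real" and Q a :: "'n::euclidean_space \<Rightarrow> 'k"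
  assumes T: "open T" and G: "\<And>i j. smooth_on T (\<lambda>z. G z i j)" and form: "\<And>z. z \<in> T \<Longrightarrow> inner_form (G z)"
    and S: "open S" "p \<in> S" and Q: "\<And>s. s \<in> S \<Longrightarrow> Q s \<in> T"
    and dQ: "Q differentiable (at p)" and da: "a differentiable (at p)"
    and u: "frechet_derivative Q (at p) u = 0"
  shows "frechet_derivative (\<lambda>s. G (Q s) (a s) (a s)) (at p) u =
    2 * G (Q p) (a p) (frechet_derivative a (at p) u)"
proof -
  let ?Da = "frechet_derivative a (at p)"
  have expand: "G z b c = (\<Sum>j\<in>Basis. \<Sum>i\<in>Basis. (c \<bullet> j) * ((b \<bullet> i) * G z i j))" if "z \<in> T" for z b c
  proof -
    have "linear (\<lambda>v. G z v w)" "linear (G z w)" for w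
      using form[OF that] unfolding inner_form_def bilinear_def by auto
    note e = this[THEN linear_euclidean_expansion]
    have "G z b c = (\<Sum>j\<in>Basis. (c \<bullet> j) * G z b j)" using e(2)[of b c] by simp
    also have "\<dots> = (\<Sum>j\<in>Basis. \<Sum>i\<in>Basis. (c \<bullet> j) * ((b \<bullet> i) * G z i j))"
      using e(1)[of b] by (simp add: sum_distrib_left)
    finally show ?thesis .
  qed
  have cmp: "(\<lambda>s. G (Q s) i j) differentiable (at p)"
    "frechet_derivative (\<lambda>s. G (Q s) i j) (at p) u = 0" for i j
  proof -
    have d: "(\<lambda>z. G z i j) differentiable (at (Q p))" by (rule smooth_on_differentiable[OF G Q[OF S(2)]])
    show "(\<lambda>s. G (Q s) i j) differentiable (at p)" by (rule frechet_derivative_chain(1)[OF dQ d])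
    show "frechet_derivative (\<lambda>s. G (Q s) i j) (at p) u = 0"
      using frechet_derivative_chain(2)[OF dQ d, of u] linear_0[OF linear_frechet_derivative[OF d]] u by simp
  qed
  have ai: "((\<lambda>s. a s \<bullet> i) has_derivative (\<lambda>v. ?Da v \<bullet> i)) (at p)" for i
    by (rule has_derivative_inner_left[OF has_frechet_derivative[OF da]])
  have "((\<lambda>s. \<Sum>j\<in>Basis. \<Sum>i\<in>Basis. (a s \<bullet> j) * ((a s \<bullet> i) * G (Q s) i j)) has_derivative
    (\<lambda>v. \<Sum>j\<in>Basis. \<Sum>i\<in>Basis.
      (a p \<bullet> j) * ((a p \<bullet> i) * frechet_derivative (\<lambda>s. G (Q s) i j) (at p) v + (?Da v \<bullet> i) * G (Q p) i j) +
      (?Da v \<bullet> j) * ((a p \<bullet> i) * G (Q p) i j))) (at p)"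
    by (intro has_derivative_sum has_derivative_mult ai has_frechet_derivative[OF cmp(1)])
  then have "((\<lambda>s. G (Q s) (a s) (a s)) has_derivative
    (\<lambda>v. \<Sum>j\<in>Basis. \<Sum>i\<in>Basis.
      (a p \<bullet> j) * ((a p \<bullet> i) * frechet_derivative (\<lambda>s. G (Q s) i j) (at p) v + (?Da v \<bullet> i) * G (Q p) i j) +
      (?Da v \<bullet> j) * ((a p \<bullet> i) * G (Q p) i j))) (at p)"
    by (rule has_derivative_transform_within_open[OF _ S]) (rule expand[OF Q, symmetric])
  from fun_cong[OF frechet_derivative_eqI[OF this], of u]
  have "frechet_derivative (\<lambda>s. G (Q s) (a s) (a s)) (at p) u = G (Q p) (?Da u) (a p) + G (Q p) (a p) (?Da u)"
    by (simp add: cmp(2) expand[OF Q[OF S(2)], of "?Da u" "a p"] expand[OF Q[OF S(2)], of "a p" "?Da u"]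
        sum.distrib distrib_left)
  then show ?thesis using inner_form_commute[OF form[OF Q[OF S(2)]]] by simp
qed

locale submersion_subbundles = orthogonal_subbundles M R conn HH VV
  for M :: "('m, 'n::euclidean_space) manifold" and R conn HH VV +
  fixes B :: "('b, 'k::euclidean_space) manifold" and RB q
  assumes submersion: "riemannian_submersion M R B RB q"
    and HH: "\<And>x. x \<in> pts M \<Longrightarrow> HH x = horizontal M R B q x"
    and VV: "\<And>x. x \<in> pts M \<Longrightarrow> VV x = vertical M B q x"
begin

sublocale B: riem_mfd B RB
proof unfold_locales
  show "riemannian_manifold B RB" using submersion unfolding riemannian_submersion_def by blast
  then show "smooth_manifold B" unfolding riemannian_manifold_def by blast
qed

text \<open>Here the horizontal spaces are full orthogonal complements of the vertical ones, so the two
  projections add up to the identity.\<close>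

lemma H_eq_minus_V:
  assumes x: "x \<in> pts M" shows "orth_proj (R x) (HH x) w = w - orth_proj (R x) (VV x) w"
proof (rule orth_proj_eqI[OF form[OF x] subH[OF x]])
  show "w - orth_proj (R x) (VV x) w \<in> HH x"
    using orth_proj(2)[OF form[OF x] subV[OF x]] VV[OF x] unfolding HH[OF x] horizontal_def by simp
  show "R x (w - (w - orth_proj (R x) (VV x) w)) s = 0" if "s \<in> HH x" for s
    using R_HV[OF x that orth_proj(1)[OF form[OF x] subV[OF x]]] inner_form_commute[OF form[OF x]] by simp
qed

lemma q_in_pts: "x \<in> pts M \<Longrightarrow> q x \<in> pts B"
  using submersion unfolding riemannian_submersion_def smooth_map_def continuous_map_def pts_def by blast

context
  fixes b assumes b: "b \<in> atlas B"
begin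

definition q_chart where "q_chart y = snd b (q y)"

definition chart_preimage where "chart_preimage = {y \<in> pts M. q y \<in> fst b}"

lemma openin_chart_preimage: "openin (mtop M) chart_preimage"
  using submersion B.chart_openin[OF b] openin_continuous_map_preimage
  unfolding riemannian_submersion_def smooth_map_def chart_preimage_def pts_def by blast

lemma smooth_q_chart: "smooth_fun_on chart_preimage q_chart"
  unfolding smooth_fun_on_def
proof
  fix c assume c: "c \<in> atlas M"
  have "fst c \<inter> chart_preimage = {y \<in> fst c. q y \<in> fst b}" using chart_in_pts[OF c] by (auto simp: chart_preimage_def)
  moreover have "smooth_map M B q" using submersion unfolding riemannian_submersion_def by blast
  ultimately show "smooth_on (snd c ` (fst c \<inter> chart_preimage)) (\<lambda>p. q_chart (chart_inv c p))"
    using b c unfolding smooth_map_def q_chart_def by (fastforce simp: o_def)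
qed

end

lemma mdiff_q_chart:
  assumes b: "b \<in> atlas B" and y: "y \<in> pts M" "q y \<in> fst b"
  shows "mdiff (\<lambda>z. snd b (q z)) y"
  using mdiff_smooth_fun_on[OF smooth_q_chart[OF b] openin_chart_preimage[OF b]] y unfolding q_chart_def[OF b] chart_preimage_def[OF b] by auto

lemma differential_eq: "differential M B q x = dird M (\<lambda>z. snd (chart_at B (q x)) (q z)) x"
  by (simp add: differential_def o_def)

text \<open>The preferred chart of \<open>B\<close> at \<open>q y\<close> may change with \<open>y\<close>; passing to a fixed chart applies
  the transition map to the differential.\<close>

lemma dird_q_chart:
  assumes b: "b \<in> atlas B" and y: "y \<in> pts M" "q y \<in> fst b"
  shows "dird M (\<lambda>z. snd b (q z)) y \<zeta> = dird B (snd b) (q y) (differential M B q y \<zeta>)"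
proof -
  let ?b = "chart_at B (q y)"
  have b': "?b \<in> atlas B" "q y \<in> fst ?b" using B.chart_at[OF q_in_pts[OF y(1)]] by auto
  let ?c = "chart_at M y"
  have c: "?c \<in> atlas M" "y \<in> fst ?c" using chart_at[OF y(1)] by auto
  have d1: "(\<lambda>p. snd ?b (q (chart_inv ?c p))) differentiable (at (snd ?c y))"
    using mdiff_q_chart[OF b'(1) y(1) b'(2)] unfolding mdiff_def .
  have "B.mdiff (snd b) (q y)" by (rule B.mdiff_chart[OF b y(2)])
  then have d2: "(\<lambda>z. snd b (chart_inv ?b z)) differentiable (at (snd ?b (q (chart_inv ?c (snd ?c y)))))"
    unfolding B.mdiff_def using c by simp
  have "dird M (\<lambda>z. snd b (q z)) y \<zeta> = dird M (\<lambda>z. snd b (chart_inv ?b (snd ?b (q z)))) y \<zeta>"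
    by (rule fun_cong[OF dird_cong[OF openin_chart_preimage[OF b'(1)]]]) (use y b' in \<open>auto simp: chart_preimage_def[OF b'(1)]\<close>)
  also have "\<dots> = dird B (snd b) (q y) (differential M B q y \<zeta>)"
    unfolding differential_eq dird_def' B.dird_def'
    using frechet_derivative_chain(2)[OF d1 d2, of \<zeta>] c by simp
  finally show ?thesis .
qed

text \<open>Let \<open>X\<close> be horizontal and \<open>U\<close> vertical. In a chart of \<open>B\<close> write \<open>a = dq X\<close>. As \<open>q\<close> does not
  change to first order along \<open>U\<close>, only \<open>a\<close> contributes to \<open>U \<langle>X, X\<rangle> = 2 \<langle>a, D\<^sub>U a\<rangle>\<close>. As \<open>dq U = 0\<close>,
  the commutator formula gives \<open>dq [X, U] = - D\<^sub>U a\<close>. This takes the place of the usual argument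
  with basic vector fields.\<close>

lemma vertical_derivative_of_horizontal_norm:
  assumes X: "smooth_vf M X" "\<And>y. y \<in> pts M \<Longrightarrow> X y \<in> HH y"
    and U: "smooth_vf M U" "\<And>y. y \<in> pts M \<Longrightarrow> U y \<in> VV y" and x: "x \<in> pts M"
  shows "dird M (\<lambda>y. R y (X y) (X y)) x (U x) = - 2 * R x (X x) (lie_bracket M X U x)"
proof -
  define b where "b = chart_at B (q x)"
  have b: "b \<in> atlas B" "q x \<in> fst b" using B.chart_at[OF q_in_pts[OF x]] by (auto simp: b_def)
  define F where "F = (\<lambda>z. snd b (q z))"
  define W where "W = {y \<in> pts M. q y \<in> fst b}"
  have F: "smooth_fun_on W F" and W: "openin (mtop M) W" "x \<in> W"
    using smooth_q_chart[OF b(1)] openin_chart_preimage[OF b(1)] b(2) x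
    unfolding F_def W_def q_chart_def[OF b(1), abs_def] chart_preimage_def[OF b(1)] by auto
  have Wp: "y \<in> pts M" "q y \<in> fst b" if "y \<in> W" for y using that by (auto simp: W_def)
  have dF: "dird M F y \<zeta> = dird B (snd b) (q y) (differential M B q y \<zeta>)" if "y \<in> W" for y \<zeta>
    unfolding F_def by (rule dird_q_chart[OF b(1) Wp[OF that]])
  let ?G = "B.metric_chart b"
  define a where "a = (\<lambda>y. dird M F y (X y))"
  have sm_a: "smooth_fun_on W a" unfolding a_def
    by (rule smooth_fun_on_dird_vf[OF F smooth_vf_imp_smooth_vf_on[OF X(1)] W(1)])
  have da: "mdiff a x" "mdiff F x" using mdiff_smooth_fun_on[OF _ W] sm_a F by auto
  have vert: "dird M F y (U y) = 0" if y: "y \<in> W" for y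
  proof -
    have "differential M B q y (U y) = 0" using U(2) VV Wp[OF y] by (auto simp: vertical_def)
    then show ?thesis using dF[OF y] linear_0[OF B.linear_dird_chart[OF b(1) Wp(2)[OF y]]] by simp
  qed
  have RG: "R y (X y) h = ?G (F y) (a y) (dird M F y h)" if y: "y \<in> W" and h: "h \<in> HH y" for y h
  proof -
    have "R y (X y) h = RB (q y) (differential M B q y (X y)) (differential M B q y h)"
      using submersion Wp(1)[OF y] X(2)[OF Wp(1)[OF y]] h HH[OF Wp(1)[OF y]]
      unfolding riemannian_submersion_def by auto
    also have "\<dots> = ?G (F y) (a y) (dird M F y h)"
      unfolding a_def dF[OF y] unfolding F_def by (rule B.metric_chart[OF b(1) Wp(2)[OF y], symmetric])
    finally show ?thesis .
  qed
  have "dird M (\<lambda>y. R y (X y) (X y)) x (U x) = dird M (\<lambda>y. ?G (F y) (a y) (a y)) x (U x)"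
    by (rule fun_cong[OF dird_cong[OF W]]) (simp add: RG X(2) Wp a_def)
  also have "\<dots> = 2 * ?G (F x) (a x) (dird M a x (U x))"
  proof -
    let ?c = "chart_at M x"
    have c: "?c \<in> atlas M" "x \<in> fst ?c" using chart_at[OF x] by auto
    note N = local_chart_nbhd[OF x W]
    have "frechet_derivative (\<lambda>s. ?G (F (chart_inv ?c s)) (a (chart_inv ?c s)) (a (chart_inv ?c s))) (at (snd ?c x)) (U x) =
      2 * ?G (F (chart_inv ?c (snd ?c x))) (a (chart_inv ?c (snd ?c x)))
        (frechet_derivative (\<lambda>s. a (chart_inv ?c s)) (at (snd ?c x)) (U x))"
    proof (rule frechet_derivative_form_along_fibre[OF B.chart_open_image[OF b(1)] B.smooth_metric_chart[OF b(1)] B.inner_form_metric_chart[OF b(1)] N(1,2)])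
      show "F (chart_inv ?c s) \<in> snd b ` fst b" if "s \<in> snd ?c ` (fst ?c \<inter> W)" for s
        using Wp(2)[OF N(3)[OF that]] by (simp add: F_def)
      show "frechet_derivative (\<lambda>s. F (chart_inv ?c s)) (at (snd ?c x)) (U x) = 0"
        using vert[OF W(2)] unfolding dird_def' .
    qed (use da in \<open>simp_all add: mdiff_def\<close>)
    then show ?thesis using c by (simp add: dird_def')
  qed
  also have "dird M a x (U x) = - dird M F x (lie_bracket M X U x)"
  proof -
    have "dird M (\<lambda>y. dird M F y (U y)) x = dird M (\<lambda>y. 0) x" by (rule dird_cong[OF W]) (rule vert)
    then have "dird M (\<lambda>y. dird M F y (U y)) x (X x) = 0" by simp
    then have "- dird M a x (U x) = dird M F x (lie_bracket M X U x)"
      using dird_commutator[OF F W X(1) U(1)] by (simp add: a_def)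
    then show ?thesis by (metis minus_minus)
  qed
  also have "?G (F x) (a x) (- dird M F x (lie_bracket M X U x)) = - R x (X x) (lie_bracket M X U x)"
  proof -
    let ?w = "lie_bracket M X U x"
    let ?v = "orth_proj (R x) (VV x) ?w"
    have v: "?v \<in> VV x" by (rule orth_proj(1)[OF form[OF x] subV[OF x]])
    have h: "?w - ?v \<in> HH x" using H_eq_minus_V[OF x] orth_proj(1)[OF form[OF x] subH[OF x]] by metis
    have "differential M B q x ?v = 0" using v VV[OF x] by (simp add: vertical_def)
    then have "dird M F x ?v = 0" using dF[OF W(2)] linear_0[OF B.linear_dird_chart[OF b]] by simp
    then have "dird M F x (?w - ?v) = dird M F x ?w" using linear_diff[OF linear_dird[OF da(2)]] by simp
    moreover have "R x (X x) (?w - ?v) = R x (X x) ?w"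
      using R_HV[OF x X(2)[OF x] v] by (simp add: inner_form_simps[OF form[OF x]])
    moreover have "inner_form (?G (F x))" using b B.inner_form_metric_chart[OF b(1)] by (simp add: F_def)
    ultimately show ?thesis using RG[OF W(2) h] by (simp add: inner_form_simps(10))
  qed
  finally show ?thesis by simp
qed

text \<open>Test \<open>A\<^sub>\<xi> \<xi>\<close> against a vertical field \<open>U\<close> extending it. Metric compatibility and absence of
  torsion give \<open>\<langle>\<nabla>\<^sub>X X, U\<rangle> = - \<langle>X, \<nabla>\<^sub>X U\<rangle> = - \<langle>X, [X, U]\<rangle> - U \<langle>X, X\<rangle> / 2\<close>, which is zero.\<close>

lemma A_horizontal_self:
  assumes x: "x \<in> pts M" and \<xi>: "\<xi> \<in> HH x" shows "A x \<xi> \<xi> = 0"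
proof -
  obtain c where c: "smooth_vf M c" "c x = \<xi>" using tangent_vector_extends[OF x] by blast
  define X where "X = H c"
  have X: "smooth_vf M X" "\<And>y. y \<in> pts M \<Longrightarrow> X y \<in> HH y" "X x = \<xi>"
    unfolding X_def using smooth_H[OF c(1)] H_in H_ident[OF x, of c] c(2) \<xi> by auto
  have "conn X (H X) x = conn X X x"
    by (rule connection_cong[OF affine X(1) smooth_H[OF X(1)] X(1) _ x]) (rule H_ident[OF _ X(2)])
  then have A: "A x \<xi> \<xi> = V (conn X X) x" using A_eq[OF x X(1) X(1)] X(3) by (simp add: vf_proj_def[of R VV])
  define u where "u = A x \<xi> \<xi>"
  have u: "u \<in> VV x" unfolding u_def by (rule A_in[OF x])
  obtain c' where c': "smooth_vf M c'" "c' x = u" using tangent_vector_extends[OF x] by blast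
  define U where "U = V c'"
  have U: "smooth_vf M U" "\<And>y. y \<in> pts M \<Longrightarrow> U y \<in> VV y" "U x = u"
    unfolding U_def using smooth_V[OF c'(1)] V_in c'(2) orth_proj_ident[OF form[OF x] subV[OF x] u] by (auto simp: vf_proj_def[of R VV])
  have "R x u u = R x (conn X X x) (U x)"
    using orth_proj(3)[OF form[OF x] subV[OF x] u, of "conn X X x"] A U(3) by (simp add: u_def vf_proj_def[of R VV])
  also have "\<dots> = - R x (X x) (conn X U x)"
  proof -
    have "dird M (\<lambda>y. R y (X y) (U y)) x (X x) = dird M (\<lambda>y. 0 :: real) x (X x)"
      by (rule fun_cong[OF dird_cong[OF openin_pts x]]) (use R_HV X(2) U(2) in auto)
    then show ?thesis using metric_compatible[OF x X(1) X(1) U(1)] by simp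
  qed
  also have "R x (X x) (conn X U x) = R x (X x) (conn U X x) + R x (X x) (lie_bracket M X U x)"
    using torsion_free[OF x X(1) U(1)] inner_form_simps(2)[OF form[OF x], of "X x" "conn U X x"]
    by (metis add.commute diff_add_cancel)
  also have "R x (X x) (conn U X x) = dird M (\<lambda>y. R y (X y) (X y)) x (U x) / 2"
    using metric_compatible[OF x U(1) X(1) X(1)] inner_form_commute[OF form[OF x], of "X x"] by simp
  also have "\<dots> = - R x (X x) (lie_bracket M X U x)"
    using vertical_derivative_of_horizontal_norm[OF X(1,2) U(1,2) x] by simp
  finally have "R x u u = 0" by simp
  then show ?thesis using inner_form_eq_0[OF form[OF x]] by (simp add: u_def)
qed

text \<open>Polarisation of \<open>A\<^sub>\<xi> \<xi> = 0\<close>.\<close>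

lemma A_horizontal_skew:
  assumes x: "x \<in> pts M" and \<xi>: "\<xi> \<in> HH x" "\<eta> \<in> HH x" shows "A x \<eta> \<xi> = - A x \<xi> \<eta>"
proof -
  have "A x (\<xi> + \<eta>) (\<xi> + \<eta>) = 0" by (rule A_horizontal_self[OF x subspace_add[OF subH[OF x] \<xi>]])
  moreover have "A x (\<xi> + \<eta>) (\<xi> + \<eta>) = A x \<xi> \<xi> + A x \<xi> \<eta> + (A x \<eta> \<xi> + A x \<eta> \<eta>)"
    by (simp add: bilinear_ladd[OF bilinear_A[OF x]] bilinear_radd[OF bilinear_A[OF x]])
  ultimately show ?thesis using A_horizontal_self[OF x] \<xi> by (simp add: eq_neg_iff_add_eq_0 add.commute)
qed

text \<open>By absence of torsion \<open>V [X, Y] = A\<^sub>X Y - A\<^sub>Y X\<close>, and \<open>A\<close> is skew on horizontal vectors.\<close>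

lemma A_bracket:
  assumes x: "x \<in> pts M" and X: "smooth_vf M X" "\<And>y. y \<in> pts M \<Longrightarrow> X y \<in> HH y"
    and Y: "smooth_vf M Y" "\<And>y. y \<in> pts M \<Longrightarrow> Y y \<in> HH y"
  shows "2 *\<^sub>R A x (X x) (Y x) = V (lie_bracket M X Y) x"
proof -
  have HA: "A x (X x) (Y x) = orth_proj (R x) (VV x) (conn X Y x)"
    if sm: "smooth_vf M X" "smooth_vf M Y" and h: "\<And>y. y \<in> pts M \<Longrightarrow> Y y \<in> HH y" for X Y
  proof -
    have "conn X (H Y) x = conn X Y x"
      by (rule connection_cong[OF affine sm(1) smooth_H[OF sm(2)] sm(2) _ x]) (rule H_ident[OF _ h])
    then show ?thesis using A_eq[OF x sm] by (simp add: vf_proj_def[of R VV])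
  qed
  have "A x (X x) (Y x) - A x (Y x) (X x) = V (lie_bracket M X Y) x"
    using HA[OF X(1) Y] HA[OF Y(1) X] linear_diff[OF linV[OF x], of "conn X Y x" "conn Y X x"]
      torsion_free[OF x X(1) Y(1)]
    by (simp add: vf_proj_def[of R VV])
  then show ?thesis using A_horizontal_skew[OF x X(2)[OF x] Y(2)[OF x]] by (simp add: scaleR_2)
qed

text \<open>Horizontal fields satisfy \<open>H Y = Y\<close>, so \<open>D Y = (D H) Y + H D Y\<close>; antisymmetrising turns the
  terms \<open>D Y\<close> into the Lie bracket.\<close>

lemma ambient_V_bracket:
  fixes \<iota> :: "'m \<Rightarrow> 'e::euclidean_space"
  assumes amb: "ambient_structure M R \<iota> g" and x: "x \<in> pts M"
    and X: "smooth_vf M X" "\<And>y. y \<in> pts M \<Longrightarrow> X y \<in> HH y"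
    and Y: "smooth_vf M Y" "\<And>y. y \<in> pts M \<Longrightarrow> Y y \<in> HH y"
  shows "dird M \<iota> x (V (lie_bracket M X Y) x) =
    blinfun_apply (dird M (amb_proj M \<iota> g HH) x (X x)) (dird M \<iota> x (Y x)) -
    blinfun_apply (dird M (amb_proj M \<iota> g HH) x (Y x)) (dird M \<iota> x (X x))"
proof -
  interpret ambient_mfd M R \<iota> g by unfold_locales (rule amb)
  let ?P = "blinfun_apply (amb_proj M \<iota> g HH x)" and ?w = "lie_bracket M X Y x"
  have com: "dird M (\<lambda>y. d y (Y y)) x (X x) - dird M (\<lambda>y. d y (X y)) x (Y x) = d x ?w"
    by (rule dird_commutator[OF smooth_fun_imp_smooth_fun_on[OF smooth_embedding] openin_pts x X(1) Y(1)])
  have "V (lie_bracket M X Y) x = ?w - orth_proj (R x) (HH x) ?w"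
    using H_eq_minus_V[OF x, of ?w] by (simp add: vf_proj_def[of R VV])
  then have "d x (V (lie_bracket M X Y) x) = d x ?w - ?P (d x ?w)"
    by (simp add: linear_diff[OF linear_d[OF x]] amb_proj_d[OF subbundles(1) x])
  also have "?P (d x ?w) = ?P (dird M (\<lambda>y. d y (Y y)) x (X x)) - ?P (dird M (\<lambda>y. d y (X y)) x (Y x))"
    unfolding com[symmetric] by (rule blinfun.diff_right)
  finally have "d x (V (lie_bracket M X Y) x) =
      (dird M (\<lambda>y. d y (Y y)) x (X x) - ?P (dird M (\<lambda>y. d y (Y y)) x (X x))) -
      (dird M (\<lambda>y. d y (X y)) x (Y x) - ?P (dird M (\<lambda>y. d y (X y)) x (Y x)))"
    unfolding com[symmetric] by simp
  moreover have "dird M (\<lambda>y. d y (Z y)) x \<zeta> - ?P (dird M (\<lambda>y. d y (Z y)) x \<zeta>) =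
      blinfun_apply (dird M (amb_proj M \<iota> g HH) x \<zeta>) (d x (Z x))"
    if "smooth_vf M Z" "\<And>y. y \<in> pts M \<Longrightarrow> Z y \<in> HH y" for Z \<zeta>
    unfolding diff_eq_eq add.commute[of "blinfun_apply (dird M (amb_proj M \<iota> g HH) x \<zeta>) (d x (Z x))"]
    by (rule dird_section[OF subbundles(1) that x])
  ultimately show ?thesis using X Y by simp
qed

end

section \<open>The tensor \<open>A\<close>, its ambient expressions and submersions\<close>

theorem lemma5p3:
  fixes M :: "('m, 'n::euclidean_space) manifold"
    and R :: "'m \<Rightarrow> 'n \<Rightarrow> 'n \<Rightarrow> real"
    and conn :: "('m \<Rightarrow> 'n) \<Rightarrow> ('m \<Rightarrow> 'n) \<Rightarrow> 'm \<Rightarrow> 'n"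
    and HH VV :: "'m \<Rightarrow> 'n set"
  assumes "riemannian_manifold M R"
    and "levi_civita M R conn"
    and "subbundle M HH" and "subbundle M VV"
    and "orthogonal_bundles M R HH VV"
  shows "let H = vf_proj R HH; V = vf_proj R VV;
             A = A_tensor M R conn HH VV; A' = A_adj M R conn HH VV in
    tensor_1_2 M (\<lambda>c1 c2. V (conn c1 (H c2))) \<and>
    (\<forall>x\<in>pts M. \<forall>\<xi> \<eta>. \<exists>c1 c2. smooth_vf M c1 \<and> smooth_vf M c2 \<and> c1 x = \<xi> \<and> c2 x = \<eta>) \<and>
    (\<forall>c1 c2. smooth_vf M c1 \<and> smooth_vf M c2 \<longrightarrow>
       (\<forall>x\<in>pts M. A x (c1 x) (c2 x) = V (conn c1 (H c2)) x)) \<and>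
    (\<forall>x\<in>pts M. bilinear (A x)) \<and>
    (\<forall>c1 c2. smooth_vf M c1 \<and> smooth_vf M c2 \<longrightarrow> smooth_vf M (\<lambda>x. A x (c1 x) (c2 x))) \<and>
    (\<forall>c1 c3. smooth_vf M c1 \<and> smooth_vf M c3 \<longrightarrow>
       (\<forall>x\<in>pts M. A' x (c1 x) (c3 x) = - H (conn c1 (V c3)) x)) \<and>
    (\<forall>c1 c2 c3. smooth_vf M c1 \<and> smooth_vf M c2 \<and> smooth_vf M c3 \<longrightarrow>
       (\<forall>x\<in>pts M. R x (H (conn c1 (V c3)) x) (c2 x) = - R x (c3 x) (V (conn c1 (H c2)) x))) \<and>

    (\<forall>(\<iota> :: 'm \<Rightarrow> 'e::euclidean_space) g \<Gamma>.
       ambient_structure M R \<iota> g \<and> christoffel M conn \<iota> \<Gamma> \<longrightarrow>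
       (let d = dird M \<iota>; PH = amb_proj M \<iota> g HH; PV = amb_proj M \<iota> g VV;
            \<Gamma>r = Gamma_ring M \<iota> g \<Gamma>;
            \<Gamma>H = Gamma_sub M \<iota> g \<Gamma> HH; \<Gamma>V = Gamma_sub M \<iota> g \<Gamma> VV in
        (\<forall>c1 c2 c3. smooth_vf M c1 \<and> smooth_vf M c2 \<and> smooth_vf M c3 \<longrightarrow> (\<forall>x\<in>pts M.
           d x (A x (c1 x) (c2 x)) =
             - blinfun_apply (dird M PV x (c1 x)) (blinfun_apply (PH x) (d x (c2 x)))
             + blinfun_apply (PV x) (\<Gamma>r x (c1 x) (blinfun_apply (PH x) (d x (c2 x)))) \<and>
           d x (A' x (c1 x) (c3 x)) =
             blinfun_apply (dird M PH x (c1 x)) (blinfun_apply (PV x) (d x (c3 x)))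
             - blinfun_apply (PH x) (\<Gamma>r x (c1 x) (blinfun_apply (PV x) (d x (c3 x)))) \<and>
           d x (A x (c1 x) (c2 x)) = \<Gamma>V x (c1 x) (blinfun_apply (PH x) (d x (c2 x))) \<and>
           d x (A' x (c1 x) (c3 x)) = - \<Gamma>H x (c1 x) (blinfun_apply (PV x) (d x (c3 x))))) \<and>
        (\<forall>x\<in>pts M. \<forall>\<xi> \<eta>.
           d x (A x \<xi> \<eta>) = \<Gamma>V x \<xi> (blinfun_apply (PH x) (d x \<eta>)) \<and>
           d x (A' x \<xi> \<eta>) = - \<Gamma>H x \<xi> (blinfun_apply (PV x) (d x \<eta>))))) \<and>

    (\<forall>(B :: ('b, 'k::euclidean_space) manifold) RB q.
       riemannian_submersion M R B RB q \<and>
       (\<forall>x\<in>pts M. HH x = horizontal M R B q x \<and> VV x = vertical M B q x) \<longrightarrow>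
       (\<forall>x\<in>pts M. \<forall>\<xi> \<eta> c1 c2.
          smooth_vf M c1 \<and> smooth_vf M c2 \<and>
          (\<forall>y\<in>pts M. c1 y \<in> HH y \<and> c2 y \<in> HH y) \<and> c1 x = \<xi> \<and> c2 x = \<eta> \<longrightarrow>
          2 *\<^sub>R A x \<xi> \<eta> = V (lie_bracket M c1 c2) x \<and>
          (\<forall>(\<iota> :: 'm \<Rightarrow> 'e) g. ambient_structure M R \<iota> g \<longrightarrow>
             (let d = dird M \<iota>; PH = amb_proj M \<iota> g HH in
              d x (V (lie_bracket M c1 c2) x) =
                blinfun_apply (dird M PH x \<xi>) (d x \<eta>) - blinfun_apply (dird M PH x \<eta>) (d x \<xi>)))))"
proof -
  interpret orthogonal_subbundles M R conn HH VV
    using assms by unfold_locales (auto simp: riemannian_manifold_def)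
  let ?A' = "A_adj M R conn HH VV"
  have T: "tensor_1_2 M (\<lambda>c1 c2. V (conn c1 (H c2)))" by (rule tensor_VconnH)
  have ext: "\<forall>x\<in>pts M. \<forall>\<xi> \<eta>. \<exists>c1 c2. smooth_vf M c1 \<and> smooth_vf M c2 \<and> c1 x = \<xi> \<and> c2 x = \<eta>"
    using tangent_vector_extends by metis
  have ambient: "\<forall>\<xi> \<eta>. dird M \<iota> x (A x \<xi> \<eta>) = Gamma_sub M \<iota> g \<Gamma> VV x \<xi> (blinfun_apply (amb_proj M \<iota> g HH x) (dird M \<iota> x \<eta>)) \<and>
      dird M \<iota> x (?A' x \<xi> \<eta>) = - Gamma_sub M \<iota> g \<Gamma> HH x \<xi> (blinfun_apply (amb_proj M \<iota> g VV x) (dird M \<iota> x \<eta>))"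
    if amb: "ambient_structure M R \<iota> g" and \<Gamma>: "christoffel M conn \<iota> \<Gamma>" and x: "x \<in> pts M"
    for \<iota> :: "'m \<Rightarrow> 'e" and g \<Gamma> x
  proof -
    interpret ambient_subbundles M R conn HH VV \<iota> g by unfold_locales (rule amb)
    interpret sw: orthogonal_subbundles M R conn VV HH by (rule swap_subbundles)
    interpret sw: ambient_subbundles M R conn VV HH \<iota> g by unfold_locales
    show ?thesis
      using ambient_A[OF \<Gamma> x] sw.ambient_A[OF \<Gamma> x] A_adj_swap[OF x] by (simp add: linear_neg[OF linear_d[OF x]])
  qed
  have submersion: "2 *\<^sub>R A x (c1 x) (c2 x) = V (lie_bracket M c1 c2) x \<and>
      (ambient_structure M R \<iota> g \<longrightarrow> dird M \<iota> x (V (lie_bracket M c1 c2) x) =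
        blinfun_apply (dird M (amb_proj M \<iota> g HH) x (c1 x)) (dird M \<iota> x (c2 x)) -
        blinfun_apply (dird M (amb_proj M \<iota> g HH) x (c2 x)) (dird M \<iota> x (c1 x)))"
    if sub: "riemannian_submersion M R B RB q"
      and HV: "\<forall>x\<in>pts M. HH x = horizontal M R B q x \<and> VV x = vertical M B q x"
      and c: "x \<in> pts M" "smooth_vf M c1" "smooth_vf M c2" "\<forall>y\<in>pts M. c1 y \<in> HH y \<and> c2 y \<in> HH y"
    for B :: "('b, 'k) manifold" and RB q x c1 c2 and \<iota> :: "'m \<Rightarrow> 'e" and g
  proof -
    interpret submersion_subbundles M R conn HH VV B RB q
      using sub HV by unfold_locales auto
    show ?thesis using A_bracket[OF c(1,2) _ c(3)] ambient_V_bracket[OF _ c(1,2) _ c(3)] c(4) by blast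
  qed
  show ?thesis
    unfolding Let_def
  proof (intro conjI allI impI ballI)
    fix B :: "('b, 'k) manifold" and RB q x \<xi> \<eta> c1 c2
    assume *: "riemannian_submersion M R B RB q \<and> (\<forall>x\<in>pts M. HH x = horizontal M R B q x \<and> VV x = vertical M B q x)"
      "x \<in> pts M"
      "smooth_vf M c1 \<and> smooth_vf M c2 \<and> (\<forall>y\<in>pts M. c1 y \<in> HH y \<and> c2 y \<in> HH y) \<and> c1 x = \<xi> \<and> c2 x = \<eta>"
    show "2 *\<^sub>R A x \<xi> \<eta> = V (lie_bracket M c1 c2) x"
      using submersion[of B RB q x c1 c2] * by simp
    show "dird M \<iota> x (V (lie_bracket M c1 c2) x) =
        blinfun_apply (dird M (amb_proj M \<iota> g HH) x \<xi>) (dird M \<iota> x \<eta>) -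
        blinfun_apply (dird M (amb_proj M \<iota> g HH) x \<eta>) (dird M \<iota> x \<xi>)"
      if "ambient_structure M R \<iota> g" for \<iota> :: "'m \<Rightarrow> 'e" and g
      using submersion[of B RB q x c1 c2 \<iota> g] * that by simp
  qed ((elim conjE, frule (2) ambient, simp add: Gamma_sub_def; fail) |
      (use T ext in \<open>auto simp: A_eq bilinear_A smooth_A A_adj_eq HconnV_adjoint\<close>; fail))+
qed

end
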